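(* Let $\bm{p}=(p_i)_{i=1}^k$, $k\le\infty$, be a decreasing probability mass function with flat regions of known lengths $\bm{w}=(w_1,w_2,\dots)$, let $X_1,\dots,X_n$ be i.i.d. with probability mass function $\bm{p}$, let $\hat{\bm{p}}^{*}_n$ be the maximum likelihood estimator of $\bm{p}$ under the order restriction and the known flat regions, and let $\hat{\bm{p}}^{G}_n$ be the Grenander estimator. For the $l_2$ metric, $$\lim_{n\to\infty}\mathbb{E}[n\,l_2^2(\hat{\bm{p}}^{*}_n,\bm{p})]\le\lim_{n\to\infty}\mathbb{E}[n\,l_2^2(\hat{\bm{p}}^{G}_n,\bm{p})],$$ and for the Hellinger distance, when $k<\infty$, $$\lim_{n\to\infty}\mathbb{E}[n\,H^2(\hat{\bm{p}}^{*}_n,\bm{p})]\le\lim_{n\to\infty}\mathbb{E}[n\,H^2(\hat{\bm{p}}^{G}_n,\bm{p})].$$ Equalities hold if and only if the true probability mass function $\bm{p}$ is strictly monotone (on its support $\{i\in\mathbb{N}_+: i\le k\}$).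
   Context: Setting. $\bm{p}$ is a probability mass function on $\mathbb{N}_+=\{1,2,\dots\}$, $k=\sup\{i:p_i>0\}\le\infty$, $p_i>0$ for all $i\in\mathbb{N}_+$ with $i\le k$, $\sum_ip_i=1$, and $$p_1=\dots=p_{w_1}>p_{w_1+1}=\dots=p_{w_1+w_2}>\dots,$$ ending, when $k<\infty$, with the last block $p_{\sum_{j=1}^{m-1}w_j+1}=\dots=p_k$. Here $m\le\infty$ is the number of flat regions and $w_j\ge1$ (an integer) is the length of the $j$-th one, so $\sum_{j=1}^mw_j=k$; $m=\infty$ exactly when $k=\infty$. Let $q_j=1+\sum_{l<j}w_l$ be the first index of the $j$-th flat region. Write $\mathbb{R}_+=[0,\infty)$, $0^0=1$, $n_i=\sum_{l=1}^n1\{X_l=i\}$ and $\hat p_{n,i}=n_i/n$ (the empirical estimator). For $k=\infty$ the sets below consist of sequences satisfying the analogous constraints. New estimator: $$\hat{\bm{p}}^{*}_n=\underset{\bm{f}\in\mathcal{F}^*_k}{\mathrm{argmax}}\ \prod_{i=1}^kf_i^{n_i},$$ where $\mathcal{F}^*_k$ is the set of $\bm{f}\in\mathbb{R}_+^k$ with $\sum_{i=1}^kf_i=1$, $f_1\ge f_2\ge\dots\ge f_k$, and $f$ constant on each block $\{q_j,q_j+1,\dots,q_j+w_j-1\}$. Grenander estimator (order restricted MLE, equivalently isotonic regression of the empirical estimator): $$\hat{\bm{p}}^{G}_n=\underset{\bm{f}\in\mathcal{F}_k}{\mathrm{argmin}}\ \sum_{i=1}^k[\hat p_{n,i}-f_i]^2,\qquad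 \mathcal{F}_k=\Big\{\bm{f}\in\mathbb{R}_+^k:\ \sum_{i=1}^kf_i=1,\ f_1\ge f_2\ge\dots\ge f_k\Big\}.$$ Losses: $l_2^2(\hat{\bm{p}},\bm{p})=\sum_{i=1}^k(\hat p_i-p_i)^2$ for $k\le\infty$, and $H^2(\hat{\bm{p}},\bm{p})=\frac12\sum_{i=1}^k(\sqrt{\hat p_i}-\sqrt{p_i})^2$ for $k<\infty$. All limits are as $n\to\infty$ with $\bm{p}$ fixed; their existence is part of the assertion. *)

theory Defs
  imports "HOL-Probability.Probability"
begin

definition idx :: "enat \<Rightarrow> nat set" where
  "idx k = {i. 1 \<le> i \<and> enat i \<le> k}"

definition first_index :: "(nat \<Rightarrow> nat) \<Rightarrow> nat \<Rightarrow> nat" where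
  "first_index w j = 1 + (\<Sum>l = 1..<j. w l)"

definition block :: "(nat \<Rightarrow> nat) \<Rightarrow> nat \<Rightarrow> nat set" where
  "block w j = {first_index w j ..< first_index w j + w j}"

text \<open>
  Both \<open>k\<close> and the number of blocks \<open>m\<close> may be infinite; the block lengths are
  \<open>w j\<close> for \<open>j \<in> idx m\<close>, and their sum is taken in the extended naturals. The sum
  condition makes the blocks a partition of \<open>idx k\<close> and forces \<open>m = \<infinity>\<close> exactly
  when \<open>k = \<infinity>\<close>.
\<close>

definition flat_regions :: "enat \<Rightarrow> enat \<Rightarrow> (nat \<Rightarrow> nat) \<Rightarrow> (nat \<Rightarrow> real) \<Rightarrow> bool" where
  "flat_regions k m w p \<longleftrightarrow>
     (\<forall>j\<in>idx m. 1 \<le> w j) \<and>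
     (\<Sum>\<^sub>\<infinity>j\<in>idx m. enat (w j)) = k \<and>
     (\<forall>j\<in>idx m. \<forall>i\<in>block w j. p i = p (first_index w j)) \<and>
     (\<forall>j. j \<in> idx m \<longrightarrow> Suc j \<in> idx m \<longrightarrow>
        p (first_index w (Suc j)) < p (first_index w j))"

text \<open>
  Vectors indexed by \<open>{1..k}\<close> (sequences if \<open>k = \<infinity>\<close>) are functions on \<open>nat\<close> that
  vanish outside \<open>idx k\<close>, so that equality of functions is equality of vectors.
\<close>

definition decreasing_pmfs :: "enat \<Rightarrow> (nat \<Rightarrow> real) set" where
  "decreasing_pmfs k =
     {f. (\<forall>i. i \<notin> idx k \<longrightarrow> f i = 0) \<and> (\<forall>i\<in>idx k. 0 \<le> f i) \<and>
         (f has_sum 1) (idx k) \<and> antimono_on (idx k) f}"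

definition flat_decreasing_pmfs :: "enat \<Rightarrow> enat \<Rightarrow> (nat \<Rightarrow> nat) \<Rightarrow> (nat \<Rightarrow> real) set" where
  "flat_decreasing_pmfs k m w =
     {f \<in> decreasing_pmfs k. \<forall>j\<in>idx m. \<forall>i\<in>block w j. f i = f (first_index w j)}"

definition count_obs :: "nat \<Rightarrow> (nat \<Rightarrow> nat) \<Rightarrow> nat \<Rightarrow> nat" where
  "count_obs n x i = card {l \<in> {1..n}. x l = i}"

definition empirical :: "nat \<Rightarrow> (nat \<Rightarrow> nat) \<Rightarrow> nat \<Rightarrow> real" where
  "empirical n x i = real (count_obs n x i) / real n"

text \<open>Only finitely many factors of the product differ from 1, as \<open>0 ^ 0 = 1\<close>.\<close>

definition likelihood :: "enat \<Rightarrow> nat \<Rightarrow> (nat \<Rightarrow> nat) \<Rightarrow> (nat \<Rightarrow> real) \<Rightarrow> real" where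
  "likelihood k n x f = (\<Prod>i. if i \<in> idx k then f i ^ count_obs n x i else 1)"

text \<open>
  For \<open>n \<ge> 1\<close> and observations \<open>x 1, \<dots>, x n\<close> in \<open>idx k\<close>, the optimisers below exist
  and are unique.
\<close>

definition flat_mle :: "enat \<Rightarrow> enat \<Rightarrow> (nat \<Rightarrow> nat) \<Rightarrow> nat \<Rightarrow> (nat \<Rightarrow> nat) \<Rightarrow> nat \<Rightarrow> real" where
  "flat_mle k m w n x = arg_max_on (likelihood k n x) (flat_decreasing_pmfs k m w)"

definition grenander :: "enat \<Rightarrow> nat \<Rightarrow> (nat \<Rightarrow> nat) \<Rightarrow> nat \<Rightarrow> real" where
  "grenander k n x =
     arg_min_on (\<lambda>f. \<Sum>\<^sub>\<infinity>i\<in>idx k. (empirical n x i - f i)\<^sup>2) (decreasing_pmfs k)"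

definition l2_sq :: "enat \<Rightarrow> (nat \<Rightarrow> real) \<Rightarrow> (nat \<Rightarrow> real) \<Rightarrow> real" where
  "l2_sq k f p = (\<Sum>\<^sub>\<infinity>i\<in>idx k. (f i - p i)\<^sup>2)"

definition hellinger_sq :: "enat \<Rightarrow> (nat \<Rightarrow> real) \<Rightarrow> (nat \<Rightarrow> real) \<Rightarrow> real" where
  "hellinger_sq k f p = 1 / 2 * (\<Sum>\<^sub>\<infinity>i\<in>idx k. (sqrt (f i) - sqrt (p i))\<^sup>2)"

definition scaled_risk ::
  "'a measure \<Rightarrow> (nat \<Rightarrow> 'a \<Rightarrow> nat) \<Rightarrow> ((nat \<Rightarrow> real) \<Rightarrow> (nat \<Rightarrow> real) \<Rightarrow> real) \<Rightarrow>
     (nat \<Rightarrow> (nat \<Rightarrow> nat) \<Rightarrow> nat \<Rightarrow> real) \<Rightarrow> (nat \<Rightarrow> real) \<Rightarrow> nat \<Rightarrow> real" where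
  "scaled_risk M X loss est p n =
     (\<integral>\<omega>. real n * loss (est n (\<lambda>l. X l \<omega>)) p \<partial>M)"

end

theory Submission
  imports Defs "HOL-Real_Asymp.Real_Asymp"
begin

text \<open>
  Both estimators are isotonic regressions, that is, slopes of least concave majorants of partial
  sums: the Grenander estimator is the regression of the empirical frequencies
  (\<open>grenander_eq_isoreg\<close>), and the maximum likelihood estimator is the regression of their averages
  over the known flat regions (\<open>flat_mle_eq_isoreg\<close>). The second fact combines Gibbs' inequality with
  the orthogonality of the residual of a regression to all functions of the regression.

  By Hoeffding's inequality the frequencies are uniformly close to \<open>p\<close> except with exponentially small
  probability (\<open>prob_not_close_emp\<close>). As \<open>p\<close> drops strictly at the end of each flat region, the
  regression then acts on the first \<open>J\<close> regions separately (\<open>isoreg_block\<close>), and on the remaining labels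
  it is a contraction towards \<open>p\<close>, so that these contribute at most the tail of \<open>p\<close> to the scaled risk.
  Hence the limit of the scaled risk is the sum over all regions of the risks of the local regressions
  (\<open>l2_risk_tendsto\<close>). For the Hellinger loss, which is to second order a squared error with weights
  \<open>1 / (8 * p)\<close>, the same holds with these weights (\<open>hellinger_risk_tendsto\<close>).

  Consider a region of length \<open>w\<close> on which \<open>p\<close> has the value \<open>q\<close>. For averages the local risk is a
  binomial variance, \<open>q - w * q\<^sup>2\<close>. For the isotonic regression the local risk also has a closed form that
  is exact for every sample size (\<open>expectation_isoreg_block\<close>). The sum of squares of the regression is
  an integral over \<open>t\<close> of the maxima of the partial sums of the frequencies shifted by \<open>t\<close>
  (\<open>is_isoreg_sum_squares\<close>), and the frequencies within a region are exchangeable, so that the expected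
  maximum is given by Spitzer's identity, proved in integrated form in
  \<open>expectation_integral_run_max\<close>. The result is \<open>q * H - w * q\<^sup>2\<close> with the harmonic number \<open>H\<close> of
  \<open>w\<close>. The two local risks thus differ by \<open>q * (H - 1)\<close>, which is nonnegative and vanishes exactly if
  \<open>w = 1\<close>. All regions have length 1 if and only if \<open>p\<close> is strictly decreasing.
\<close>

section \<open>Isotonic regression on a window\<close>

text \<open>
  Optimality conditions for the projection of \<open>y\<close> onto the vectors that decrease on the window
  \<open>{a..<c}\<close>: the partial sums of \<open>f\<close> form the least concave majorant of those of \<open>y\<close>. All
  properties of the projection, including that it minimises a distance, follow from them by
  summation by parts.
\<close>

definition is_isoreg :: "nat \<Rightarrow> nat \<Rightarrow> (nat \<Rightarrow> real) \<Rightarrow> (nat \<Rightarrow> real) \<Rightarrow> bool" where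
  "is_isoreg a c y f \<longleftrightarrow>
     antimono_on {a..<c} f \<and>
     (\<forall>j\<in>{a..c}. sum y {a..<j} \<le> sum f {a..<j}) \<and>
     sum f {a..<c} = sum y {a..<c} \<and>
     (\<forall>j\<in>{a<..<c}. f j < f (j - 1) \<longrightarrow> sum f {a..<j} = sum y {a..<j})"

lemma abel_summation:
  fixes d h :: "nat \<Rightarrow> real"
  assumes "a \<le> c"
  shows "(\<Sum>i=a..<Suc c. d i * h i) =
     sum d {a..<Suc c} * h c + (\<Sum>j\<in>{a<..c}. sum d {a..<j} * (h (j - 1) - h j))"
  using assms
proof (induction c rule: dec_induct)
  case base
  then show ?case by simp
next
  case (step n)
  have *: "{a<..Suc n} = insert (Suc n) {a<..n}" using step by auto
  show ?case using step by (simp add: * algebra_simps)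
qed

text \<open>
  Summation by parts pairs the gaps between the partial sums of \<open>y\<close> and \<open>f\<close>, which are nonpositive,
  with the decrements of \<open>h\<close>, which are nonnegative.
\<close>

lemma is_isoreg_inner_antimono:
  assumes f: "is_isoreg a c y f" and h: "antimono_on {a..<c} h"
  shows "(\<Sum>i=a..<c. (y i - f i) * h i) \<le> 0"
proof (cases "a < c")
  case True
  then obtain c' where c: "c = Suc c'" "a \<le> c'" by (cases c) auto
  have "(\<Sum>i=a..<c. (y i - f i) * h i)
      = (\<Sum>j\<in>{a<..c'}. (sum y {a..<j} - sum f {a..<j}) * (h (j - 1) - h j))"
    using f unfolding c(1) abel_summation[OF c(2)]
    by (simp add: sum_subtractf is_isoreg_def)
  also have "\<dots> \<le> 0"
  proof (intro sum_nonpos mult_nonpos_nonneg)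
    fix j assume j: "j \<in> {a<..c'}"
    show "sum y {a..<j} - sum f {a..<j} \<le> 0"
      using f j c unfolding is_isoreg_def by auto
    show "0 \<le> h (j - 1) - h j"
    proof -
      have "j - 1 \<in> {a..<c}" "j \<in> {a..<c}" using j c by auto
      then show ?thesis using monotone_onD[OF h, of "j - 1" j] by auto
    qed
  qed
  finally show ?thesis .
qed auto

text \<open>
  For \<open>h = \<psi> \<circ> f\<close> the decrements vanish unless \<open>f\<close> jumps, and there the gap vanishes. The choice
  of \<open>\<psi>\<close> matters below: the identity gives a Pythagorean inequality, indicators control level sets,
  and the logarithm turns least squares into maximum likelihood.
\<close>

lemma is_isoreg_inner_self:
  assumes f: "is_isoreg a c y f"
  shows "(\<Sum>i=a..<c. (y i - f i) * \<psi> (f i)) = 0"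
proof (cases "a < c")
  case True
  then obtain c' where c: "c = Suc c'" "a \<le> c'" by (cases c) auto
  have "(\<Sum>i=a..<c. (y i - f i) * \<psi> (f i))
      = (\<Sum>j\<in>{a<..c'}. (sum y {a..<j} - sum f {a..<j}) * (\<psi> (f (j - 1)) - \<psi> (f j)))"
    using f unfolding c(1) abel_summation[OF c(2), where h = "\<lambda>i. \<psi> (f i)"]
    by (simp add: sum_subtractf is_isoreg_def)
  also have "\<dots> = 0"
  proof (intro sum.neutral ballI)
    fix j assume j: "j \<in> {a<..c'}"
    have am: "antimono_on {a..<c} f" using f by (simp add: is_isoreg_def)
    have "j - 1 \<in> {a..<c}" "j \<in> {a..<c}" using j c by auto
    then have "f j \<le> f (j - 1)" using monotone_onD[OF am, of "j - 1" j] by simp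
    then consider "f j = f (j - 1)" | "f j < f (j - 1)" by linarith
    then show "(sum y {a..<j} - sum f {a..<j}) * (\<psi> (f (j - 1)) - \<psi> (f j)) = 0"
      by cases (use f j c in \<open>auto simp: is_isoreg_def\<close>)
  qed
  finally show ?thesis .
qed auto

text \<open>
  Adding the variational inequalities of two solutions leaves minus their squared distance.
\<close>

lemma is_isoreg_unique:
  assumes f: "is_isoreg a c y f" and g: "is_isoreg a c y g" and i: "i \<in> {a..<c}"
  shows "f i = g i"
proof -
  have am: "antimono_on {a..<c} f" "antimono_on {a..<c} g"
    using f g by (auto simp: is_isoreg_def)
  have "(\<Sum>i=a..<c. (f i - g i)\<^sup>2) =
      (\<Sum>i=a..<c. (y i - f i) * g i) - (\<Sum>i=a..<c. (y i - f i) * f i)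
      + (\<Sum>i=a..<c. (y i - g i) * f i) - (\<Sum>i=a..<c. (y i - g i) * g i)"
    by (simp add: sum.distrib[symmetric] sum_subtractf[symmetric] power2_eq_square algebra_simps)
  also have "\<dots> \<le> 0"
    using is_isoreg_inner_antimono[OF f am(2)] is_isoreg_inner_antimono[OF g am(1)]
      is_isoreg_inner_self[OF f, of "\<lambda>x. x"] is_isoreg_inner_self[OF g, of "\<lambda>x. x"]
    by simp
  finally have "(\<Sum>i=a..<c. (f i - g i)\<^sup>2) = 0"
    by (intro antisym sum_nonneg) auto
  then show ?thesis using i by (subst (asm) sum_nonneg_eq_0_iff) auto
qed

text \<open>
  Expand the square around \<open>f\<close>: the cross term is nonnegative by the two inner product lemmas.
\<close>

lemma is_isoreg_contraction:
  assumes f: "is_isoreg a c y f" and p: "antimono_on {a..<c} p"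
  shows "(\<Sum>i=a..<c. (f i - p i)\<^sup>2) \<le> (\<Sum>i=a..<c. (y i - p i)\<^sup>2)"
proof -
  have "(\<Sum>i=a..<c. (y i - p i)\<^sup>2) - (\<Sum>i=a..<c. (f i - p i)\<^sup>2) =
     (\<Sum>i=a..<c. (y i - f i)\<^sup>2) + 2 * (\<Sum>i=a..<c. (y i - f i) * f i)
       - 2 * (\<Sum>i=a..<c. (y i - f i) * p i)"
    by (simp add: sum.distrib[symmetric] sum_subtractf[symmetric] sum_distrib_left
        power2_eq_square algebra_simps)
  moreover have "(\<Sum>i=a..<c. (y i - f i)\<^sup>2) \<ge> 0" by (intro sum_nonneg) auto
  ultimately show ?thesis
    using is_isoreg_inner_antimono[OF f p] is_isoreg_inner_self[OF f, of "\<lambda>x. x"]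
    by linarith
qed

text \<open>
  The residual \<open>y - f\<close> is orthogonal to the indicator of \<open>f < v\<close> but positive on that set.
\<close>

lemma is_isoreg_ge:
  assumes f: "is_isoreg a c y f" and y: "\<And>i. i \<in> {a..<c} \<Longrightarrow> v \<le> y i" and i: "i \<in> {a..<c}"
  shows "v \<le> f i"
proof -
  have "(\<Sum>i=a..<c. (y i - f i) * of_bool (f i < v)) = 0"
    using is_isoreg_inner_self[OF f] .
  moreover have "(y i - f i) * of_bool (f i < v) \<ge> 0" if "i \<in> {a..<c}" for i
    using y[OF that] by auto
  ultimately have "(y i - f i) * of_bool (f i < v) = 0"
    using i by (subst (asm) sum_nonneg_eq_0_iff) auto
  then show ?thesis using y[OF i] by (auto split: if_splits)
qed

lemma is_isoreg_le:
  assumes f: "is_isoreg a c y f" and y: "\<And>i. i \<in> {a..<c} \<Longrightarrow> y i \<le> v" and i: "i \<in> {a..<c}"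
  shows "f i \<le> v"
proof -
  have "(\<Sum>i=a..<c. (y i - f i) * (- of_bool (v < f i))) = 0"
    using is_isoreg_inner_self[OF f] .
  moreover have "(y i - f i) * (- of_bool (v < f i)) \<ge> 0" if "i \<in> {a..<c}" for i
    using y[OF that] by auto
  ultimately have "(y i - f i) * (- of_bool (v < f i)) = 0"
    using i by (subst (asm) sum_nonneg_eq_0_iff) auto
  then show ?thesis using y[OF i] by (auto split: if_splits)
qed

text \<open>
  The partial sums of both parts agree with those of \<open>y\<close> at the seam \<open>j\<close>, so a majorant on each side
  is a majorant on the whole window; concavity only needs that the slope does not increase at \<open>j\<close>.
\<close>

lemma is_isoreg_append:
  assumes g: "is_isoreg a j y g" and h: "is_isoreg j c y h" and "a \<le> j" "j \<le> c"
    and gh: "a < j \<Longrightarrow> j < c \<Longrightarrow> h j \<le> g (j - 1)"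
  shows "is_isoreg a c y (\<lambda>i. if i < j then g i else h i)"
proof -
  let ?f = "\<lambda>i. if i < j then g i else h i"
  have left: "sum ?f {a..<l} = sum g {a..<l}" if "l \<le> j" for l
    using that by (intro sum.cong) auto
  have split: "sum u {a..<l} = sum u {a..<j} + sum u {j..<l}" if "j \<le> l" for l and u :: "nat \<Rightarrow> real"
    using that \<open>a \<le> j\<close> by (simp add: sum.atLeastLessThan_concat)
  have right: "sum ?f {a..<l} = sum y {a..<j} + sum h {j..<l}" if "j \<le> l" for l
  proof -
    have "sum ?f {j..<l} = sum h {j..<l}" by (intro sum.cong) auto
    then show ?thesis using split[OF that, of ?f] left[of j] g by (simp add: is_isoreg_def)
  qed
  show ?thesis unfolding is_isoreg_def
  proof (intro conjI ballI impI)
    show "antimono_on {a..<c} ?f"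
    proof (rule monotone_onI)
      fix u v assume uv: "u \<in> {a..<c}" "v \<in> {a..<c}" "u \<le> v"
      show "?f u \<ge> ?f v"
      proof (cases "u < j \<and> j \<le> v")
        case True
        then have "g (j - 1) \<le> g u" "h v \<le> h j"
          using g h uv unfolding is_isoreg_def by (auto simp: monotone_on_def)
        then show ?thesis using gh True uv by auto
      next
        case False
        then show ?thesis using g h uv unfolding is_isoreg_def by (auto simp: monotone_on_def)
      qed
    qed
    show "sum y {a..<l} \<le> sum ?f {a..<l}" if "l \<in> {a..c}" for l
      using that g h left right split[of l y]
      by (cases "l \<le> j") (auto simp: is_isoreg_def simp del: sum.If_cases)
    show "sum ?f {a..<c} = sum y {a..<c}"
      using right[of c] split[of c y] h \<open>j \<le> c\<close> by (auto simp: is_isoreg_def)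
    show "sum ?f {a..<l} = sum y {a..<l}" if "l \<in> {a<..<c}" "?f l < ?f (l - 1)" for l
    proof (cases l j rule: linorder_cases)
      case less
      then have "l \<in> {a<..<j}" "g l < g (l - 1)" using that by (auto split: if_splits)
      then show ?thesis using g left[of l] less by (auto simp: is_isoreg_def)
    next
      case equal
      then show ?thesis using right[of j] by auto
    next
      case greater
      then have l: "l \<in> {j<..<c}" "\<not> l - 1 < j" "\<not> l < j" using that(1) by auto
      then have "h l < h (l - 1)" using that(2) by simp
      then have "sum h {j..<l} = sum y {j..<l}" using h l(1) unfolding is_isoreg_def by blast
      then show ?thesis using right[of l] split[of l y] greater by linarith
    qed
  qed
qed

text \<open>
  The maximum of the partial sums of length \<open>0, \<dots>, m\<close>. Recursion from the front exposes the first
  summand, which is what the argument for Spitzer's identity takes out.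
\<close>

primrec run_max :: "nat \<Rightarrow> (nat \<Rightarrow> real) \<Rightarrow> real" where
  "run_max 0 z = 0"
| "run_max (Suc m) z = max 0 (z 0 + run_max m (\<lambda>i. z (Suc i)))"

lemma run_max_nonneg: "0 \<le> run_max m z"
  by (cases m) auto

lemma run_max_Suc_right: "run_max (Suc m) z = max (run_max m z) (sum z {..<Suc m})"
proof (induction m arbitrary: z)
  case (Suc m)
  have "run_max (Suc (Suc m)) z = max 0 (z 0 + run_max (Suc m) (\<lambda>i. z (Suc i)))" by simp
  also have "\<dots> = max 0 (z 0 + max (run_max m (\<lambda>i. z (Suc i))) (\<Sum>i<Suc m. z (Suc i)))"
    by (subst Suc.IH) simp
  also have "\<dots> = max (run_max (Suc m) z) (sum z {..<Suc (Suc m)})"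
    unfolding sum.lessThan_Suc_shift[of z "Suc m"] by (auto simp: max_def)
  finally show ?case .
qed auto

lemma sum_le_run_max: "j \<le> m \<Longrightarrow> sum z {..<j} \<le> run_max m z"
proof (induction m)
  case (Suc m)
  then show ?case unfolding run_max_Suc_right
    by (cases "j = Suc m") (auto simp: le_max_iff_disj)
qed auto

lemma run_max_attained: "\<exists>j\<le>m. run_max m z = sum z {..<j}"
proof (induction m)
  case (Suc m)
  then obtain j where "j \<le> m" "run_max m z = sum z {..<j}" by auto
  then show ?case unfolding run_max_Suc_right
    by (cases "run_max m z \<le> sum z {..<Suc m}") (auto simp: max_def intro: le_SucI)
qed auto

text \<open>
  Legendre duality: a function and its least concave majorant have the same conjugate. The maximum
  on the right is attained at the first index \<open>j\<close> with \<open>f j \<le> t\<close>, which is a point of contact. This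
  formula is the bridge from the regression, which is not linear in \<open>y\<close>, to maxima of
  partial sums.
\<close>

lemma is_isoreg_sum_pos_part:
  assumes f: "is_isoreg a c y f" and "a \<le> c"
  shows "(\<Sum>i=a..<c. max 0 (f i - t)) = run_max (c - a) (\<lambda>i. y (a + i) - t)"
proof (rule antisym)
  have shift: "(\<Sum>i<j - a. u (a + i)) = sum u {a..<j}" if "a \<le> j" for j and u :: "nat \<Rightarrow> real"
    using that sum.shift_bounds_nat_ivl[of u 0 a "j - a"]
    by (simp add: atLeast0LessThan add.commute)
  let ?z = "\<lambda>i. y (a + i) - t"
  have z: "sum ?z {..<j - a} = (\<Sum>i=a..<j. y i - t)" if "a \<le> j" for j
    using shift[OF that, of "\<lambda>i. y i - t"] by simp
  have am: "f v \<le> f u" if "a \<le> u" "u \<le> v" "v < c" for u v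
    using f that by (auto simp: is_isoreg_def monotone_on_def)
  show "run_max (c - a) ?z \<le> (\<Sum>i=a..<c. max 0 (f i - t))"
  proof -
    obtain j0 where j0: "j0 \<le> c - a" "run_max (c - a) ?z = sum ?z {..<j0}"
      using run_max_attained by blast
    define j where "j = a + j0"
    have j: "a \<le> j" "j \<le> c" "j0 = j - a" using j0 \<open>a \<le> c\<close> by (auto simp: j_def)
    have "sum ?z {..<j0} = (\<Sum>i=a..<j. y i - t)" using z j by simp
    also have "\<dots> \<le> (\<Sum>i=a..<j. f i - t)"
      using f j by (auto simp: is_isoreg_def sum_subtractf)
    also have "\<dots> \<le> (\<Sum>i=a..<j. max 0 (f i - t))" by (intro sum_mono) auto
    also have "\<dots> \<le> (\<Sum>i=a..<c. max 0 (f i - t))"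
      using j by (intro sum_mono2) auto
    finally show ?thesis using j0 by simp
  qed
  show "(\<Sum>i=a..<c. max 0 (f i - t)) \<le> run_max (c - a) ?z"
  proof -
    define j where "j = (LEAST j. a \<le> j \<and> (j = c \<or> f j \<le> t))"
    have j: "a \<le> j \<and> (j = c \<or> f j \<le> t)" unfolding j_def
      by (rule LeastI[of _ c]) (use \<open>a \<le> c\<close> in auto)
    have jc: "j \<le> c" unfolding j_def by (rule Least_le) (use \<open>a \<le> c\<close> in auto)
    have below: "f i > t" if "i \<in> {a..<j}" for i
    proof (rule ccontr)
      assume "\<not> t < f i"
      then have "j \<le> i" unfolding j_def using that by (intro Least_le) auto
      then show False using that by auto
    qed
    have above: "f i \<le> t" if "i \<in> {j..<c}" for i
      using am[of j i] j that jc by auto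
    have "(\<Sum>i=a..<c. max 0 (f i - t)) = (\<Sum>i=a..<j. max 0 (f i - t)) + (\<Sum>i=j..<c. max 0 (f i - t))"
      using j jc by (simp add: sum.atLeastLessThan_concat)
    also have "(\<Sum>i=j..<c. max 0 (f i - t)) = 0"
      using above by (intro sum.neutral) auto
    also have "(\<Sum>i=a..<j. max 0 (f i - t)) = (\<Sum>i=a..<j. f i - t)"
      using below by (intro sum.cong) (auto simp: max_def dest: less_imp_le)
    also have "(\<Sum>i=a..<j. f i - t) + 0 = (\<Sum>i=a..<j. y i - t)"
    proof -
      consider "j = a" | "j = c" | "a < j" "j < c" using j jc by linarith
      then have "sum f {a..<j} = sum y {a..<j}"
      proof cases
        case 3
        then have "t < f (j - 1)" "f j \<le> t" using below[of "j - 1"] above[of j] by auto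
        then have "f j < f (j - 1)" by linarith
        then show ?thesis using f 3 by (auto simp: is_isoreg_def)
      qed (use f in \<open>auto simp: is_isoreg_def\<close>)
      then show ?thesis by (simp add: sum_subtractf)
    qed
    also have "\<dots> \<le> run_max (c - a) ?z"
      using sum_le_run_max[of "j - a" "c - a" ?z] z[of j] j jc by auto
    finally show ?thesis .
  qed
qed

text \<open>
  The initial segment of largest average \<open>s j\<close> becomes the first level set, and the rest is treated
  recursively. The next level cannot exceed \<open>s j\<close>, since the first segment together with a segment of
  larger average would have an average above the maximum.
\<close>

lemma is_isoreg_exists: "\<exists>f. is_isoreg a c y f"
proof (induction "c - a" arbitrary: a rule: less_induct)
  case less
  show ?case
  proof (cases "a < c")
    case False
    then show ?thesis by (auto simp: is_isoreg_def monotone_on_def)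
  next
    case True
    define s where "s j = sum y {a..<j} / real (j - a)" for j
    have "\<exists>j\<in>{a<..c}. \<forall>l\<in>{a<..c}. s l \<le> s j"
      using True finite_imageI[of "{a<..c}" s] Max_in[of "s ` {a<..c}"] Max_ge[of "s ` {a<..c}"]
      by (metis (no_types, lifting) empty_iff finite_greaterThanAtMost greaterThanAtMost_iff
          image_eqI image_iff image_is_empty order_refl)
    then obtain j where j: "j \<in> {a<..c}" and max: "\<And>l. l \<in> {a<..c} \<Longrightarrow> s l \<le> s j" by auto
    have part: "sum y {a..<l} \<le> s j * real (l - a)" if "l \<in> {a..c}" for l
    proof (cases "l = a")
      case False
      then have "s l \<le> s j" "real (l - a) > 0" using that max by auto
      then show ?thesis by (auto simp: s_def[of l] field_simps)
    qed auto
    have sumj: "sum y {a..<j} = s j * real (j - a)" using j by (auto simp: s_def)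
    have "c - j < c - a" using j by auto
    then obtain g where g: "is_isoreg j c y g" using less by blast
    have "g i \<le> s j" if i: "i \<in> {j..<c}" for i
    proof -
      obtain l where l: "l \<le> c - j"
        "run_max (c - j) (\<lambda>i. y (j + i) - s j) = (\<Sum>i<l. y (j + i) - s j)"
        using run_max_attained by blast
      have "(\<Sum>i<l. y (j + i)) = sum y {j..<j + l}"
        using sum.shift_bounds_nat_ivl[of y 0 j l] by (simp add: atLeast0LessThan add.commute)
      also have "\<dots> = sum y {a..<j + l} - sum y {a..<j}"
        using j sum.atLeastLessThan_concat[of a j "j + l" y] by simp
      also have "\<dots> \<le> s j * real l"
      proof -
        have "j + l \<in> {a..c}" "j + l - a = (j - a) + l" using l(1) j by auto
        then have "sum y {a..<j + l} \<le> s j * real ((j - a) + l)" using part[of "j + l"] by metis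
        then show ?thesis using sumj by (simp only: of_nat_add distrib_left)
      qed
      finally have "(\<Sum>i=j..<c. max 0 (g i - s j)) \<le> 0"
        using is_isoreg_sum_pos_part[OF g, of "s j"] l j by (auto simp: sum_subtractf mult.commute)
      then have "(\<Sum>i=j..<c. max 0 (g i - s j)) = 0"
        by (intro antisym sum_nonneg) auto
      then have "max 0 (g i - s j) = 0" using i by (subst (asm) sum_nonneg_eq_0_iff) auto
      then show ?thesis by linarith
    qed
    moreover have "is_isoreg a j y (\<lambda>_. s j)"
      unfolding is_isoreg_def using part sumj j by (auto simp: monotone_on_def mult.commute)
    ultimately have "is_isoreg a c y (\<lambda>i. if i < j then s j else g i)"
      using g j by (intro is_isoreg_append) auto
    then show ?thesis by blast
  qed
qed

definition isoreg :: "nat \<Rightarrow> nat \<Rightarrow> (nat \<Rightarrow> real) \<Rightarrow> nat \<Rightarrow> real" where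
  "isoreg a c y = (\<lambda>i. if i \<in> {a..<c} then (SOME f. is_isoreg a c y f) i else 0)"

lemma is_isoreg_cong:
  assumes "\<And>i. i \<in> {a..<c} \<Longrightarrow> y i = y' i" "\<And>i. i \<in> {a..<c} \<Longrightarrow> f i = f' i"
  shows "is_isoreg a c y f \<longleftrightarrow> is_isoreg a c y' f'"
proof -
  have *: "is_isoreg a c y' f'" if "is_isoreg a c y f" 
      "\<And>i. i \<in> {a..<c} \<Longrightarrow> y i = y' i" "\<And>i. i \<in> {a..<c} \<Longrightarrow> f i = f' i" for y y' f f'
  proof -
    have s: "sum y {a..<j} = sum y' {a..<j}" "sum f {a..<j} = sum f' {a..<j}" if "j \<le> c" for j
      using \<open>\<And>i. i \<in> {a..<c} \<Longrightarrow> y i = y' i\<close> \<open>\<And>i. i \<in> {a..<c} \<Longrightarrow> f i = f' i\<close> that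
      by (auto intro!: sum.cong)
    have v: "f j = f' j" "f (j - 1) = f' (j - 1)" if "j \<in> {a<..<c}" for j
    proof -
      have "j - 1 \<in> {a..<c}" "j \<in> {a..<c}" using that by auto
      then show "f j = f' j" "f (j - 1) = f' (j - 1)"
        using \<open>\<And>i. i \<in> {a..<c} \<Longrightarrow> f i = f' i\<close> by blast+
    qed
    show ?thesis
      using that(1) s v that(3) unfolding is_isoreg_def monotone_on_def by (auto simp: less_imp_le)
  qed
  show ?thesis using *[of y f y' f'] *[of y' f' y f] assms by auto
qed

lemma is_isoreg_isoreg: "is_isoreg a c y (isoreg a c y)"
proof -
  have "is_isoreg a c y (SOME f. is_isoreg a c y f)"
    using is_isoreg_exists by (rule someI_ex)
  then show ?thesis
    by (subst is_isoreg_cong[of _ _ y y _ "SOME f. is_isoreg a c y f"]) (auto simp: isoreg_def)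
qed

lemma isoreg_outside: "i \<notin> {a..<c} \<Longrightarrow> isoreg a c y i = 0"
  by (auto simp: isoreg_def)

lemma isoreg_eqI: "is_isoreg a c y f \<Longrightarrow> i \<in> {a..<c} \<Longrightarrow> isoreg a c y i = f i"
  using is_isoreg_unique[OF is_isoreg_isoreg] by blast

text \<open>
  If everything left of \<open>j\<close> lies above everything right of it, then so do the two regressions, and
  no pooling takes place across \<open>j\<close>.
\<close>

lemma isoreg_split:
  assumes "a \<le> j" "j \<le> c"
    and l: "\<And>i. i \<in> {a..<j} \<Longrightarrow> v \<le> y i" and r: "\<And>i. i \<in> {j..<c} \<Longrightarrow> y i \<le> v"
  shows "isoreg a c y i = (if i < j then isoreg a j y i else isoreg j c y i)"
proof (cases "i \<in> {a..<c}")
  case True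
  have "is_isoreg a c y (\<lambda>i. if i < j then isoreg a j y i else isoreg j c y i)"
  proof (rule is_isoreg_append[OF is_isoreg_isoreg is_isoreg_isoreg assms(1,2)])
    assume "a < j" "j < c"
    then have "v \<le> isoreg a j y (j - 1)" "isoreg j c y j \<le> v"
      by (auto intro: is_isoreg_ge[OF is_isoreg_isoreg l] is_isoreg_le[OF is_isoreg_isoreg r])
    then show "isoreg j c y j \<le> isoreg a j y (j - 1)" by simp
  qed
  then show ?thesis using isoreg_eqI True by blast
qed (use assms in \<open>auto simp: isoreg_outside\<close>)

lemma isoreg_antimono_id:
  "antimono_on {a..<c} y \<Longrightarrow> i \<in> {a..<c} \<Longrightarrow> isoreg a c y i = y i"
  by (rule isoreg_eqI) (auto simp: is_isoreg_def)

section \<open>A Spitzer identity for the regression\<close>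

lemma continuous_on_run_max [continuous_intros]:
  "continuous_on A (\<lambda>t. run_max m (\<lambda>i. z i - t))"
proof (induction m arbitrary: z)
  case (Suc m)
  show ?case using Suc[of "\<lambda>i. z (Suc i)"] by (auto intro!: continuous_intros)
qed auto

lemma run_max_le:
  assumes "\<And>i. i < m \<Longrightarrow> z i \<le> B" "0 \<le> B"
  shows "run_max m z \<le> real m * B"
proof -
  obtain j where "j \<le> m" "run_max m z = sum z {..<j}" using run_max_attained by blast
  moreover have "sum z {..<j} \<le> real (card {..<j}) * B"
    using assms \<open>j \<le> m\<close> by (intro sum_bounded_above) auto
  moreover have "real j * B \<le> real m * B" using \<open>j \<le> m\<close> assms by (intro mult_right_mono) auto
  ultimately show ?thesis by simp
qed

text \<open>
  If the total is nonnegative, some maximal partial sum is nonempty and contains the first summand;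
  if it is nonpositive, the longest partial sum can be left out.
\<close>

lemma run_max_step:
  fixes z z' :: "nat \<Rightarrow> real"
  assumes z': "z' = (\<lambda>i. z (Suc i))"
  shows "0 \<le> sum z {..<Suc m} \<Longrightarrow> run_max (Suc m) z = z 0 + run_max m z'"
    and "sum z {..<Suc m} \<le> 0 \<Longrightarrow> run_max (Suc m) z = run_max m z"
proof -
  assume "0 \<le> sum z {..<Suc m}"
  also have "\<dots> = z 0 + sum z' {..<m}" using sum.lessThan_Suc_shift[of z m] z' by simp
  also have "\<dots> \<le> z 0 + run_max m z'" using sum_le_run_max[of m m z'] by simp
  finally show "run_max (Suc m) z = z 0 + run_max m z'"
    unfolding run_max.simps z' by (simp add: max_def)
next
  assume "sum z {..<Suc m} \<le> 0"
  then show "run_max (Suc m) z = run_max m z"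
    unfolding run_max_Suc_right using run_max_nonneg[of m z] by simp
qed

text \<open>
  Shifting all summands by \<open>t\<close> changes the sign of the total exactly at their average \<open>s\<close>, where the
  integral is cut.
\<close>

lemma integral_run_max_step:
  assumes "\<And>i. i \<le> m \<Longrightarrow> 0 \<le> z i \<and> z i \<le> 1" and s: "s = sum z {..<Suc m} / real (Suc m)"
  shows "integral {0..1} (\<lambda>t. run_max (Suc m) (\<lambda>i. z i - t)) =
     s * z 0 - s\<^sup>2 / 2 + integral {0..s} (\<lambda>t. run_max m (\<lambda>i. z (Suc i) - t))
       + integral {s..1} (\<lambda>t. run_max m (\<lambda>i. z i - t))"
    and "0 \<le> s" "s \<le> 1"
proof -
  have "sum z {..<Suc m} \<le> real (card {..<Suc m}) * 1"
    using assms(1) by (intro sum_bounded_above) auto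
  then show s1: "s \<le> 1" unfolding s by simp
  have "0 \<le> sum z {..<Suc m}" using assms(1) by (intro sum_nonneg) auto
  then show s0: "0 \<le> s" unfolding s by simp
  have S: "(\<Sum>i<Suc m. z i - t) = real (Suc m) * (s - t)" for t
    unfolding s by (simp add: sum_subtractf field_simps)
  have i: "(\<lambda>t. run_max n (\<lambda>i. u i - t)) integrable_on {a..b}" for n and u :: "nat \<Rightarrow> real" and a b
    by (intro integrable_continuous_interval continuous_intros)
  have lin: "((\<lambda>t. z 0 - t) has_integral (s * z 0 - s\<^sup>2 / 2)) {0..s}"
    using fundamental_theorem_of_calculus[OF s0, of "\<lambda>t. t * z 0 - t\<^sup>2 / 2" "\<lambda>t. z 0 - t"]
    by (force simp: has_real_derivative_iff_has_vector_derivative[symmetric]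
        intro!: derivative_eq_intros)
  have "integral {0..1} (\<lambda>t. run_max (Suc m) (\<lambda>i. z i - t)) =
     integral {0..s} (\<lambda>t. run_max (Suc m) (\<lambda>i. z i - t))
     + integral {s..1} (\<lambda>t. run_max (Suc m) (\<lambda>i. z i - t))"
    using Henstock_Kurzweil_Integration.integral_combine[OF s0 s1 i, symmetric] .
  also have "integral {0..s} (\<lambda>t. run_max (Suc m) (\<lambda>i. z i - t)) =
      integral {0..s} (\<lambda>t. (z 0 - t) + run_max m (\<lambda>i. z (Suc i) - t))"
    by (intro integral_cong run_max_step(1)) (auto simp: S simp del: sum.lessThan_Suc)
  also have "\<dots> = s * z 0 - s\<^sup>2 / 2 + integral {0..s} (\<lambda>t. run_max m (\<lambda>i. z (Suc i) - t))"
    using lin i[where u = "\<lambda>i. z (Suc i)"]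
    by (subst integral_add) (auto simp: has_integral_integrable_integral)
  also have "integral {s..1} (\<lambda>t. run_max (Suc m) (\<lambda>i. z i - t)) =
      integral {s..1} (\<lambda>t. run_max m (\<lambda>i. z i - t))"
    by (intro integral_cong run_max_step(2))
      (auto simp: S mult_nonneg_nonpos simp del: sum.lessThan_Suc)
  finally show "integral {0..1} (\<lambda>t. run_max (Suc m) (\<lambda>i. z i - t)) =
     s * z 0 - s\<^sup>2 / 2 + integral {0..s} (\<lambda>t. run_max m (\<lambda>i. z (Suc i) - t))
       + integral {s..1} (\<lambda>t. run_max m (\<lambda>i. z i - t))" .
qed

lemma integral_run_max_bounds:
  assumes z: "\<And>i. i < m \<Longrightarrow> 0 \<le> z i \<and> z i \<le> 1" and "0 \<le> a" "a \<le> b" "b \<le> 1"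
  shows "0 \<le> integral {a..b} (\<lambda>t. run_max m (\<lambda>i. z i - t))"
    and "integral {a..b} (\<lambda>t. run_max m (\<lambda>i. z i - t)) \<le> real m"
proof -
  have i: "(\<lambda>t. run_max m (\<lambda>i. z i - t)) integrable_on {a..b}"
    by (intro integrable_continuous_interval continuous_intros)
  show "0 \<le> integral {a..b} (\<lambda>t. run_max m (\<lambda>i. z i - t))"
    by (intro integral_nonneg i run_max_nonneg)
  have "integral {a..b} (\<lambda>t. run_max m (\<lambda>i. z i - t)) \<le> integral {a..b} (\<lambda>t. real m)"
  proof (intro integral_le i)
    fix t assume t: "t \<in> {a..b}"
    have "z i - t \<le> 1" if "i < m" for i using z[OF that] t assms(2) by auto
    then have "run_max m (\<lambda>i. z i - t) \<le> real m * 1"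
      by (intro run_max_le) auto
    then show "run_max m (\<lambda>i. z i - t) \<le> real m" by simp
  qed auto
  also have "\<dots> = (b - a) * real m" using assms by simp
  also have "\<dots> \<le> 1 * real m" using assms by (intro mult_right_mono) auto
  finally show "integral {a..b} (\<lambda>t. run_max m (\<lambda>i. z i - t)) \<le> real m" by simp
qed

lemma integrable_pmf_bounded:
  fixes f :: "'a \<Rightarrow> real"
  assumes "\<And>x. x \<in> set_pmf Q \<Longrightarrow> \<bar>f x\<bar> \<le> B"
  shows "integrable (measure_pmf Q) f"
  by (rule measure_pmf.integrable_const_bound[where B = B]) (use assms in \<open>auto simp: AE_measure_pmf_iff\<close>)

lemma run_max_cong: "(\<And>i. i < m \<Longrightarrow> z i = z' i) \<Longrightarrow> run_max m z = run_max m z'"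
proof (induction m arbitrary: z z')
  case (Suc m)
  have "run_max m (\<lambda>i. z (Suc i)) = run_max m (\<lambda>i. z' (Suc i))" using Suc.prems by (intro Suc.IH) auto
  then show ?case using Suc.prems[of 0] by simp
qed auto

text \<open>
  The integral over all shifts \<open>t\<close> of Spitzer's identity for the expected maximum of exchangeable
  partial sums. In the step from \<open>m\<close> to \<open>m + 1\<close> summands, a rotation of the coordinates leaves the
  average \<open>s\<close> unchanged and turns the shifted vector into the original one, so that the two pieces of
  the preceding lemma recombine to the integral for \<open>m\<close> and only \<open>s\<^sup>2 / 2\<close> is new. Integrating before
  taking expectations avoids an exchange of integrals.
\<close>

lemma expectation_integral_run_max:
  fixes Z :: "'b \<Rightarrow> nat \<Rightarrow> real" and Q :: "'b pmf"
  assumes Z: "\<And>x i. x \<in> set_pmf Q \<Longrightarrow> i < w \<Longrightarrow> 0 \<le> Z x i \<and> Z x i \<le> 1"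
    and rot: "\<And>m. m < w \<Longrightarrow> map_pmf (rot m) Q = Q"
    and Z_rot: "\<And>m x i. x \<in> set_pmf Q \<Longrightarrow> m < w \<Longrightarrow> i \<le> m \<Longrightarrow>
                  Z (rot m x) i = Z x (if i = m then 0 else Suc i)"
  shows "measure_pmf.expectation Q (\<lambda>x. integral {0..1} (\<lambda>t. run_max w (\<lambda>i. Z x i - t))) =
    (\<Sum>r<w. measure_pmf.expectation Q (\<lambda>x. ((\<Sum>i<Suc r. Z x i) / real (Suc r))\<^sup>2)) / 2"
proof -
  have "n \<le> w \<Longrightarrow>
    measure_pmf.expectation Q (\<lambda>x. integral {0..1} (\<lambda>t. run_max n (\<lambda>i. Z x i - t))) =
    (\<Sum>r<n. measure_pmf.expectation Q (\<lambda>x. ((\<Sum>i<Suc r. Z x i) / real (Suc r))\<^sup>2)) / 2" for n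
  proof (induction n)
    case (Suc m)
    then have m: "m < w" by simp
    let ?E = "measure_pmf.expectation Q"
    define s where "s x = (\<Sum>i<Suc m. Z x i) / real (Suc m)" for x
    define I where "I z a b = integral {a..b} (\<lambda>t. run_max m (\<lambda>i. z i - t))" for a b :: real and z
    have Z01: "0 \<le> Z x i \<and> Z x i \<le> 1" if "x \<in> set_pmf Q" "i \<le> m" for x i
      using Z that m by auto
    have step: "integral {0..1} (\<lambda>t. run_max (Suc m) (\<lambda>i. Z x i - t)) =
        s x * Z x 0 - (s x)\<^sup>2 / 2 + I (\<lambda>i. Z x (Suc i)) 0 (s x) + I (Z x) (s x) 1"
      and s0: "0 \<le> s x" and s1: "s x \<le> 1" if "x \<in> set_pmf Q" for x
    proof -
      have z: "0 \<le> Z x i \<and> Z x i \<le> 1" if "i \<le> m" for i using Z01 that \<open>x \<in> set_pmf Q\<close> by blast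
      note * = integral_run_max_step[of m "Z x" "s x", OF z s_def]
      show "integral {0..1} (\<lambda>t. run_max (Suc m) (\<lambda>i. Z x i - t)) =
        s x * Z x 0 - (s x)\<^sup>2 / 2 + I (\<lambda>i. Z x (Suc i)) 0 (s x) + I (Z x) (s x) 1"
        unfolding I_def by (rule *(1))
      show "0 \<le> s x" by (rule *(2))
      show "s x \<le> 1" by (rule *(3))
    qed
    have rotE: "?E (\<lambda>x. F (rot m x)) = ?E F" for F :: "'b \<Rightarrow> real"
    proof -
      have "?E F = measure_pmf.expectation (map_pmf (rot m) Q) F" using rot[OF m] by simp
      then show ?thesis by (simp add: integral_map_pmf)
    qed
    have s_rot: "s (rot m x) = s x" if "x \<in> set_pmf Q" for x
    proof -
      have "(\<Sum>i<Suc m. Z (rot m x) i) = (\<Sum>i<m. Z x (Suc i)) + Z x 0"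
        using Z_rot[OF that m] by simp
      also have "\<dots> = (\<Sum>i<Suc m. Z x i)"
        unfolding sum.lessThan_Suc_shift by simp
      finally show ?thesis by (simp add: s_def)
    qed
    have int: "integrable Q F" if "\<And>x. x \<in> set_pmf Q \<Longrightarrow> \<bar>F x\<bar> \<le> B" for F and B :: real
      by (rule integrable_pmf_bounded[of _ _ B]) (use that in auto)
    have sZ: "\<bar>s x * Z x i\<bar> \<le> 1" if "x \<in> set_pmf Q" "i \<le> m" for x i
      using s0[OF that(1)] s1[OF that(1)] Z01[OF that] by (simp add: abs_mult mult_le_one)
    have s2: "\<bar>(s x)\<^sup>2\<bar> \<le> 1" if "x \<in> set_pmf Q" for x
      using s0[OF that] s1[OF that] by (simp add: power_le_one)
    have Ib: "\<bar>I (\<lambda>i. Z x (Suc i)) 0 (s x)\<bar> \<le> real m" "\<bar>I (Z x) (s x) 1\<bar> \<le> real m"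
      "\<bar>I (Z x) 0 (s x)\<bar> \<le> real m" if "x \<in> set_pmf Q" for x
      using integral_run_max_bounds[of m "\<lambda>i. Z x (Suc i)" 0 "s x"]
        integral_run_max_bounds[of m "Z x" "s x" 1]
        integral_run_max_bounds[of m "Z x" 0 "s x"] Z01[OF that] s0[OF that] s1[OF that]
      unfolding I_def by (auto simp: Suc_le_eq)
    have i1: "integrable Q (\<lambda>x. s x * Z x i)" if "i \<le> m" for i
      using sZ that by (intro int)
    have i2: "integrable Q (\<lambda>x. (s x)\<^sup>2)"
      using s2 by (intro int)
    have i3: "integrable Q (\<lambda>x. I (\<lambda>i. Z x (Suc i)) 0 (s x))"
      using Ib(1) by (intro int)
    have i4: "integrable Q (\<lambda>x. I (Z x) (s x) 1)"
      using Ib(2) by (intro int)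
    have i5: "integrable Q (\<lambda>x. I (Z x) 0 (s x))"
      using Ib(3) by (intro int)
    \<comment> \<open>all coordinates have the same mixed moment with their average\<close>
    have sZ_eq: "?E (\<lambda>x. s x * Z x i) = ?E (\<lambda>x. s x * Z x 0)" if "i \<le> m" for i
      using that
    proof (induction i)
      case (Suc i)
      have "?E (\<lambda>x. s x * Z x (Suc i)) = ?E (\<lambda>x. s (rot m x) * Z (rot m x) i)"
        using Suc.prems s_rot Z_rot[OF _ m, of _ i]
        by (intro integral_cong_AE) (auto simp: AE_measure_pmf_iff)
      also have "\<dots> = ?E (\<lambda>x. s x * Z x i)" by (rule rotE)
      finally show ?case using Suc by simp
    qed simp
    have "real (Suc m) * ?E (\<lambda>x. s x * Z x 0) = (\<Sum>i<Suc m. ?E (\<lambda>x. s x * Z x i))"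
    proof -
      have "(\<Sum>i<Suc m. ?E (\<lambda>x. s x * Z x i)) = (\<Sum>i<Suc m. ?E (\<lambda>x. s x * Z x 0))"
        by (rule sum.cong) (auto intro: sZ_eq)
      then show ?thesis by (simp only: sum_constant card_lessThan)
    qed
    also have "\<dots> = ?E (\<lambda>x. \<Sum>i<Suc m. s x * Z x i)"
      by (rule Bochner_Integration.integral_sum[symmetric]) (rule i1, simp)
    also have "(\<lambda>x. \<Sum>i<Suc m. s x * Z x i) = (\<lambda>x. real (Suc m) * (s x)\<^sup>2)"
    proof
      fix x
      have "(\<Sum>i<Suc m. s x * Z x i) = s x * (\<Sum>i<Suc m. Z x i)"
        by (rule sum_distrib_left[symmetric])
      also have "(\<Sum>i<Suc m. Z x i) = real (Suc m) * s x"
        by (simp only: s_def nonzero_mult_div_cancel_left times_divide_eq_right of_nat_eq_0_iff nat.distinct simp_thms)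
      finally show "(\<Sum>i<Suc m. s x * Z x i) = real (Suc m) * (s x)\<^sup>2"
        by (simp only: power2_eq_square ac_simps)
    qed
    finally have E1: "?E (\<lambda>x. s x * Z x 0) = ?E (\<lambda>x. (s x)\<^sup>2)" by simp
    have "?E (\<lambda>x. I (\<lambda>i. Z x (Suc i)) 0 (s x)) = ?E (\<lambda>x. I (Z (rot m x)) 0 (s (rot m x)))"
    proof (intro integral_cong_AE)
      have "run_max m (\<lambda>i. Z (rot m x) i - t) = run_max m (\<lambda>i. Z x (Suc i) - t)"
        if "x \<in> set_pmf Q" for x t
        using Z_rot[OF that m] by (intro run_max_cong) auto
      then show "AE x in Q. I (\<lambda>i. Z x (Suc i)) 0 (s x) = I (Z (rot m x)) 0 (s (rot m x))"
        by (auto simp: AE_measure_pmf_iff s_rot I_def)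
    qed auto
    also have "\<dots> = ?E (\<lambda>x. I (Z x) 0 (s x))" by (rule rotE)
    finally have E2: "?E (\<lambda>x. I (\<lambda>i. Z x (Suc i)) 0 (s x)) = ?E (\<lambda>x. I (Z x) 0 (s x))" .
    have "?E (\<lambda>x. integral {0..1} (\<lambda>t. run_max (Suc m) (\<lambda>i. Z x i - t))) =
        ?E (\<lambda>x. s x * Z x 0 - (s x)\<^sup>2 / 2 + I (\<lambda>i. Z x (Suc i)) 0 (s x) + I (Z x) (s x) 1)"
      using step by (intro integral_cong_AE) (auto simp: AE_measure_pmf_iff)
    also have "\<dots> = ?E (\<lambda>x. s x * Z x 0) - ?E (\<lambda>x. (s x)\<^sup>2) / 2
        + ?E (\<lambda>x. I (\<lambda>i. Z x (Suc i)) 0 (s x)) + ?E (\<lambda>x. I (Z x) (s x) 1)"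
      using i1[of 0] i2 i3 i4 by simp
    also have "\<dots> = ?E (\<lambda>x. (s x)\<^sup>2) / 2 + (?E (\<lambda>x. I (Z x) 0 (s x)) + ?E (\<lambda>x. I (Z x) (s x) 1))"
      unfolding E1 E2 by simp
    also have "?E (\<lambda>x. I (Z x) 0 (s x)) + ?E (\<lambda>x. I (Z x) (s x) 1) = 
       ?E (\<lambda>x. I (Z x) 0 (s x) + I (Z x) (s x) 1)"
      using i4 i5 by simp
    also have "\<dots> = ?E (\<lambda>x. I (Z x) 0 1)"
    proof (intro integral_cong_AE)
      have "I (Z x) 0 (s x) + I (Z x) (s x) 1 = I (Z x) 0 1" if "x \<in> set_pmf Q" for x
        unfolding I_def using s0[OF that] s1[OF that]
        by (intro Henstock_Kurzweil_Integration.integral_combine integrable_continuous_interval continuous_intros)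
      then show "AE x in Q. I (Z x) 0 (s x) + I (Z x) (s x) 1 = I (Z x) 0 1"
        by (auto simp: AE_measure_pmf_iff)
    qed auto
    finally show ?case using Suc.IH m by (simp add: s_def I_def add_divide_distrib)
  qed simp
  then show ?thesis by blast
qed

lemma integral_pos_part:
  assumes "0 \<le> x" "x \<le> (1::real)"
  shows "((\<lambda>t. max 0 (x - t)) has_integral x\<^sup>2 / 2) {0..1}"
proof -
  have "((\<lambda>t. x - t) has_integral x\<^sup>2 / 2) {0..x}"
    using fundamental_theorem_of_calculus[OF assms(1), of "\<lambda>t. t * x - t\<^sup>2 / 2" "\<lambda>t. x - t"]
    by (force simp: has_real_derivative_iff_has_vector_derivative[symmetric] power2_eq_square
        intro!: derivative_eq_intros)
  then have 1: "((\<lambda>t. max 0 (x - t)) has_integral x\<^sup>2 / 2) {0..x}"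
    by (rule has_integral_eq[rotated]) auto
  have "((\<lambda>t. max 0 (x - t)) has_integral 0) {x..1}"
    by (rule has_integral_is_0) auto
  then show ?thesis using has_integral_combine[OF assms 1, of 0] by simp
qed

text \<open>
  Since \<open>x\<^sup>2 = 2 \<integral> max 0 (x - t) dt\<close> for \<open>x\<close> in the unit interval, Legendre duality
  integrates to a formula for the sum of squares.
\<close>

lemma is_isoreg_sum_squares:
  assumes f: "is_isoreg a c y f" and "a \<le> c" and y: "\<And>i. i \<in> {a..<c} \<Longrightarrow> 0 \<le> y i \<and> y i \<le> 1"
  shows "(\<Sum>i=a..<c. (f i)\<^sup>2) = 2 * integral {0..1} (\<lambda>t. run_max (c - a) (\<lambda>i. y (a + i) - t))"
proof -
  have f01: "0 \<le> f i \<and> f i \<le> 1" if "i \<in> {a..<c}" for i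
    using is_isoreg_ge[OF f _ that, of 0] is_isoreg_le[OF f _ that, of 1] y by auto
  have "((\<lambda>t. \<Sum>i=a..<c. max 0 (f i - t)) has_integral (\<Sum>i=a..<c. (f i)\<^sup>2 / 2)) {0..1}"
    using f01 by (intro has_integral_sum integral_pos_part) auto
  then show ?thesis
    unfolding is_isoreg_sum_pos_part[OF f \<open>a \<le> c\<close>]
    by (auto simp: integral_unique sum_divide_distrib[symmetric])
qed

section \<open>Empirical frequencies of an i.i.d. sample\<close>

lemma replicate_pmf_Suc_pair:
  "replicate_pmf (Suc n) p = map_pmf (\<lambda>(x, xs). x # xs) (pair_pmf p (replicate_pmf n p))"
  by (simp add: pair_pmf_def map_bind_pmf bind_return_pmf map_pmf_def bind_assoc_pmf)

lemma map_replicate_pmf: "map_pmf (map f) (replicate_pmf n p) = replicate_pmf n (map_pmf f p)"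
proof (induction n)
  case (Suc n)
  show ?case
    unfolding replicate_pmf.simps Suc[symmetric] by (simp add: map_bind_pmf bind_map_pmf)
qed simp

lemma pmf_replicate_pmf:
  "pmf (replicate_pmf (length xs) p) xs = (\<Prod>i<length xs. pmf p (xs ! i))"
proof (induction xs)
  case (Cons x xs)
  have "inj (\<lambda>(x, xs). x # xs :: 'a list)" by (auto simp: inj_def)
  from pmf_map_inj'[OF this, of "pair_pmf p (replicate_pmf (length xs) p)" "(x, xs)"]
  have "pmf (replicate_pmf (length (x # xs)) p) (x # xs) = pmf p x * pmf (replicate_pmf (length xs) p) xs"
    unfolding length_Cons replicate_pmf_Suc_pair by (simp add: pmf_pair)
  then show ?case using Cons prod.lessThan_Suc_shift[of "\<lambda>i. pmf p ((x # xs) ! i)" "length xs"]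
    by (simp del: prod.lessThan_Suc)
qed auto

text \<open>
  Finite samples are recorded as lists because these form a countable type: measurability and
  the equality of laws can be checked on singletons.
\<close>

lemma (in prob_space) distr_sample_eq_replicate_pmf:
  fixes X :: "nat \<Rightarrow> 'a \<Rightarrow> 'c :: countable"
  assumes indep: "indep_vars (\<lambda>_. count_space UNIV) X {1..}"
    and distr: "\<And>l. l \<ge> 1 \<Longrightarrow> distr M (count_space UNIV) (X l) = measure_pmf p"
  shows "(\<lambda>\<omega>. map (\<lambda>l. X l \<omega>) [1..<Suc n]) \<in> measurable M (count_space UNIV)" (is "?Y \<in> _")
    and "distr M (count_space UNIV) (\<lambda>\<omega>. map (\<lambda>l. X l \<omega>) [1..<Suc n]) =
      measure_pmf (replicate_pmf n p)"
proof -
  have X [measurable]: "X l \<in> measurable M (count_space UNIV)" if "l \<ge> 1" for l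
    using indep that by (auto simp: indep_vars_def2)
  have vimage: "?Y -` {xs} \<inter> space M =
      (if length xs = n then {\<omega>\<in>space M. \<forall>l\<in>{1..n}. X l \<omega> = xs ! (l - 1)} else {})" for xs
  proof -
    have "?Y \<omega> = xs \<longleftrightarrow> length xs = n \<and> (\<forall>l\<in>{1..n}. X l \<omega> = xs ! (l - 1))" for \<omega>
    proof -
      have "?Y \<omega> = xs \<longleftrightarrow> length xs = n \<and> (\<forall>i<n. X (Suc i) \<omega> = xs ! i)"
        by (auto simp: list_eq_iff_nth_eq simp del: upt_Suc)
      also have "(\<forall>i<n. X (Suc i) \<omega> = xs ! i) \<longleftrightarrow> (\<forall>l\<in>{1..n}. X l \<omega> = xs ! (l - 1))"
      proof safe
        fix l assume "\<forall>i<n. X (Suc i) \<omega> = xs ! i" "l \<in> {1..n}"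
        then show "X l \<omega> = xs ! (l - 1)" by (cases l) auto
      next
        fix i assume "\<forall>l\<in>{1..n}. X l \<omega> = xs ! (l - 1)" "i < n"
        moreover have "Suc i \<in> {1..n}" using \<open>i < n\<close> by simp
        ultimately have "X (Suc i) \<omega> = xs ! (Suc i - 1)" by blast
        then show "X (Suc i) \<omega> = xs ! i" by simp
      qed
      finally show ?thesis .
    qed
    then show ?thesis by (simp only: vimage_def Int_def mem_Collect_eq singleton_iff) auto
  qed
  have meas: "{\<omega>\<in>space M. \<forall>l\<in>{1..n}. X l \<omega> = xs ! (l - 1)} \<in> sets M" for xs
  proof -
    have "{\<omega>\<in>space M. X l \<omega> = xs ! (l - 1)} \<in> sets M" if "l \<in> {1..n}" for l
    proof -
      have "{\<omega>\<in>space M. X l \<omega> = xs ! (l - 1)} = X l -` {xs ! (l - 1)} \<inter> space M" by auto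
      also have "\<dots> \<in> sets M" using that by (intro measurable_sets[OF X]) auto
      finally show ?thesis .
    qed
    then show ?thesis by (intro sets.sets_Collect_finite_All) auto
  qed
  show Y: "?Y \<in> measurable M (count_space UNIV)"
    unfolding measurable_count_space_eq2_countable using vimage meas by auto
  interpret D: prob_space "distr M (count_space UNIV) ?Y" by (rule prob_space_distr[OF Y])
  show "distr M (count_space UNIV) ?Y = measure_pmf (replicate_pmf n p)"
  proof (rule measure_eqI_countable[where A = UNIV])
    fix xs :: "'c list"
    have "measure (distr M (count_space UNIV) ?Y) {xs} = pmf (replicate_pmf n p) xs"
    proof (cases "length xs = n")
      case False
      have "measure (distr M (count_space UNIV) ?Y) {xs} = 0"
        using False by (subst measure_distr[OF Y]) (simp_all only: vimage, auto)
      moreover have "xs \<notin> set_pmf (replicate_pmf n p)"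
        using False by (auto simp: set_replicate_pmf)
      ultimately show ?thesis by (simp add: set_pmf_iff)
    next
      case True
      have "measure (distr M (count_space UNIV) ?Y) {xs} = prob {\<omega>\<in>space M. \<forall>l\<in>{1..n}. X l \<omega> = xs ! (l - 1)}"
        using True by (subst measure_distr[OF Y]) (simp_all only: vimage, auto)
      also have "\<dots> = (\<Prod>l\<in>{1..n}. pmf p (xs ! (l - 1)))"
      proof (cases "n = 0")
        case False
        have "{\<omega>\<in>space M. \<forall>l\<in>{1..n}. X l \<omega> = xs ! (l - 1)}
          = (\<Inter>l\<in>{1..n}. X l -` {xs ! (l - 1)} \<inter> space M)"
        proof (rule set_eqI)
          fix \<omega>
          have "{1..n} \<noteq> {}" using False by simp
          then show "\<omega> \<in> {\<omega>\<in>space M. \<forall>l\<in>{1..n}. X l \<omega> = xs ! (l - 1)} \<longleftrightarrow>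
            \<omega> \<in> (\<Inter>l\<in>{1..n}. X l -` {xs ! (l - 1)} \<inter> space M)"
            by (simp only: mem_Collect_eq INT_iff Int_iff vimage_singleton_eq) blast
        qed
        also have "prob \<dots> = (\<Prod>l\<in>{1..n}. prob (X l -` {xs ! (l - 1)} \<inter> space M))"
          using indep False unfolding indep_vars_def2
          by (intro indep_setsD[where I = "{1..}" and
               F = "\<lambda>i. {X i -` A \<inter> space M |A. A \<in> sets (count_space UNIV)}"]) auto
        also have "\<dots> = (\<Prod>l\<in>{1..n}. pmf p (xs ! (l - 1)))"
        proof (rule prod.cong)
          fix l assume l: "l \<in> {1..n}"
          then have "prob (X l -` {xs ! (l - 1)} \<inter> space M) =
              measure (distr M (count_space UNIV) (X l)) {xs ! (l - 1)}"
            by (subst measure_distr[OF X]) auto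
          then show "prob (X l -` {xs ! (l - 1)} \<inter> space M) = pmf p (xs ! (l - 1))"
            using distr[of l] l by (simp add: pmf.rep_eq)
        qed simp
        finally show ?thesis .
      qed (simp add: prob_space)
      also have "\<dots> = (\<Prod>i<n. pmf p (xs ! i))"
        by (rule prod.reindex_bij_witness[of _ Suc "\<lambda>l. l - 1"]) auto
      finally show ?thesis using pmf_replicate_pmf[of xs p] True by simp
    qed
    then show "emeasure (distr M (count_space UNIV) ?Y) {xs} = emeasure (measure_pmf (replicate_pmf n p)) {xs}"
      by (simp only: D.emeasure_eq_measure measure_pmf.emeasure_eq_measure pmf.rep_eq)
  qed auto
qed

lemma map_length_filter_replicate_pmf:
  "map_pmf (\<lambda>xs. length (filter P xs)) (replicate_pmf n p) = binomial_pmf n (measure p {x. P x})"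
proof -
  let ?q = "measure p {x. P x}"
  have q: "?q \<in> {0..1}" by simp
  have "map_pmf P p = bernoulli_pmf ?q"
  proof (rule pmf_eqI)
    fix b
    show "pmf (map_pmf P p) b = pmf (bernoulli_pmf ?q) b"
    proof (cases b)
      case True
      then show ?thesis by (auto simp: pmf_map vimage_def)
    next
      case False
      have "- {x. P x} = {x. \<not> P x}" by auto
      then have "measure p {x. \<not> P x} = 1 - ?q"
        using measure_pmf.prob_compl[of "{x. P x}" p] by (simp add: Compl_eq_Diff_UNIV)
      then show ?thesis using False by (auto simp: pmf_map vimage_def)
    qed
  qed
  then have "binomial_pmf n ?q = map_pmf (length \<circ> filter id) (replicate_pmf n (map_pmf P p))"
    using binomial_pmf_altdef[OF q, of n] by simp
  also have "\<dots> = map_pmf (\<lambda>xs. length (filter P xs)) (replicate_pmf n p)"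
    by (simp add: map_replicate_pmf[symmetric] pmf.map_comp o_def filter_map)
  finally show ?thesis by simp
qed

text \<open>
  The two sums are the first moments of the Bernstein polynomials.
\<close>

lemma binomial_pmf_moments:
  assumes q: "q \<in> {0..1}"
  shows "measure_pmf.expectation (binomial_pmf n q) real = real n * q"
    and "measure_pmf.expectation (binomial_pmf n q) (\<lambda>k. (real k)\<^sup>2) = (real n * q)\<^sup>2 + real n * q * (1 - q)"
proof -
  have E: "measure_pmf.expectation (binomial_pmf n q) f = (\<Sum>k\<le>n. f k * Bernstein n k q)" for f :: "nat \<Rightarrow> real"
    using expectation_binomial_pmf'[OF q, of n f] by (simp add: Bernstein_def mult_ac)
  show 1: "measure_pmf.expectation (binomial_pmf n q) real = real n * q"
    by (simp add: E)
  have "measure_pmf.expectation (binomial_pmf n q) (\<lambda>k. (real k)\<^sup>2) =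
      (\<Sum>k\<le>n. real k * (real k - 1) * Bernstein n k q) + (\<Sum>k\<le>n. real k * Bernstein n k q)"
    unfolding E sum.distrib[symmetric] by (intro sum.cong) (auto simp: power2_eq_square algebra_simps)
  then show "measure_pmf.expectation (binomial_pmf n q) (\<lambda>k. (real k)\<^sup>2) = (real n * q)\<^sup>2 + real n * q * (1 - q)"
    by (simp only: sum_kk_Bernstein sum_k_Bernstein) (simp add: power2_eq_square algebra_simps)
qed

definition emp :: "nat list \<Rightarrow> nat \<Rightarrow> real" where
  "emp xs i = real (count_list xs i) / real (length xs)"

lemma emp_nonneg: "0 \<le> emp xs i"
  by (simp add: emp_def)

lemma sum_count_list_filter:
  "finite S \<Longrightarrow> (\<Sum>i\<in>S. count_list xs i) = length (filter (\<lambda>x. x \<in> S) xs)"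
proof (induction xs)
  case (Cons x xs)
  have "(\<Sum>i\<in>S. count_list (x # xs) i) = (\<Sum>i\<in>S. count_list xs i + (if x = i then 1 else 0))"
    by (intro sum.cong) auto
  then show ?case using Cons by (auto simp: sum.distrib sum.delta')
qed simp

lemma sum_emp: "finite S \<Longrightarrow> (\<Sum>i\<in>S. emp xs i) = real (length (filter (\<lambda>x. x \<in> S) xs)) / real (length xs)"
  unfolding emp_def sum_divide_distrib[symmetric] sum_count_list_filter[symmetric] by simp

lemma sum_emp_le_1: "finite S \<Longrightarrow> (\<Sum>i\<in>S. emp xs i) \<le> 1"
  by (subst sum_emp) (auto simp: divide_le_eq)

lemma emp_le_1: "emp xs i \<le> 1"
  using sum_emp_le_1[of "{i}" xs] by simp

lemma sum_emp_eq_1: "finite S \<Longrightarrow> set xs \<subseteq> S \<Longrightarrow> xs \<noteq> [] \<Longrightarrow> (\<Sum>i\<in>S. emp xs i) = 1"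
  by (subst sum_emp) (auto simp: filter_True subset_iff)

lemma expectation_sum_emp:
  fixes p :: "nat pmf"
  assumes "finite S" "0 < n"
  defines "q \<equiv> measure p S"
  shows "measure_pmf.expectation (replicate_pmf n p) (\<lambda>xs. \<Sum>i\<in>S. emp xs i) = q"
    and "measure_pmf.expectation (replicate_pmf n p) (\<lambda>xs. (\<Sum>i\<in>S. emp xs i)\<^sup>2) = q\<^sup>2 + q * (1 - q) / real n"
proof -
  let ?B = "binomial_pmf n q"
  have q: "q \<in> {0..1}" by (simp add: q_def)
  have E: "measure_pmf.expectation (replicate_pmf n p) (\<lambda>xs. F (\<Sum>i\<in>S. emp xs i)) =
      measure_pmf.expectation ?B (\<lambda>k. F (real k / real n))" for F :: "real \<Rightarrow> real"
  proof -
    have "?B = map_pmf (\<lambda>xs. length (filter (\<lambda>x. x \<in> S) xs)) (replicate_pmf n p)"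
      unfolding map_length_filter_replicate_pmf by (simp add: q_def)
    then have "measure_pmf.expectation ?B (\<lambda>k. F (real k / real n)) =
      measure_pmf.expectation (replicate_pmf n p) (\<lambda>xs. F (real (length (filter (\<lambda>x. x \<in> S) xs)) / real n))"
      by simp
    also have "\<dots> = measure_pmf.expectation (replicate_pmf n p) (\<lambda>xs. F (\<Sum>i\<in>S. emp xs i))"
      by (intro integral_cong_AE) (auto simp: AE_measure_pmf_iff set_replicate_pmf sum_emp[OF assms(1)])
    finally show ?thesis by simp
  qed
  show "measure_pmf.expectation (replicate_pmf n p) (\<lambda>xs. \<Sum>i\<in>S. emp xs i) = q"
    using E[of "\<lambda>x. x"] binomial_pmf_moments(1)[OF q, of n] assms(2) by simp
  show "measure_pmf.expectation (replicate_pmf n p) (\<lambda>xs. (\<Sum>i\<in>S. emp xs i)\<^sup>2) = q\<^sup>2 + q * (1 - q) / real n"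
    using E[of "\<lambda>x. x\<^sup>2"] binomial_pmf_moments(2)[OF q, of n] assms(2)
    by (simp add: power_divide add_divide_distrib) (simp add: power2_eq_square field_simps)
qed

lemma expectation_emp_deviation:
  fixes p :: "nat pmf"
  assumes "finite S" "0 < n"
  defines "q \<equiv> measure p S"
  shows "measure_pmf.expectation (replicate_pmf n p) (\<lambda>xs. real n * ((\<Sum>i\<in>S. emp xs i) - q)\<^sup>2) = q * (1 - q)"
proof -
  let ?E = "measure_pmf.expectation (replicate_pmf n p)"
  have b: "0 \<le> (\<Sum>i\<in>S. emp xs i)" "(\<Sum>i\<in>S. emp xs i) \<le> 1" for xs
    using assms by (auto intro: sum_nonneg emp_nonneg sum_emp_le_1)
  have i1: "integrable (replicate_pmf n p) (\<lambda>xs. \<Sum>i\<in>S. emp xs i)"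
    using b by (intro integrable_pmf_bounded[where B = 1]) auto
  have i2: "integrable (replicate_pmf n p) (\<lambda>xs. (\<Sum>i\<in>S. emp xs i)\<^sup>2)"
    using b by (intro integrable_pmf_bounded[where B = 1]) (auto simp: power_le_one)
  have "?E (\<lambda>xs. real n * ((\<Sum>i\<in>S. emp xs i) - q)\<^sup>2) =
     real n * ?E (\<lambda>xs. (\<Sum>i\<in>S. emp xs i)\<^sup>2 - 2 * q * (\<Sum>i\<in>S. emp xs i) + q\<^sup>2)"
    by (simp add: power2_diff mult_ac add_diff_eq diff_add_eq)
  also have "\<dots> = real n * (?E (\<lambda>xs. (\<Sum>i\<in>S. emp xs i)\<^sup>2) - 2 * q * ?E (\<lambda>xs. \<Sum>i\<in>S. emp xs i) + q\<^sup>2)"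
    using i1 i2 by simp
  also have "\<dots> = q * (1 - q)"
    using expectation_sum_emp[OF assms(1,2), of p] assms(2)
    unfolding q_def[symmetric] by (simp add: power2_eq_square field_simps)
  finally show ?thesis .
qed

lemma prob_emp_deviation:
  fixes p :: "nat pmf"
  assumes "0 \<le> e" "0 < n"
  shows "measure (replicate_pmf n p)
    {xs. e \<le> \<bar>real (length (filter P xs)) / real n - measure p {x. P x}\<bar>} \<le> 2 * exp (- 2 * real n * e\<^sup>2)"
proof -
  let ?q = "measure p {x. P x}"
  interpret binomial_distribution n ?q by unfold_locales simp
  have "measure (replicate_pmf n p) {xs. e \<le> \<bar>real (length (filter P xs)) / real n - ?q\<bar>}
    = measure (map_pmf (\<lambda>xs. length (filter P xs)) (replicate_pmf n p)) {k. e \<le> \<bar>real k / real n - ?q\<bar>}"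
    by (simp add: vimage_def)
  also have "\<dots> \<le> 2 * exp (- 2 * real n * e\<^sup>2)"
    unfolding map_length_filter_replicate_pmf using prob_abs_ge'[OF assms(2,1)] by simp
  finally show ?thesis .
qed

definition close_emp :: "nat pmf \<Rightarrow> real \<Rightarrow> nat list \<Rightarrow> bool" where
  "close_emp p d xs \<longleftrightarrow> (\<forall>i. \<bar>emp xs i - pmf p i\<bar> < d)"

lemma measure_pmf_tail_tendsto_0:
  fixes p :: "nat pmf"
  shows "(\<lambda>N. measure p {N..}) \<longlonglongrightarrow> 0"
proof -
  have "(\<lambda>N. measure p {N..}) \<longlonglongrightarrow> measure p (\<Inter>N. {N..})"
    by (intro measure_pmf.finite_Lim_measure_decseq) (auto simp: decseq_def)
  moreover have "(\<Inter>N. {N..}) = ({} :: nat set)"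
    using Suc_n_not_le_n by blast
  ultimately show ?thesis by simp
qed

text \<open>
  Uniform closeness over infinitely many labels needs only finitely many applications of Hoeffding's
  inequality: one for each label below a suitable \<open>N\<close> and one for the tail \<open>{N..}\<close>, which bounds
  all remaining frequencies at once.
\<close>

lemma prob_not_close_emp:
  fixes p :: "nat pmf"
  assumes d: "0 < d"
  shows "(\<lambda>n. real n * measure (replicate_pmf n p) {xs. \<not> close_emp p d xs}) \<longlonglongrightarrow> 0"
proof -
  obtain N where N: "measure p {N..} < d / 2"
    using order_tendstoD(2)[OF measure_pmf_tail_tendsto_0[of p], of "d / 2"] d
    by (auto simp: eventually_sequentially)
  define bad where "bad n S = {xs. d / 2 \<le> \<bar>real (length (filter (\<lambda>x. x \<in> S) xs)) / real n - measure p S\<bar>}"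
    for n :: nat and S
  have bad: "measure (replicate_pmf n p) (bad n S) \<le> 2 * exp (- 2 * real n * (d / 2)\<^sup>2)" if "0 < n" for n S
    using prob_emp_deviation[of "d / 2" n p "\<lambda>x. x \<in> S"] d that by (simp add: bad_def)
  have sub: "{xs. \<not> close_emp p d xs} \<inter> set_pmf (replicate_pmf n p)
      \<subseteq> (\<Union>i<N. bad n {i}) \<union> bad n {N..}" if "0 < n" for n
  proof safe
    fix xs assume xs: "xs \<in> set_pmf (replicate_pmf n p)" "\<not> close_emp p d xs" "xs \<notin> bad n {N..}"
    have len: "length xs = n" using xs by (auto simp: set_replicate_pmf)
    obtain i where i: "d \<le> \<bar>emp xs i - pmf p i\<bar>" using xs by (auto simp: close_emp_def not_less)
    have "i < N"
    proof (rule ccontr)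
      assume "\<not> i < N"
      then have iN: "{i} \<subseteq> {N..}" by auto
      have "emp xs i = real (length (filter (\<lambda>x. x \<in> {i}) xs)) / real n"
        using sum_emp[of "{i}" xs] len by simp
      also have "\<dots> \<le> real (length (filter (\<lambda>x. x \<in> {N..}) xs)) / real n"
        using \<open>\<not> i < N\<close>
        by (intro divide_right_mono) (induction xs, auto)
      also have "\<dots> < measure p {N..} + d / 2"
      proof -
        have "\<bar>real (length (filter (\<lambda>x. x \<in> {N..}) xs)) / real n - measure p {N..}\<bar> < d / 2"
          using xs(3) unfolding bad_def by (simp only: mem_Collect_eq not_le)
        then show ?thesis by linarith
      qed
      also have "\<dots> < d" using N by simp
      finally have "emp xs i < d" .
      moreover have "pmf p i < d"
        using measure_pmf.finite_measure_mono[OF iN, of p] N d by (simp add: pmf.rep_eq)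
      ultimately show False using i emp_nonneg[of xs i] pmf_nonneg[of p i] by linarith
    qed
    moreover have "xs \<in> bad n {i}"
      using i d sum_emp[of "{i}" xs] len by (simp add: bad_def measure_pmf_single)
    ultimately show "xs \<in> (\<Union>i<N. bad n {i})" by blast
  qed
  have bound: "real n * measure (replicate_pmf n p) {xs. \<not> close_emp p d xs}
      \<le> real n * (real (N + 1) * (2 * exp (- 2 * real n * (d / 2)\<^sup>2)))" if "0 < n" for n
  proof (intro mult_left_mono)
    let ?P = "measure (replicate_pmf n p)"
    have "?P {xs. \<not> close_emp p d xs} = ?P ({xs. \<not> close_emp p d xs} \<inter> set_pmf (replicate_pmf n p))"
      by (simp add: measure_Int_set_pmf)
    also have "\<dots> \<le> ?P ((\<Union>i<N. bad n {i}) \<union> bad n {N..})"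
      by (rule measure_pmf.finite_measure_mono[OF sub[OF that]]) simp
    also have "\<dots> \<le> ?P (\<Union>i<N. bad n {i}) + ?P (bad n {N..})"
      by (rule measure_Un_le) auto
    also have "?P (\<Union>i<N. bad n {i}) \<le> (\<Sum>i<N. ?P (bad n {i}))"
      by (rule measure_UNION_le) auto
    also have "\<dots> \<le> (\<Sum>i<N. 2 * exp (- 2 * real n * (d / 2)\<^sup>2))"
      by (intro sum_mono bad that)
    finally show "?P {xs. \<not> close_emp p d xs} \<le> real (N + 1) * (2 * exp (- 2 * real n * (d / 2)\<^sup>2))"
      using bad[OF that, of "{N..}"] by (simp add: algebra_simps)
  qed simp
  have "(\<lambda>n. real n * (real (N + 1) * (2 * exp (- 2 * real n * (d / 2)\<^sup>2)))) \<longlonglongrightarrow> 0"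
    using d by real_asymp
  then show ?thesis
  proof (rule tendsto_sandwich[OF _ _ tendsto_const, rotated 2])
    show "\<forall>\<^sub>F n in sequentially. 0 \<le> real n * measure (replicate_pmf n p) {xs. \<not> close_emp p d xs}"
      by simp
    show "\<forall>\<^sub>F n in sequentially. real n * measure (replicate_pmf n p) {xs. \<not> close_emp p d xs}
      \<le> real n * (real (N + 1) * (2 * exp (- 2 * real n * (d / 2)\<^sup>2)))"
      using eventually_gt_at_top[of 0] by (rule eventually_mono) (rule bound)
  qed
qed

section \<open>Flat regions\<close>

lemma ex_consecutive_endpoints:
  fixes b :: "nat \<Rightarrow> nat"
  assumes "b 0 \<le> i" "i < b J"
  obtains j where "j < J" "i \<in> {b j..<b (Suc j)}"
proof -
  define J' where "J' = (LEAST J. i < b J)"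
  have 1: "i < b J'" unfolding J'_def by (rule LeastI[of _ J]) (rule assms)
  have 2: "J' \<le> J" unfolding J'_def by (rule Least_le) (rule assms)
  have "J' \<noteq> 0" using 1 assms(1) by (intro notI) simp
  then obtain j where j: "J' = Suc j" by (cases J') auto
  have "\<not> i < b j"
    using not_less_Least[of j "\<lambda>J. i < b J"] j unfolding J'_def by simp
  then show ?thesis using 1 2 j by (intro that[of j]) auto
qed

text \<open>
  The flat regions are the intervals \<open>{b j..<b (Suc j)}\<close>, numbered from 0. Empty intervals are allowed,
  so that a finite support corresponds to a sequence \<open>b\<close> that is eventually constant and need not be
  distinguished from an infinite one.
\<close>

locale flat_blocks =
  fixes p :: "nat pmf" and b :: "nat \<Rightarrow> nat"
  assumes b_0: "b 0 = 1"
    and b_mono: "mono b"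
    and support: "set_pmf p = (\<Union>J. {1..<b J})"
    and flat: "i \<in> {b j..<b (Suc j)} \<Longrightarrow> pmf p i = pmf p (b j)"
    and drop: "1 \<le> i \<Longrightarrow> i < b j \<Longrightarrow> b j \<le> i' \<Longrightarrow> pmf p i' < pmf p i"
begin

lemma b_le: "j \<le> J \<Longrightarrow> b j \<le> b J"
  using b_mono by (auto simp: mono_def)

lemma b_pos: "1 \<le> b j"
  using b_le[of 0 j] b_0 by simp

lemma block_exists:
  assumes "1 \<le> i" "i < b J"
  obtains j where "j < J" "i \<in> {b j..<b (Suc j)}"
  using ex_consecutive_endpoints[of b i J] assms b_0 by auto

lemma pmf_antimono: "1 \<le> i \<Longrightarrow> i \<le> i' \<Longrightarrow> pmf p i' \<le> pmf p i"
proof (cases "i' \<in> set_pmf p")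
  case True
  assume i: "1 \<le> i" "i \<le> i'"
  then obtain J where "i' < b J" using True support by auto
  then obtain j where j: "i \<in> {b j..<b (Suc j)}" using block_exists[of i J] i by auto
  show ?thesis
  proof (cases "i' < b (Suc j)")
    case True
    then have "i' \<in> {b j..<b (Suc j)}" using i j by auto
    then show ?thesis using flat[of i j] flat[of i' j] j by simp
  next
    case False
    then show ?thesis using drop[of i "Suc j" i'] i j by auto
  qed
qed (simp add: set_pmf_iff)

lemma antimono_on_pmf: "1 \<le> a \<Longrightarrow> antimono_on {a..<c} (pmf p)"
  by (rule monotone_onI) (auto intro: pmf_antimono)

lemma pmf_pos: "1 \<le> i \<Longrightarrow> i < b J \<Longrightarrow> 0 < pmf p i"
  using support by (auto simp: pmf_positive_iff)

lemma sum_blocks: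
  fixes u :: "nat \<Rightarrow> real"
  shows "sum u {1..<b J} = (\<Sum>j<J. sum u {b j..<b (Suc j)})"
proof (induction J)
  case 0
  then show ?case by (simp add: b_0)
next
  case (Suc J)
  have "sum u {1..<b (Suc J)} = sum u {1..<b J} + sum u {b J..<b (Suc J)}"
    by (rule sum.atLeastLessThan_concat[symmetric, OF b_pos b_le]) simp
  then show ?case using Suc by simp
qed

lemma pmf_0: "pmf p 0 = 0"
proof -
  have "0 \<notin> set_pmf p" using support by simp
  then show ?thesis by (simp add: set_pmf_iff)
qed

lemma sum_blocks_from:
  fixes u :: "nat \<Rightarrow> real"
  assumes "J \<le> J'"
  shows "sum u {b J..<b J'} = (\<Sum>j=J..<J'. sum u {b j..<b (Suc j)})"
proof -
  have "sum u {1..<b J'} = sum u {1..<b J} + sum u {b J..<b J'}"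
    by (rule sum.atLeastLessThan_concat[symmetric, OF b_pos b_le[OF assms]])
  moreover have "(\<Sum>j<J'. sum u {b j..<b (Suc j)}) = (\<Sum>j<J. sum u {b j..<b (Suc j)}) + (\<Sum>j=J..<J'. sum u {b j..<b (Suc j)})"
    using sum.atLeastLessThan_concat[of 0 J J' "\<lambda>j. sum u {b j..<b (Suc j)}"] assms
    by (simp add: atLeast0LessThan)
  ultimately show ?thesis unfolding sum_blocks by simp
qed

lemma measure_block: "measure p {b j..<b (Suc j)} = real (b (Suc j) - b j) * pmf p (b j)"
proof -
  have "measure p {b j..<b (Suc j)} = (\<Sum>i\<in>{b j..<b (Suc j)}. pmf p (b j))"
    using flat by (subst measure_measure_pmf_finite) (auto intro!: sum.cong)
  then show ?thesis by simp
qed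

lemma measure_tail_tendsto_0: "(\<lambda>J. measure p {b J..}) \<longlonglongrightarrow> 0"
proof -
  have "(\<lambda>J. measure p {b J..}) \<longlonglongrightarrow> measure p (\<Inter>J. {b J..})"
    by (intro measure_pmf.finite_Lim_measure_decseq) (auto simp: decseq_def intro: order_trans[OF b_le])
  moreover have "measure p (\<Inter>J. {b J..}) = 0"
  proof -
    have "set_pmf p \<inter> (\<Inter>J. {b J..}) = {}" unfolding support by (auto simp: not_le[symmetric])
    then show ?thesis by (simp add: measure_pmf_zero_iff)
  qed
  ultimately show ?thesis by simp
qed

text \<open>
  The condition of \<open>isoreg_split\<close> at \<open>b j\<close>.
\<close>

definition separated :: "nat \<Rightarrow> (nat \<Rightarrow> real) \<Rightarrow> bool" where
  "separated j y \<longleftrightarrow> (\<exists>v. (\<forall>i\<in>{1..<b j}. v \<le> y i) \<and> (\<forall>i\<ge>b j. y i \<le> v))"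

text \<open>
  At the end of each region \<open>p\<close> drops by a positive amount; half of the smallest of finitely many
  drops is a sufficient precision.
\<close>

lemma close_imp_separated:
  "\<exists>d>0. \<forall>y. (\<forall>i. \<bar>y i - pmf p i\<bar> < d) \<longrightarrow> (\<forall>j\<le>J. separated j y)"
proof -
  have "\<exists>d>0. \<forall>y. (\<forall>i. \<bar>y i - pmf p i\<bar> < d) \<longrightarrow> separated j y" for j
  proof (cases "b j = 1")
    case True
    \<comment> \<open>no label precedes \<open>b j\<close>, so any common upper bound of \<open>y\<close> serves\<close>
    have "separated j y" if "\<forall>i. \<bar>y i - pmf p i\<bar> < 1" for y
      unfolding separated_def
    proof (intro exI[of _ 2] conjI ballI allI impI)
      fix i show "y i \<le> 2" using spec[OF that, of i] pmf_le_1[of p i] by linarith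
    qed (use True in auto)
    then show ?thesis by (intro exI[of _ 1]) auto
  next
    case False
    then have j: "1 \<le> b j - 1" "b j - 1 < b j" using b_pos[of j] by auto
    let ?l = "pmf p (b j - 1)" and ?r = "pmf p (b j)"
    have lr: "?r < ?l" using drop[OF j, of "b j"] by simp
    have "separated j y" if y: "\<forall>i. \<bar>y i - pmf p i\<bar> < (?l - ?r) / 2" for y
      unfolding separated_def
    proof (intro exI[of _ "(?l + ?r) / 2"] conjI ballI allI impI)
      fix i assume "i \<in> {1..<b j}"
      then have "?l \<le> pmf p i" by (intro pmf_antimono) auto
      then show "(?l + ?r) / 2 \<le> y i" using y[rule_format, of i] by argo
    next
      fix i assume "b j \<le> i"
      then have "pmf p i \<le> ?r" using b_pos by (intro pmf_antimono) auto
      then show "y i \<le> (?l + ?r) / 2" using y[rule_format, of i] by argo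
    qed
    then show ?thesis using lr by (intro exI[of _ "(?l - ?r) / 2"]) auto
  qed
  then obtain d where d: "\<And>j. d j > 0" "\<And>j y. (\<forall>i. \<bar>y i - pmf p i\<bar> < d j) \<Longrightarrow> separated j y"
    by metis
  define e where "e = Min (d ` {..J})"
  have e: "e \<le> d j" if "j \<le> J" for j using that by (auto simp: e_def)
  have "e > 0" using d(1) by (auto simp: e_def)
  moreover have "separated j y" if "\<forall>i. \<bar>y i - pmf p i\<bar> < e" "j \<le> J" for j y
    using d(2)[of y j] that e[of j] by (meson less_le_trans)
  ultimately show ?thesis by blast
qed

lemma isoreg_tail:
  assumes "separated J y" "J \<le> J'" "b J \<le> i"
  shows "isoreg 1 (b J') y i = isoreg (b J) (b J') y i"
proof -
  obtain v where "\<forall>i\<in>{1..<b J}. v \<le> y i" "\<forall>i\<ge>b J. y i \<le> v"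
    using assms(1) unfolding separated_def by blast
  then show ?thesis
    using isoreg_split[of 1 "b J" "b J'" v y i] assms b_pos b_le by auto
qed

text \<open>
  Splitting at both ends of a region shows that the global regression is computed locally there.
\<close>

lemma isoreg_block:
  assumes "separated j y" "separated (Suc j) y" "Suc j \<le> J'" "i \<in> {b j..<b (Suc j)}"
  shows "isoreg 1 (b J') y i = isoreg (b j) (b (Suc j)) y i"
proof -
  obtain v where v: "\<forall>i\<in>{1..<b (Suc j)}. v \<le> y i" "\<forall>i\<ge>b (Suc j). y i \<le> v"
    using assms(2) unfolding separated_def by blast
  have "isoreg 1 (b J') y i = isoreg (b j) (b J') y i"
    using isoreg_tail[of j y J' i] assms by auto
  also have "\<dots> = isoreg (b j) (b (Suc j)) y i"
    using isoreg_split[of "b j" "b (Suc j)" "b J'" v y i] v assms b_pos[of j] b_le by auto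
  finally show ?thesis .
qed

end

text \<open>
  Termwise limits may be summed because the remainder \<open>T\<close> is controlled uniformly in \<open>n\<close>, up to a
  vanishing error, by \<open>\<tau>\<close>.
\<close>

lemma tendsto_of_block_tendsto:
  fixes R :: "nat \<Rightarrow> real"
  assumes split: "\<And>n J. 0 < n \<Longrightarrow> R n = (\<Sum>j<J. a n j) + T n J"
    and T: "\<And>n J. 0 < n \<Longrightarrow> 0 \<le> T n J" "\<And>n J. 0 < n \<Longrightarrow> T n J \<le> \<tau> J + e J n"
    and e: "\<And>J. e J \<longlonglongrightarrow> 0" and \<tau>: "\<tau> \<longlonglongrightarrow> 0"
    and a: "\<And>j. (\<lambda>n. a n j) \<longlonglongrightarrow> c j" and c: "summable c"
  shows "R \<longlonglongrightarrow> suminf c"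
proof (rule LIMSEQ_I)
  fix r :: real assume r: "0 < r"
  have "\<forall>\<^sub>F J in sequentially. \<bar>\<tau> J\<bar> < r / 4" using tendstoD[OF \<tau>, of "r / 4"] r by simp
  moreover have "\<forall>\<^sub>F J in sequentially. \<bar>(\<Sum>j<J. c j) - suminf c\<bar> < r / 4"
    using tendstoD[OF summable_LIMSEQ[OF c], of "r / 4"] r by (simp add: dist_real_def)
  ultimately have "\<forall>\<^sub>F J in sequentially. \<bar>\<tau> J\<bar> < r / 4 \<and> \<bar>(\<Sum>j<J. c j) - suminf c\<bar> < r / 4"
    by (rule eventually_conj)
  then obtain J where J: "\<bar>\<tau> J\<bar> < r / 4" "\<bar>(\<Sum>j<J. c j) - suminf c\<bar> < r / 4"
    by (auto simp: eventually_sequentially)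
  have "(\<lambda>n. \<Sum>j<J. a n j) \<longlonglongrightarrow> (\<Sum>j<J. c j)" by (intro tendsto_sum a)
  then have "\<forall>\<^sub>F n in sequentially. \<bar>(\<Sum>j<J. a n j) - (\<Sum>j<J. c j)\<bar> < r / 4"
    using r by (auto dest!: tendstoD[of _ _ _ "r / 4"] simp: dist_real_def)
  moreover have "\<forall>\<^sub>F n in sequentially. \<bar>e J n\<bar> < r / 4"
    using tendstoD[OF e, of "r / 4" J] r by simp
  ultimately have "\<forall>\<^sub>F n in sequentially. norm (R n - suminf c) < r"
    using eventually_gt_at_top[of 0]
  proof eventually_elim
    case (elim n)
    then show ?case using split[of n J] T[of n J] J unfolding real_norm_def by linarith
  qed
  then show "\<exists>no. \<forall>n\<ge>no. norm (R n - suminf c) < r" by (simp add: eventually_sequentially)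
qed

lemma expectation_diff_le_prob:
  fixes F G :: "'a \<Rightarrow> real"
  assumes F: "integrable (measure_pmf Q) F" and G: "integrable (measure_pmf Q) G"
    and le: "\<And>x. x \<in> set_pmf Q \<Longrightarrow> F x \<le> G x + B * indicator A x"
  shows "measure_pmf.expectation Q F \<le> measure_pmf.expectation Q G + B * measure Q A"
proof -
  have i: "integrable (measure_pmf Q) (indicator A :: 'a \<Rightarrow> real)"
    by (rule integrable_pmf_bounded[of _ _ 1]) (auto simp: indicator_def)
  have "measure_pmf.expectation Q F \<le> measure_pmf.expectation Q (\<lambda>x. G x + B * indicator A x)"
    using F G i le by (intro integral_mono_AE) (auto simp: AE_measure_pmf_iff)
  also have "\<dots> = measure_pmf.expectation Q G + B * measure Q A"
    using G i by simp
  finally show ?thesis .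
qed

lemma square_diff_le:
  fixes x y :: real
  assumes "0 \<le> x" "x \<le> 1" "0 \<le> y" "y \<le> 1"
  shows "(x - y)\<^sup>2 \<le> x + y" "(x - y)\<^sup>2 \<le> 1"
proof -
  have "\<bar>x - y\<bar> \<le> 1" using assms by (simp add: abs_le_iff)
  then show "(x - y)\<^sup>2 \<le> 1" by (simp add: abs_square_le_1)
  have "(x - y)\<^sup>2 = \<bar>x - y\<bar> * \<bar>x - y\<bar>" by (simp add: power2_eq_square)
  also have "\<dots> \<le> \<bar>x - y\<bar> * 1" using \<open>\<bar>x - y\<bar> \<le> 1\<close> by (intro mult_left_mono) auto
  also have "\<dots> \<le> x + y" using assms by (simp add: abs_le_iff)
  finally show "(x - y)\<^sup>2 \<le> x + y" .
qed

text \<open>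
  The common features of both estimators: each is the isotonic regression of a vector \<open>yv xs\<close> computed
  from the sample, this vector is no further from \<open>p\<close> on any region than the empirical frequencies are,
  and the regression on a single region has a scaled risk \<open>c j\<close> that does not depend on the sample
  size.
\<close>

locale blockwise_estimator = flat_blocks +
  fixes yv est :: "nat list \<Rightarrow> nat \<Rightarrow> real" and c :: "nat \<Rightarrow> real"
  assumes est: "xs \<noteq> [] \<Longrightarrow> set xs \<subseteq> {1..<b J} \<Longrightarrow> est xs = isoreg 1 (b J) (yv xs)"
    and yv_nonneg: "0 \<le> yv xs i"
    and yv_sum: "xs \<noteq> [] \<Longrightarrow> set xs \<subseteq> {1..<b J} \<Longrightarrow> sum (yv xs) {1..<b J} = 1"
    and yv_close: "(\<And>i. \<bar>emp xs i - pmf p i\<bar> < d) \<Longrightarrow> \<bar>yv xs i - pmf p i\<bar> < d"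
    and yv_block: "(\<Sum>i=b j..<b (Suc j). (yv xs i - pmf p i)\<^sup>2) \<le> (\<Sum>i=b j..<b (Suc j). (emp xs i - pmf p i)\<^sup>2)"
    and block_risk: "0 < n \<Longrightarrow> measure_pmf.expectation (replicate_pmf n p)
        (\<lambda>xs. real n * (\<Sum>i=b j..<b (Suc j). (isoreg (b j) (b (Suc j)) (yv xs) i - pmf p i)\<^sup>2)) = c j"
begin

end

section \<open>Squared error of estimators that localise\<close>

lemma summable_pmf_nat:
  fixes p :: "nat pmf"
  shows "summable (pmf p)"
proof (rule summableI_nonneg_bounded[where x = 1])
  fix n
  have "sum (pmf p) {..<n} = measure p {..<n}" by (simp add: measure_measure_pmf_finite)
  then show "sum (pmf p) {..<n} \<le> 1" by simp
qed simp

lemma emp_eq_0: "i \<notin> set xs \<Longrightarrow> emp xs i = 0"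
  by (simp add: emp_def)

lemma summable_tail_square:
  fixes p :: "nat pmf" and f :: "nat \<Rightarrow> real"
  assumes f: "\<And>i. 0 \<le> f i \<and> f i \<le> 1" "\<And>i. N \<le> i \<Longrightarrow> f i = 0"
  shows "summable (\<lambda>i. if P i then (f i - pmf p i)\<^sup>2 else 0)"
proof (rule summable_comparison_test')
  show "summable (pmf p)" by (rule summable_pmf_nat)
  fix i assume i: "N \<le> i"
  have "(f i - pmf p i)\<^sup>2 \<le> f i + pmf p i"
    using f(1)[of i] by (intro square_diff_le) (auto simp: pmf_le_1)
  then show "norm (if P i then (f i - pmf p i)\<^sup>2 else 0) \<le> pmf p i"
    using f(2)[OF i] by auto
qed

lemma suminf_tail_square_le_2:
  fixes p :: "nat pmf" and f :: "nat \<Rightarrow> real"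
  assumes f: "\<And>i. 0 \<le> f i \<and> f i \<le> 1" "\<And>i. N \<le> i \<Longrightarrow> f i = 0" "sum f {..<N} \<le> 1"
  shows "(\<Sum>i. if P i then (f i - pmf p i)\<^sup>2 else 0) \<le> 2"
proof (rule suminf_le_const[OF summable_tail_square[OF f(1,2)]])
  fix n
  have "(\<Sum>i<n. if P i then (f i - pmf p i)\<^sup>2 else 0) \<le> (\<Sum>i<n. f i + pmf p i)"
  proof (rule sum_mono)
    fix i
    have "(f i - pmf p i)\<^sup>2 \<le> f i + pmf p i"
      using f(1)[of i] by (intro square_diff_le) (auto simp: pmf_le_1)
    then show "(if P i then (f i - pmf p i)\<^sup>2 else 0) \<le> f i + pmf p i"
      using f(1)[of i] by auto
  qed
  also have "\<dots> = sum f {..<n} + sum (pmf p) {..<n}" by (rule sum.distrib)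
  also have "sum f {..<n} \<le> sum f {..<N}"
  proof -
    have "sum f {..<n} \<le> sum f {..<max n N}" using f(1) by (intro sum_mono2) auto
    also have "\<dots> = sum f {..<N}" using f(2) by (intro sum.mono_neutral_right) auto
    finally show ?thesis .
  qed
  also have "sum (pmf p) {..<n} = measure p {..<n}" by (simp add: measure_measure_pmf_finite)
  also have "\<dots> \<le> 1" by simp
  finally show "(\<Sum>i<n. if P i then (f i - pmf p i)\<^sup>2 else 0) \<le> 2" using f(3) by simp
qed

text \<open>
  Each frequency contributes its variance \<open>p i * (1 - p i)\<close>, whence the bound by the mass of the tail.
\<close>

lemma expectation_emp_tail:
  fixes p :: "nat pmf"
  assumes n: "0 < n"
  shows "integrable (replicate_pmf n p) (\<lambda>xs. real n * (\<Sum>i. if N \<le> i then (emp xs i - pmf p i)\<^sup>2 else 0))"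
    and "measure_pmf.expectation (replicate_pmf n p)
      (\<lambda>xs. real n * (\<Sum>i. if N \<le> i then (emp xs i - pmf p i)\<^sup>2 else 0)) \<le> measure p {N..}"
proof -
  let ?Q = "replicate_pmf n p"
  define f where "f i xs = (if N \<le> i then real n * (emp xs i - pmf p i)\<^sup>2 else 0)" for i xs
  have emp01: "0 \<le> emp xs i \<and> emp xs i \<le> 1" for xs i using emp_nonneg emp_le_1 by blast
  have big: "emp xs i = 0" if "Suc (sum_list xs) \<le> i" for xs i
    using that member_le_sum_list[of i xs] by (intro emp_eq_0) auto
  have summ: "summable (\<lambda>i. if N \<le> i then (emp xs i - pmf p i)\<^sup>2 else 0)" for xs
    by (rule summable_tail_square[OF emp01 big])
  have f_eq: "f i xs = real n * (if N \<le> i then (emp xs i - pmf p i)\<^sup>2 else 0)" for i xs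
    by (simp add: f_def)
  have sf: "(\<Sum>i. f i xs) = real n * (\<Sum>i. if N \<le> i then (emp xs i - pmf p i)\<^sup>2 else 0)" for xs
    unfolding f_eq by (rule suminf_mult[OF summ])
  have int: "integrable ?Q (f i)" for i
  proof (rule integrable_pmf_bounded[of _ _ "real n"])
    fix xs
    have "(emp xs i - pmf p i)\<^sup>2 \<le> 1" using emp01[of xs i] by (intro square_diff_le) (auto simp: pmf_le_1)
    then show "\<bar>f i xs\<bar> \<le> real n" by (auto simp: f_def mult_left_le)
  qed
  have Ef: "measure_pmf.expectation ?Q (f i) = (if N \<le> i then pmf p i * (1 - pmf p i) else 0)" for i
    using expectation_emp_deviation[of "{i}" n p] n by (simp add: f_def[abs_def] measure_pmf_single)
  have nn: "0 \<le> f i xs" for i xs by (simp add: f_def)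
  have part: "(\<Sum>i<m. if N \<le> i then pmf p i * (1 - pmf p i) else 0) \<le> measure p {N..}" for m
  proof -
    have "(\<Sum>i<m. if N \<le> i then pmf p i * (1 - pmf p i) else 0) \<le> (\<Sum>i<m. if N \<le> i then pmf p i else 0)"
      by (intro sum_mono) (auto intro!: mult_left_le)
    also have "\<dots> = (\<Sum>i\<in>{N..<m}. pmf p i)"
      by (intro sum.mono_neutral_cong_right) auto
    also have "\<dots> = measure p {N..<m}" by (simp add: measure_measure_pmf_finite)
    also have "\<dots> \<le> measure p {N..}" by (intro measure_pmf.finite_measure_mono) auto
    finally show ?thesis .
  qed
  have summE: "summable (\<lambda>i. measure_pmf.expectation ?Q (\<lambda>xs. norm (f i xs)))"
    using nn part by (intro summableI_nonneg_bounded[where x = "measure p {N..}"])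
      (auto simp: Ef pmf_le_1 intro!: Bochner_Integration.integral_nonneg)
  have AEs: "AE xs in ?Q. summable (\<lambda>i. norm (f i xs))"
    using summ by (auto simp: f_eq abs_mult AE_measure_pmf_iff if_distrib[of abs] intro!: summable_mult cong: if_cong)
  show "integrable ?Q (\<lambda>xs. real n * (\<Sum>i. if N \<le> i then (emp xs i - pmf p i)\<^sup>2 else 0))"
    using integrable_suminf[OF int AEs summE] unfolding sf .
  have "measure_pmf.expectation ?Q (\<lambda>xs. real n * (\<Sum>i. if N \<le> i then (emp xs i - pmf p i)\<^sup>2 else 0)) =
      (\<Sum>i. if N \<le> i then pmf p i * (1 - pmf p i) else 0)"
    using integral_suminf[OF int AEs summE] unfolding sf Ef .
  also have "\<dots> \<le> measure p {N..}"
  proof (rule suminf_le_const)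
    show "summable (\<lambda>i. if N \<le> i then pmf p i * (1 - pmf p i) else 0)"
      using summable_integral[OF int AEs summE] unfolding Ef .
  qed (rule part)
  finally show "measure_pmf.expectation ?Q
      (\<lambda>xs. real n * (\<Sum>i. if N \<le> i then (emp xs i - pmf p i)\<^sup>2 else 0)) \<le> measure p {N..}" .
qed

context blockwise_estimator
begin

abbreviation Q :: "nat \<Rightarrow> nat list pmf" where "Q n \<equiv> replicate_pmf n p"

definition err :: "nat list \<Rightarrow> nat \<Rightarrow> real" where
  "err xs i = (est xs i - pmf p i)\<^sup>2"

text \<open>
  For an infinite support the regression needs a finite window. Any window that ends with a region and
  contains the sample gives the same estimate, so it may be chosen as large as convenient.
\<close>

lemma window:
  assumes "xs \<in> set_pmf (Q n)"
  obtains J' where "J \<le> J'" "set xs \<subseteq> {1..<b J'}"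
proof -
  have "\<exists>J'. set ys \<subseteq> {1..<b J'}" if "set ys \<subseteq> set_pmf p" for ys
    using that
  proof (induction ys)
    case (Cons y ys)
    then obtain J1 J2 where J: "set ys \<subseteq> {1..<b J1}" "y \<in> {1..<b J2}"
      unfolding support by auto
    have "set (y # ys) \<subseteq> {1..<b (max J1 J2)}"
      using J b_le[of J1 "max J1 J2"] b_le[of J2 "max J1 J2"] by auto
    then show ?case by blast
  qed auto
  moreover have "set xs \<subseteq> set_pmf p" using assms by (auto simp: set_replicate_pmf)
  ultimately obtain J' where "set xs \<subseteq> {1..<b J'}" by blast
  then have "set xs \<subseteq> {1..<b (max J J')}" using b_le[of J' "max J J'"] by auto
  then show ?thesis by (intro that[of "max J J'"]) auto
qed

lemma sample_nonempty: "xs \<in> set_pmf (Q n) \<Longrightarrow> 0 < n \<Longrightarrow> xs \<noteq> []"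
  by (auto simp: set_replicate_pmf)

lemma est_bounds:
  assumes xs: "xs \<noteq> []" "set xs \<subseteq> {1..<b J'}"
  shows "0 \<le> est xs i \<and> est xs i \<le> 1" "b J' \<le> i \<Longrightarrow> est xs i = 0" "est xs 0 = 0" "sum (est xs) {..<b J'} = 1"
proof -
  note e = est[OF xs]
  have y1: "yv xs i \<le> 1" if "i \<in> {1..<b J'}" for i
    using yv_sum[OF xs] member_le_sum[OF that, of "yv xs"] yv_nonneg by simp
  show "0 \<le> est xs i \<and> est xs i \<le> 1"
  proof (cases "i \<in> {1..<b J'}")
    case True
    show ?thesis unfolding e
      by (rule conjI, rule is_isoreg_ge[OF is_isoreg_isoreg _ True], rule yv_nonneg,
          rule is_isoreg_le[OF is_isoreg_isoreg _ True], rule y1)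
  qed (auto simp: e isoreg_outside)
  show "b J' \<le> i \<Longrightarrow> est xs i = 0" "est xs 0 = 0" by (auto simp: e isoreg_outside)
  have "{..<b J'} = insert 0 {1..<b J'}" using b_pos[of J'] by auto
  then have "sum (est xs) {..<b J'} = sum (est xs) {1..<b J'}" using \<open>est xs 0 = 0\<close> by simp
  also have "\<dots> = 1" unfolding e
    using is_isoreg_isoreg[of 1 "b J'" "yv xs"] yv_sum[OF xs] unfolding is_isoreg_def by simp
  finally show "sum (est xs) {..<b J'} = 1" .
qed

lemma err_bounds:
  assumes "xs \<in> set_pmf (Q n)" "0 < n"
  shows "0 \<le> err xs i" "err xs i \<le> 1" "summable (\<lambda>i. if P i then err xs i else 0)"
    "(\<Sum>i. if P i then err xs i else 0) \<le> 2" "err xs 0 = 0" "0 \<le> (\<Sum>i. if P i then err xs i else 0)"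
proof -
  obtain J' where J': "set xs \<subseteq> {1..<b J'}" using window[OF assms(1)] by blast
  note e = est_bounds[OF sample_nonempty[OF assms] J']
  show "0 \<le> err xs i" by (simp add: err_def)
  show "err xs i \<le> 1" unfolding err_def using e(1)[of i] by (intro square_diff_le) (auto simp: pmf_le_1)
  show "summable (\<lambda>i. if P i then err xs i else 0)"
    unfolding err_def by (rule summable_tail_square[OF e(1,2)])
  then show "0 \<le> (\<Sum>i. if P i then err xs i else 0)" by (intro suminf_nonneg) (auto simp: err_def)
  show "(\<Sum>i. if P i then err xs i else 0) \<le> 2"
    unfolding err_def by (rule suminf_tail_square_le_2[OF e(1,2)]) (use e(4) in auto)
  show "err xs 0 = 0" by (simp add: err_def e(3) pmf_0)
qed

lemma est_block:
  assumes "xs \<in> set_pmf (Q n)" "0 < n" "separated j (yv xs)" "separated (Suc j) (yv xs)" "i \<in> {b j..<b (Suc j)}"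
  shows "est xs i = isoreg (b j) (b (Suc j)) (yv xs) i"
proof -
  obtain J' where J': "Suc j \<le> J'" "set xs \<subseteq> {1..<b J'}" using window[OF assms(1)] by blast
  show ?thesis
    unfolding est[OF sample_nonempty[OF assms(1,2)] J'(2)] using assms J' by (intro isoreg_block)
qed

text \<open>
  Once the regression splits at \<open>b J\<close>, its tail is a regression by itself and hence a contraction
  towards \<open>p\<close>.
\<close>

lemma tail_err_le:
  assumes xs: "xs \<in> set_pmf (Q n)" "0 < n" and sep: "separated J (yv xs)"
  shows "(\<Sum>i. if b J \<le> i then err xs i else 0) \<le> (\<Sum>i. if b J \<le> i then (emp xs i - pmf p i)\<^sup>2 else 0)"
proof -
  obtain J' where J': "J \<le> J'" "set xs \<subseteq> {1..<b J'}" using window[OF xs(1)] by blast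
  note ne = sample_nonempty[OF xs]
  note e = est_bounds[OF ne J'(2)]
  have emp0: "emp xs i = 0" if "b J' \<le> i" for i using J'(2) that by (intro emp_eq_0) auto
  have s: "summable (\<lambda>i. if b J \<le> i then (emp xs i - pmf p i)\<^sup>2 else 0)"
    by (rule summable_tail_square[OF _ emp0]) (auto simp: emp_nonneg emp_le_1)
  have split: "(\<Sum>i<b J'. if b J \<le> i then u i else 0) = sum u {b J..<b J'}" for u :: "nat \<Rightarrow> real"
    by (intro sum.mono_neutral_cong_right) auto
  have "sum (err xs) {b J..<b J'} = (\<Sum>i=b J..<b J'. (isoreg (b J) (b J') (yv xs) i - pmf p i)\<^sup>2)"
    unfolding err_def est[OF ne J'(2)] using isoreg_tail[OF sep J'(1)] by (intro sum.cong) auto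
  also have "\<dots> \<le> (\<Sum>i=b J..<b J'. (yv xs i - pmf p i)\<^sup>2)"
    by (intro is_isoreg_contraction is_isoreg_isoreg antimono_on_pmf b_pos)
  also have "\<dots> \<le> (\<Sum>i=b J..<b J'. (emp xs i - pmf p i)\<^sup>2)"
    unfolding sum_blocks_from[OF J'(1)] by (intro sum_mono yv_block)
  finally have *: "sum (err xs) {b J..<b J'} \<le> (\<Sum>i=b J..<b J'. (emp xs i - pmf p i)\<^sup>2)" .
  have "(\<Sum>i. if b J \<le> i + b J' then err xs (i + b J') else 0) =
      (\<Sum>i. if b J \<le> i + b J' then (emp xs (i + b J') - pmf p (i + b J'))\<^sup>2 else 0)"
    by (intro suminf_cong) (simp add: err_def e(2) emp0)
  then show ?thesis
    using * unfolding suminf_split_initial_segment[OF s, of "b J'"]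
      suminf_split_initial_segment[OF err_bounds(3)[OF xs], of _ "b J'"] split
    by simp
qed

lemma close_separated:
  obtains d where "0 < d" "\<And>xs j. close_emp p d xs \<Longrightarrow> j \<le> J \<Longrightarrow> separated j (yv xs)"
proof -
  obtain d where d: "d > 0" "\<forall>y. (\<forall>i. \<bar>y i - pmf p i\<bar> < d) \<longrightarrow> (\<forall>j\<le>J. separated j y)"
    using close_imp_separated by blast
  show ?thesis
    using d yv_close by (intro that[of d]) (auto simp: close_emp_def)
qed

definition block_risk_at :: "nat \<Rightarrow> nat \<Rightarrow> real" where
  "block_risk_at n j = measure_pmf.expectation (Q n) (\<lambda>xs. real n * (\<Sum>i=b j..<b (Suc j). err xs i))"

lemma integrable_block_err:
  assumes "0 < n"
  shows "integrable (Q n) (\<lambda>xs. real n * (\<Sum>i=l..<u. err xs i))"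
proof (rule integrable_pmf_bounded)
  fix xs assume xs: "xs \<in> set_pmf (Q n)"
  have "(\<Sum>i=l..<u. err xs i) \<le> real (card {l..<u}) * 1"
    using err_bounds(2)[OF xs assms] by (intro sum_bounded_above) auto
  moreover have "0 \<le> (\<Sum>i=l..<u. err xs i)" using err_bounds(1)[OF xs assms] by (intro sum_nonneg) auto
  ultimately show "\<bar>real n * (\<Sum>i=l..<u. err xs i)\<bar> \<le> real n * (real (card {l..<u}) * 1)"
    by (simp add: abs_mult mult_left_mono)
qed

lemma isoreg_block_sum_bounds:
  fixes xs j
  defines "S \<equiv> (\<Sum>i=b j..<b (Suc j). (isoreg (b j) (b (Suc j)) (yv xs) i - pmf p i)\<^sup>2)"
  shows "0 \<le> S" "S \<le> (\<Sum>i=b j..<b (Suc j). (emp xs i - pmf p i)\<^sup>2)"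
    "S \<le> real (b (Suc j) - b j)"
proof -
  show "0 \<le> S" unfolding S_def by (intro sum_nonneg) auto
  show "S \<le> (\<Sum>i=b j..<b (Suc j). (emp xs i - pmf p i)\<^sup>2)"
    unfolding S_def by (rule order_trans[OF is_isoreg_contraction[OF is_isoreg_isoreg] yv_block])
      (intro antimono_on_pmf b_pos)
  also have "\<dots> \<le> real (card {b j..<b (Suc j)}) * 1"
    by (intro sum_bounded_above square_diff_le) (auto simp: emp_nonneg emp_le_1 pmf_le_1)
  finally show "S \<le> real (b (Suc j) - b j)" by simp
qed

text \<open>
  The estimator agrees with its local version except on an event whose probability is \<open>o(1/n)\<close>, so the
  factor \<open>n\<close> in the risk is harmless there.
\<close>

lemma block_risk_tendsto: "(\<lambda>n. block_risk_at n j) \<longlonglongrightarrow> c j"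
proof -
  obtain d where d: "d > 0" "\<And>xs j'. close_emp p d xs \<Longrightarrow> j' \<le> Suc j \<Longrightarrow> separated j' (yv xs)"
    using close_separated[of "Suc j"] by metis
  define w where "w = real (b (Suc j) - b j)"
  define bad where "bad n = measure (Q n) {xs. \<not> close_emp p d xs}" for n
  let ?S = "\<lambda>xs. \<Sum>i=b j..<b (Suc j). (isoreg (b j) (b (Suc j)) (yv xs) i - pmf p i)\<^sup>2"
  have "\<bar>block_risk_at n j - c j\<bar> \<le> w * (real n * bad n)" if n: "0 < n" for n
  proof -
    have i1: "integrable (Q n) (\<lambda>xs. real n * (\<Sum>i=b j..<b (Suc j). err xs i))"
      by (rule integrable_block_err[OF n])
    have i2: "integrable (Q n) (\<lambda>xs. real n * ?S xs)"
    proof (rule integrable_pmf_bounded[where B = "real n * w"])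
      fix xs show "\<bar>real n * ?S xs\<bar> \<le> real n * w"
        using isoreg_block_sum_bounds[of j xs] by (simp add: abs_mult mult_left_mono w_def)
    qed
    have eq: "(\<Sum>i=b j..<b (Suc j). err xs i) = ?S xs" if "xs \<in> set_pmf (Q n)" "close_emp p d xs" for xs
      unfolding err_def using est_block[OF that(1) n d(2)[OF that(2), of j] d(2)[OF that(2), of "Suc j"]]
      by (intro sum.cong) auto
    have bound: "0 \<le> (\<Sum>i=b j..<b (Suc j). err xs i) \<and> (\<Sum>i=b j..<b (Suc j). err xs i) \<le> w"
      if "xs \<in> set_pmf (Q n)" for xs
    proof -
      have "(\<Sum>i=b j..<b (Suc j). err xs i) \<le> real (card {b j..<b (Suc j)}) * 1"
        using err_bounds(2)[OF that n] by (intro sum_bounded_above) auto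
      moreover have "0 \<le> (\<Sum>i=b j..<b (Suc j). err xs i)"
        using err_bounds(1)[OF that n] by (intro sum_nonneg) auto
      ultimately show ?thesis by (simp add: w_def)
    qed
    have 1: "block_risk_at n j \<le> c j + (real n * w) * bad n"
      unfolding block_risk_at_def block_risk[OF n, of j, symmetric] bad_def
    proof (rule expectation_diff_le_prob[OF i1 i2])
      fix xs assume xs: "xs \<in> set_pmf (Q n)"
      have "(\<Sum>i=b j..<b (Suc j). err xs i) \<le> ?S xs + w * indicator {xs. \<not> close_emp p d xs} xs"
        using eq[OF xs] bound[OF xs] isoreg_block_sum_bounds(1)[of j xs]
        by (cases "close_emp p d xs") auto
      then have "real n * (\<Sum>i=b j..<b (Suc j). err xs i) \<le>
          real n * (?S xs + w * indicator {xs. \<not> close_emp p d xs} xs)"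
        by (rule mult_left_mono) simp
      then show "real n * (\<Sum>i=b j..<b (Suc j). err xs i)
         \<le> real n * ?S xs + real n * w * indicator {xs. \<not> close_emp p d xs} xs"
        by (simp only: distrib_left mult.assoc)
    qed
    have 2: "c j \<le> block_risk_at n j + (real n * w) * bad n"
      unfolding block_risk_at_def block_risk[OF n, of j, symmetric] bad_def
    proof (rule expectation_diff_le_prob[OF i2 i1])
      fix xs assume xs: "xs \<in> set_pmf (Q n)"
      have "?S xs \<le> (\<Sum>i=b j..<b (Suc j). err xs i) + w * indicator {xs. \<not> close_emp p d xs} xs"
        using eq[OF xs] bound[OF xs] isoreg_block_sum_bounds(3)[of j xs]
        by (cases "close_emp p d xs") (auto simp: w_def)
      then have "real n * ?S xs \<le>
          real n * ((\<Sum>i=b j..<b (Suc j). err xs i) + w * indicator {xs. \<not> close_emp p d xs} xs)"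
        by (rule mult_left_mono) simp
      then show "real n * ?S xs
         \<le> real n * (\<Sum>i=b j..<b (Suc j). err xs i) + real n * w * indicator {xs. \<not> close_emp p d xs} xs"
        by (simp only: distrib_left mult.assoc)
    qed
    show ?thesis using 1 2 by (simp add: abs_le_iff mult_ac)
  qed
  then have "\<forall>\<^sub>F n in sequentially. norm (block_risk_at n j - c j) \<le> w * (real n * bad n)"
    by (intro eventually_mono[OF eventually_gt_at_top[of 0]]) simp
  moreover have "(\<lambda>n. w * (real n * bad n)) \<longlonglongrightarrow> w * 0"
    unfolding bad_def by (intro tendsto_mult tendsto_const prob_not_close_emp d)
  ultimately have "(\<lambda>n. block_risk_at n j - c j) \<longlonglongrightarrow> 0"
    unfolding mult_zero_right by (rule Lim_null_comparison)
  then show ?thesis by (simp add: LIM_zero_iff)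
qed

lemma c_bounds: "0 \<le> c j" "c j \<le> measure p {b j..<b (Suc j)}"
proof -
  let ?S = "\<lambda>xs. \<Sum>i=b j..<b (Suc j). (isoreg (b j) (b (Suc j)) (yv xs) i - pmf p i)\<^sup>2"
  show "0 \<le> c j" unfolding block_risk[of 1 j, OF zero_less_one, symmetric]
    using isoreg_block_sum_bounds(1) by (intro Bochner_Integration.integral_nonneg) simp
  have dev: "measure_pmf.expectation (Q 1) (\<lambda>xs. (emp xs i - pmf p i)\<^sup>2) = pmf p i * (1 - pmf p i)" for i
    using expectation_emp_deviation[of "{i}" 1 p] by (simp add: measure_pmf_single)
  have b1: "(emp xs i - pmf p i)\<^sup>2 \<le> 1" for xs i
    using emp_nonneg emp_le_1 by (intro square_diff_le) (auto simp: pmf_le_1)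
  have int: "integrable (Q 1) (\<lambda>xs. (emp xs i - pmf p i)\<^sup>2)" for i
    using b1 by (intro integrable_pmf_bounded[where B = 1]) simp
  have "c j = measure_pmf.expectation (Q 1) ?S" 
    using block_risk[of 1 j] by simp
  also have "\<dots> \<le> measure_pmf.expectation (Q 1) (\<lambda>xs. \<Sum>i=b j..<b (Suc j). (emp xs i - pmf p i)\<^sup>2)"
    using isoreg_block_sum_bounds[of j]
    by (intro integral_mono Bochner_Integration.integrable_sum int
        integrable_pmf_bounded[where B = "real (b (Suc j) - b j)"]) (auto simp: abs_le_iff)
  also have "\<dots> = (\<Sum>i=b j..<b (Suc j). pmf p i * (1 - pmf p i))"
    by (subst Bochner_Integration.integral_sum[OF int]) (simp only: dev)
  also have "\<dots> \<le> (\<Sum>i=b j..<b (Suc j). pmf p i)"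
    by (intro sum_mono mult_left_le) auto
  also have "\<dots> = measure p {b j..<b (Suc j)}" by (simp add: measure_measure_pmf_finite)
  finally show "c j \<le> measure p {b j..<b (Suc j)}" .
qed

lemma summable_c: "summable c"
proof (rule summableI_nonneg_bounded[where x = 1])
  fix J
  have "sum c {..<J} \<le> (\<Sum>j<J. sum (pmf p) {b j..<b (Suc j)})"
    using c_bounds(2) by (intro sum_mono) (simp add: measure_measure_pmf_finite)
  also have "\<dots> = measure p {1..<b J}"
    by (subst sum_blocks[symmetric]) (simp add: measure_measure_pmf_finite)
  finally show "sum c {..<J} \<le> 1" by (rule order_trans) simp
qed (rule c_bounds)

definition l2_risk :: "nat \<Rightarrow> real" where
  "l2_risk n = measure_pmf.expectation (Q n) (\<lambda>xs. real n * (\<Sum>i. err xs i))"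

text \<open>
  Finitely many regions converge one by one. The remaining ones contribute at most the tail of \<open>p\<close> on
  the event that the regression splits, and at most \<open>2 * n\<close> times a probability of order \<open>o(1/n)\<close>
  otherwise.
\<close>

lemma l2_risk_tendsto: "l2_risk \<longlonglongrightarrow> suminf c"
proof -
  define tail where "tail J xs = (\<Sum>i. if b J \<le> i then err xs i else 0)" for J xs
  define T where "T n J = measure_pmf.expectation (Q n) (\<lambda>xs. real n * tail J xs)" for n J
  have "\<exists>d>0. \<forall>xs. close_emp p d xs \<longrightarrow> separated J (yv xs)" for J
    using close_separated[of J] by (metis order_refl)
  then obtain d where d: "\<And>J. d J > 0" "\<And>J xs. close_emp p (d J) xs \<Longrightarrow> separated J (yv xs)"
    by metis
  have tb: "0 \<le> tail J xs" "tail J xs \<le> 2" if "xs \<in> set_pmf (Q n)" "0 < n" for J xs n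
    unfolding tail_def using err_bounds(4,6)[OF that] by blast+
  have iT: "integrable (Q n) (\<lambda>xs. real n * tail J xs)" if "0 < n" for n J
    using tb[OF _ that, of _ J] by (intro integrable_pmf_bounded[where B = "real n * 2"]) 
      (auto simp: abs_mult intro!: mult_left_mono)
  show ?thesis
  proof (rule tendsto_of_block_tendsto[where a = block_risk_at and T = T
        and \<tau> = "\<lambda>J. measure p {b J..}"
        and e = "\<lambda>J n. 2 * (real n * measure (Q n) {xs. \<not> close_emp p (d J) xs})"])
    show "l2_risk n = (\<Sum>j<J. block_risk_at n j) + T n J" if n: "0 < n" for n J
    proof -
      have "l2_risk n = measure_pmf.expectation (Q n)
        (\<lambda>xs. (\<Sum>j<J. real n * (\<Sum>i=b j..<b (Suc j). err xs i)) + real n * tail J xs)"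
        unfolding l2_risk_def
      proof (intro integral_cong_AE)
        have "(\<Sum>i. err xs i) = (\<Sum>j<J. \<Sum>i=b j..<b (Suc j). err xs i) + tail J xs"
          if xs: "xs \<in> set_pmf (Q n)" for xs
        proof -
          note e = err_bounds[OF xs n]
          have "(\<Sum>i. err xs i) = (\<Sum>i. (if i \<in> {1..<b J} then err xs i else 0) + (if b J \<le> i then err xs i else 0))"
            using e(5) by (intro suminf_cong) (auto simp: not_le Suc_le_eq)
          also have "\<dots> = (\<Sum>i. if i \<in> {1..<b J} then err xs i else 0) + tail J xs"
            unfolding tail_def by (rule suminf_add[symmetric]) (rule e(3))+
          also have "(\<Sum>i. if i \<in> {1..<b J} then err xs i else 0) = sum (err xs) {1..<b J}"
            by (subst suminf_finite[of "{1..<b J}"]) auto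
          finally show ?thesis by (simp only: sum_blocks)
        qed
        then show "AE xs in Q n. real n * (\<Sum>i. err xs i) =
            (\<Sum>j<J. real n * (\<Sum>i=b j..<b (Suc j). err xs i)) + real n * tail J xs"
          by (auto simp: AE_measure_pmf_iff distrib_left sum_distrib_left)
      qed auto
      also have "\<dots> = (\<Sum>j<J. block_risk_at n j) + T n J"
        unfolding block_risk_at_def T_def using integrable_block_err[OF n] iT[OF n]
        by (subst Bochner_Integration.integral_add) (auto simp: Bochner_Integration.integral_sum)
      finally show ?thesis .
    qed
    show "0 \<le> T n J" if "0 < n" for n J
      unfolding T_def using tb[OF _ that, of _ J] 
      by (intro integral_nonneg_AE) (auto simp: AE_measure_pmf_iff)
    show "T n J \<le> measure p {b J..} + 2 * (real n * measure (Q n) {xs. \<not> close_emp p (d J) xs})"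
      if n: "0 < n" for n J
    proof -
      let ?tail = "\<lambda>xs. \<Sum>i. if b J \<le> i then (emp xs i - pmf p i)\<^sup>2 else 0"
      have t0: "0 \<le> ?tail xs" for xs
      proof (rule suminf_nonneg[OF summable_tail_square])
        show "emp xs i = 0" if "Suc (sum_list xs) \<le> i" for i
          using that member_le_sum_list[of i xs] by (intro emp_eq_0) auto
      qed (auto simp: emp_nonneg emp_le_1)
      have "T n J \<le> measure_pmf.expectation (Q n) (\<lambda>xs. real n * ?tail xs)
          + (real n * 2) * measure (Q n) {xs. \<not> close_emp p (d J) xs}"
        unfolding T_def
      proof (rule expectation_diff_le_prob[OF iT[OF n] expectation_emp_tail(1)[OF n]])
        fix xs assume xs: "xs \<in> set_pmf (Q n)"
        have "tail J xs \<le> ?tail xs + 2 * indicator {xs. \<not> close_emp p (d J) xs} xs"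
          using tail_err_le[OF xs n d(2)] tb(2)[OF xs n, of J] t0[of xs]
          by (cases "close_emp p (d J) xs") (auto simp: tail_def)
        then have "real n * tail J xs \<le> real n * (?tail xs + 2 * indicator {xs. \<not> close_emp p (d J) xs} xs)"
          by (rule mult_left_mono) simp
        then show "real n * tail J xs \<le> real n * ?tail xs + real n * 2 * indicator {xs. \<not> close_emp p (d J) xs} xs"
          by (simp only: distrib_left mult.assoc)
      qed
      then show ?thesis using expectation_emp_tail(2)[OF n, of p "b J"] by simp
    qed
    show "(\<lambda>n. 2 * (real n * measure (Q n) {xs. \<not> close_emp p (d J) xs})) \<longlonglongrightarrow> 0" for J
      using tendsto_mult[OF tendsto_const[of 2] prob_not_close_emp[OF d(1), of p J]] by simp
  qed (auto intro: measure_tail_tendsto_0 block_risk_tendsto summable_c)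
qed

end

section \<open>Hellinger loss of estimators that localise\<close>

text \<open>
  The squared difference of roots is \<open>(x - y)\<^sup>2 / (sqrt x + sqrt y)\<^sup>2\<close>, and the denominator is
  \<open>4 * y\<close> up to an error of order \<open>x - y\<close>.
\<close>

lemma sqrt_diff_square_approx:
  fixes x y :: real
  assumes "0 \<le> x" "0 < y"
  shows "\<bar>(sqrt x - sqrt y)\<^sup>2 - (x - y)\<^sup>2 / (4 * y)\<bar> \<le> 3 / (4 * y\<^sup>2) * (\<bar>x - y\<bar> * (x - y)\<^sup>2)"
proof -
  define u v where "u = sqrt x" and "v = sqrt y"
  have uv: "0 \<le> u" "0 < v" and x: "x = u\<^sup>2" and y: "y = v\<^sup>2"
    using assms by (auto simp: u_def v_def)
  define e where "e = u - v"
  have xy: "x - y = e * (u + v)" by (simp add: x y e_def power2_eq_square algebra_simps)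
  have "(u - v)\<^sup>2 - (x - y)\<^sup>2 / (4 * y) = e\<^sup>2 - e\<^sup>2 * (u + v)\<^sup>2 / (4 * v\<^sup>2)"
    unfolding xy power_mult_distrib unfolding y e_def ..
  also have "\<dots> = e\<^sup>2 * (4 * v\<^sup>2 - (u + v)\<^sup>2) / (4 * v\<^sup>2)"
    using uv by (simp add: right_diff_distrib diff_divide_distrib)
  also have "4 * v\<^sup>2 - (u + v)\<^sup>2 = - (e * (3 * v + u))"
    by (simp add: e_def power2_eq_square algebra_simps)
  finally have "\<bar>(u - v)\<^sup>2 - (x - y)\<^sup>2 / (4 * y)\<bar> = \<bar>e\<bar> ^ 3 * (3 * v + u) / (4 * v\<^sup>2)"
    using uv by (simp add: abs_mult power2_eq_square power3_eq_cube mult_ac)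
  also have "\<dots> \<le> \<bar>e\<bar> ^ 3 * (3 * (u + v)) / (4 * v\<^sup>2)"
    using uv by (intro divide_right_mono mult_left_mono) auto
  also have "\<dots> = 3 * \<bar>e\<bar> ^ 3 * (u + v) * v\<^sup>2 / (4 * (v\<^sup>2)\<^sup>2)"
    using uv by (simp add: power2_eq_square field_simps)
  also have "\<dots> \<le> 3 * \<bar>e\<bar> ^ 3 * (u + v) * (u + v)\<^sup>2 / (4 * (v\<^sup>2)\<^sup>2)"
    using uv by (intro divide_right_mono mult_left_mono power_mono) auto
  also have "\<dots> = 3 / (4 * y\<^sup>2) * (\<bar>x - y\<bar> * (x - y)\<^sup>2)"
    unfolding xy unfolding y using uv
    by (simp add: abs_mult power2_eq_square power3_eq_cube mult_ac)
  finally show ?thesis by (simp add: u_def v_def)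
qed

context blockwise_estimator
begin

lemma est_close:
  assumes "xs \<in> set_pmf (Q n)" "0 < n" "separated j (yv xs)" "separated (Suc j) (yv xs)"
    "close_emp p d xs" "i \<in> {b j..<b (Suc j)}"
  shows "\<bar>est xs i - pmf p i\<bar> \<le> d"
proof -
  have y: "\<bar>yv xs i' - pmf p (b j)\<bar> < d" if "i' \<in> {b j..<b (Suc j)}" for i'
    using yv_close[of xs d i'] flat[OF that] assms(5) by (auto simp: close_emp_def)
  have "pmf p (b j) - d \<le> isoreg (b j) (b (Suc j)) (yv xs) i"
    by (rule is_isoreg_ge[OF is_isoreg_isoreg _ assms(6)]) (use y in \<open>force simp: abs_less_iff\<close>)
  moreover have "isoreg (b j) (b (Suc j)) (yv xs) i \<le> pmf p (b j) + d"
    by (rule is_isoreg_le[OF is_isoreg_isoreg _ assms(6)]) (use y in \<open>force simp: abs_less_iff\<close>)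
  ultimately show ?thesis
    using est_block[OF assms(1-4,6)] flat[OF assms(6)] by (simp add: abs_le_iff)
qed

definition hellinger_risk :: "nat \<Rightarrow> nat \<Rightarrow> real" where
  "hellinger_risk N n = measure_pmf.expectation (Q n)
     (\<lambda>xs. real n * (1 / 2 * (\<Sum>i=1..<N. (sqrt (est xs i) - sqrt (pmf p i))\<^sup>2)))"

lemma expectation_block_sum:
  assumes n: "0 < n" and u: "\<And>j i. i \<in> {b j..<b (Suc j)} \<Longrightarrow> u i = u (b j)"
  shows "measure_pmf.expectation (Q n) (\<lambda>xs. real n * (\<Sum>i=1..<b J. err xs i * u i)) =
      (\<Sum>j<J. u (b j) * block_risk_at n j)"
proof -
  have "(\<lambda>xs. real n * (\<Sum>i=1..<b J. err xs i * u i)) =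
      (\<lambda>xs. \<Sum>j<J. u (b j) * (real n * (\<Sum>i=b j..<b (Suc j). err xs i)))"
    unfolding sum_blocks by (auto simp: fun_eq_iff sum_distrib_left u intro!: sum.cong)
  then have "measure_pmf.expectation (Q n) (\<lambda>xs. real n * (\<Sum>i=1..<b J. err xs i * u i)) =
      measure_pmf.expectation (Q n) (\<lambda>xs. \<Sum>j<J. u (b j) * (real n * (\<Sum>i=b j..<b (Suc j). err xs i)))"
    by (simp only:)
  also have "\<dots> = (\<Sum>j<J. u (b j) * block_risk_at n j)"
    unfolding block_risk_at_def
    by (subst Bochner_Integration.integral_sum)
      (intro integrable_mult_right integrable_block_err[OF n], simp)
  finally show ?thesis .
qed

text \<open>
  By the preceding approximation the Hellinger loss is a weighted squared error, up to a cubic term.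
  The cubic term is at most a small constant times the squared error if the frequencies are close to
  \<open>p\<close>, and bounded otherwise.
\<close>

lemma hellinger_risk_tendsto:
  "hellinger_risk (b J) \<longlonglongrightarrow> (\<Sum>j<J. c j / (8 * pmf p (b j)))"
proof -
  define L where "L n = (\<Sum>j<J. 1 / (8 * pmf p (b j)) * block_risk_at n j)" for n
  define A where "A n = (\<Sum>j<J. 1 * block_risk_at n j)" for n
  define W where "W = real (b J - 1)"
  define \<kappa> where "\<kappa> = (\<Sum>i=1..<b J. 3 / (4 * (pmf p i)\<^sup>2))"
  define bad where "bad d n = measure (Q n) {xs. \<not> close_emp p d xs}" for d n
  have \<kappa>0: "0 \<le> \<kappa>" unfolding \<kappa>_def by (intro sum_nonneg) auto
  have W0: "0 \<le> W" by (simp add: W_def)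
  have \<kappa>: "3 / (4 * (pmf p i)\<^sup>2) \<le> \<kappa>" if "i \<in> {1..<b J}" for i
    unfolding \<kappa>_def by (rule member_le_sum[OF that]) auto
  obtain d0 where d0: "d0 > 0" "\<And>xs j. close_emp p d0 xs \<Longrightarrow> j \<le> J \<Longrightarrow> separated j (yv xs)"
    using close_separated[of J] by metis
  define H where "H xs = 1 / 2 * (\<Sum>i=1..<b J. (sqrt (est xs i) - sqrt (pmf p i))\<^sup>2)" for xs
  define G where "G xs = (\<Sum>i=1..<b J. err xs i * (1 / (8 * pmf p i)))" for xs
  define S where "S xs = (\<Sum>i=1..<b J. err xs i * 1)" for xs
  have approx: "\<bar>H xs - G xs\<bar> \<le> \<kappa> * d * S xs + \<kappa> * W * indicator {xs. \<not> close_emp p d xs} xs"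
    if xs: "xs \<in> set_pmf (Q n)" and n: "0 < n" and d: "0 < d" "d \<le> d0" for xs n d
  proof -
    obtain J' where J': "set xs \<subseteq> {1..<b J'}" using window[OF xs] by blast
    have e01: "0 \<le> est xs i \<and> est xs i \<le> 1" for i
      by (rule est_bounds(1)[OF sample_nonempty[OF xs n] J'])
    have pointwise: "\<bar>1 / 2 * (sqrt (est xs i) - sqrt (pmf p i))\<^sup>2 - err xs i * (1 / (8 * pmf p i))\<bar>
        \<le> \<kappa> * (\<bar>est xs i - pmf p i\<bar> * err xs i)" if i: "i \<in> {1..<b J}" for i
    proof -
      let ?D = "(sqrt (est xs i) - sqrt (pmf p i))\<^sup>2 - err xs i / (4 * pmf p i)"
      have "\<bar>?D\<bar> \<le> 3 / (4 * (pmf p i)\<^sup>2) * (\<bar>est xs i - pmf p i\<bar> * err xs i)"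
        unfolding err_def using i e01[of i] by (intro sqrt_diff_square_approx pmf_pos[of i J]) auto
      also have "\<dots> \<le> \<kappa> * (\<bar>est xs i - pmf p i\<bar> * err xs i)"
        using \<kappa>[OF i] by (intro mult_right_mono) (auto simp: err_def)
      finally have "\<bar>?D\<bar> \<le> \<kappa> * (\<bar>est xs i - pmf p i\<bar> * err xs i)" .
      moreover have "1 / 2 * (sqrt (est xs i) - sqrt (pmf p i))\<^sup>2 - err xs i * (1 / (8 * pmf p i)) = 1 / 2 * ?D"
        by (simp add: field_simps)
      ultimately show ?thesis by (simp only: abs_mult) auto
    qed
    have "H xs - G xs = (\<Sum>i=1..<b J. 1 / 2 * (sqrt (est xs i) - sqrt (pmf p i))\<^sup>2 - err xs i * (1 / (8 * pmf p i)))"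
      unfolding H_def G_def sum_subtractf sum_distrib_left ..
    then have "\<bar>H xs - G xs\<bar> \<le> (\<Sum>i=1..<b J. \<kappa> * (\<bar>est xs i - pmf p i\<bar> * err xs i))"
      by (simp only:) (rule order_trans[OF sum_abs sum_mono[OF pointwise]])
    also have "\<dots> \<le> \<kappa> * d * S xs + \<kappa> * W * indicator {xs. \<not> close_emp p d xs} xs"
    proof (cases "close_emp p d xs")
      case True
      then have "close_emp p d0 xs" using d unfolding close_emp_def by (meson less_le_trans)
      then have sep: "separated j (yv xs)" if "j \<le> J" for j using d0(2) that by blast
      have "\<bar>est xs i - pmf p i\<bar> \<le> d" if i: "i \<in> {1..<b J}" for i
      proof -
        obtain j where j: "j < J" "i \<in> {b j..<b (Suc j)}" using block_exists[of i J] i by auto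
        show ?thesis using j by (intro est_close[OF xs n sep sep True]) auto
      qed
      then have "(\<Sum>i=1..<b J. \<kappa> * (\<bar>est xs i - pmf p i\<bar> * err xs i)) \<le> (\<Sum>i=1..<b J. \<kappa> * (d * err xs i))"
        using \<kappa>0 by (intro sum_mono mult_left_mono mult_right_mono) (auto simp: err_def)
      also have "\<dots> = \<kappa> * d * S xs" unfolding S_def by (simp add: sum_distrib_left mult.assoc)
      finally show ?thesis using True by simp
    next
      case False
      have "(\<Sum>i=1..<b J. \<kappa> * (\<bar>est xs i - pmf p i\<bar> * err xs i)) \<le> (\<Sum>i=1..<b J. \<kappa> * (1 * 1))"
      proof (intro sum_mono mult_left_mono mult_mono)
        fix i show "\<bar>est xs i - pmf p i\<bar> \<le> 1"
          using e01[of i] pmf_le_1[of p i] pmf_nonneg[of p i] unfolding abs_le_iff by linarith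
      qed (use err_bounds(1,2)[OF xs n] \<kappa>0 in auto)
      also have "\<dots> = \<kappa> * W" by (simp add: W_def)
      also have "\<dots> \<le> \<kappa> * d * S xs + \<kappa> * W"
        using \<kappa>0 d by (simp add: S_def err_def sum_nonneg)
      finally show ?thesis using False by simp
    qed
    finally show ?thesis .
  qed
  have bound: "\<bar>hellinger_risk (b J) n - L n\<bar> \<le> \<kappa> * d * A n + \<kappa> * W * (real n * bad d n)"
    if n: "0 < n" and d: "0 < d" "d \<le> d0" for n d
  proof -
    have iS: "integrable (Q n) (\<lambda>xs. real n * S xs)"
      using integrable_block_err[OF n, of 1 "b J"] by (simp add: S_def)
    have int_err: "integrable (Q n) (\<lambda>xs. err xs i)" for i
      using err_bounds(1,2)[OF _ n] by (intro integrable_pmf_bounded[where B = 1]) auto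
    have iG: "integrable (Q n) (\<lambda>xs. real n * G xs)"
      unfolding G_def by (intro Bochner_Integration.integrable_sum integrable_mult_right integrable_mult_left int_err)
    have "integrable (Q n) (\<lambda>xs. (sqrt (est xs i) - sqrt (pmf p i))\<^sup>2)" for i
    proof (rule integrable_pmf_bounded[where B = 1])
      fix xs assume xs: "xs \<in> set_pmf (Q n)"
      obtain J' where J': "set xs \<subseteq> {1..<b J'}" using window[OF xs] by blast
      then show "\<bar>(sqrt (est xs i) - sqrt (pmf p i))\<^sup>2\<bar> \<le> 1"
        using est_bounds(1)[OF sample_nonempty[OF xs n] J', of i] square_diff_le(2)[of "sqrt (est xs i)" "sqrt (pmf p i)"]
        by (simp add: pmf_le_1)
    qed
    then have iH: "integrable (Q n) (\<lambda>xs. real n * H xs)"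
      unfolding H_def by (intro Bochner_Integration.integrable_sum integrable_mult_right)
    have EG: "measure_pmf.expectation (Q n) (\<lambda>xs. real n * G xs) = L n"
      unfolding G_def L_def by (rule expectation_block_sum[OF n]) (use flat in auto)
    have ES: "measure_pmf.expectation (Q n) (\<lambda>xs. real n * S xs) = A n"
      unfolding S_def A_def by (rule expectation_block_sum[OF n]) auto
    have EH: "hellinger_risk (b J) n = measure_pmf.expectation (Q n) (\<lambda>xs. real n * H xs)"
      unfolding hellinger_risk_def H_def ..
    let ?I = "\<lambda>xs. indicator {xs. \<not> close_emp p d xs} xs :: real"
    have nm: "real n * u \<le> real n * v + \<kappa> * d * (real n * S xs) + (\<kappa> * W * real n) * ?I xs"
      if "u \<le> v + (\<kappa> * d * S xs + \<kappa> * W * ?I xs)" for u v xs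
    proof -
      have "real n * u \<le> real n * (v + (\<kappa> * d * S xs + \<kappa> * W * ?I xs))"
        using that by (rule mult_left_mono) simp
      then show ?thesis by (simp add: algebra_simps)
    qed
    have "measure_pmf.expectation (Q n) (\<lambda>xs. real n * H xs) \<le>
      measure_pmf.expectation (Q n) (\<lambda>xs. real n * G xs + \<kappa> * d * (real n * S xs)) + (\<kappa> * W * real n) * bad d n"
      unfolding bad_def
    proof (rule expectation_diff_le_prob[OF iH])
      show "integrable (Q n) (\<lambda>xs. real n * G xs + \<kappa> * d * (real n * S xs))"
        using iG iS by simp
      fix xs assume "xs \<in> set_pmf (Q n)"
      from approx[OF this n d] show "real n * H xs \<le> real n * G xs + \<kappa> * d * (real n * S xs) + (\<kappa> * W * real n) * ?I xs"
        by (intro nm) (simp add: abs_le_iff)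
    qed
    also have "measure_pmf.expectation (Q n) (\<lambda>xs. real n * G xs + \<kappa> * d * (real n * S xs)) = L n + \<kappa> * d * A n"
      unfolding EG[symmetric] ES[symmetric] using iG iS by simp
    finally have 1: "hellinger_risk (b J) n \<le> L n + \<kappa> * d * A n + \<kappa> * W * (real n * bad d n)"
      by (simp add: EH mult.assoc)
    have "measure_pmf.expectation (Q n) (\<lambda>xs. real n * G xs) \<le>
      measure_pmf.expectation (Q n) (\<lambda>xs. real n * H xs + \<kappa> * d * (real n * S xs)) + (\<kappa> * W * real n) * bad d n"
      unfolding bad_def
    proof (rule expectation_diff_le_prob[OF iG])
      show "integrable (Q n) (\<lambda>xs. real n * H xs + \<kappa> * d * (real n * S xs))"
        using iH iS by simp
      fix xs assume "xs \<in> set_pmf (Q n)"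
      from approx[OF this n d] show "real n * G xs \<le> real n * H xs + \<kappa> * d * (real n * S xs) + (\<kappa> * W * real n) * ?I xs"
        by (intro nm) (simp add: abs_le_iff)
    qed
    also have "measure_pmf.expectation (Q n) (\<lambda>xs. real n * H xs + \<kappa> * d * (real n * S xs)) = hellinger_risk (b J) n + \<kappa> * d * A n"
      unfolding EH ES[symmetric] using iH iS by simp
    finally have 2: "L n \<le> hellinger_risk (b J) n + \<kappa> * d * A n + \<kappa> * W * (real n * bad d n)"
      by (simp only: EG mult.assoc)
    show ?thesis using 1 2 by (simp add: abs_le_iff)
  qed
  have A_lim: "A \<longlonglongrightarrow> (\<Sum>j<J. 1 * c j)"
    unfolding A_def by (intro tendsto_sum tendsto_mult tendsto_const block_risk_tendsto)
  define C where "C = \<bar>\<Sum>j<J. 1 * c j\<bar> + 1"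
  have C: "\<forall>\<^sub>F n in sequentially. A n < C" "0 < C"
    unfolding C_def using order_tendstoD(2)[OF A_lim, of "\<bar>\<Sum>j<J. 1 * c j\<bar> + 1"] by auto
  have "(\<lambda>n. hellinger_risk (b J) n - L n) \<longlonglongrightarrow> 0"
  proof (rule tendstoI)
    fix r :: real assume r: "0 < r"
    \<comment> \<open>with this precision the cubic term contributes at most \<open>r / 2\<close> in the limit\<close>
    define d where "d = min d0 (r / (2 * (\<kappa> + 1) * C))"
    have d: "0 < d" "d \<le> d0" using d0 r \<kappa>0 C by (auto simp: d_def)
    have "\<kappa> * d * C \<le> \<kappa> * (r / (2 * (\<kappa> + 1) * C)) * C"
      using \<kappa>0 C by (intro mult_right_mono mult_left_mono) (auto simp: d_def)
    also have "\<dots> = r / 2 * (\<kappa> / (\<kappa> + 1))" 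
    proof -
      have "0 < C" "\<kappa> + 1 \<noteq> 0" using C \<kappa>0 by auto
      moreover have "k * (r / (2 * u * C)) * C = r / 2 * (k / u)" if "0 < C" "u \<noteq> 0" for k u :: real
        using that by (simp add: field_simps)
      ultimately show ?thesis by blast
    qed
    also have "\<dots> \<le> r / 2 * 1" using \<kappa>0 r by (intro mult_left_mono) auto
    finally have dC: "\<kappa> * d * C \<le> r / 2" by simp
    have "(\<lambda>n. \<kappa> * W * (real n * bad d n)) \<longlonglongrightarrow> \<kappa> * W * 0"
      unfolding bad_def by (intro tendsto_mult tendsto_const prob_not_close_emp d)
    then have "\<forall>\<^sub>F n in sequentially. \<kappa> * W * (real n * bad d n) < r / 2"
      using r by (intro order_tendstoD(2)[where y = "\<kappa> * W * 0"]) auto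
    then show "\<forall>\<^sub>F n in sequentially. dist (hellinger_risk (b J) n - L n) 0 < r"
      using C(1) eventually_gt_at_top[of 0]
    proof eventually_elim
      case (elim n)
      have "\<kappa> * d * A n \<le> \<kappa> * d * C" using elim \<kappa>0 d by (intro mult_left_mono) auto
      then show ?case using bound[OF elim(3) d] elim dC unfolding dist_real_def diff_0_right by linarith
    qed
  qed
  moreover have "L \<longlonglongrightarrow> (\<Sum>j<J. 1 / (8 * pmf p (b j)) * c j)"
    unfolding L_def by (intro tendsto_sum tendsto_mult tendsto_const block_risk_tendsto)
  ultimately have "(\<lambda>n. (hellinger_risk (b J) n - L n) + L n) \<longlonglongrightarrow> 0 + (\<Sum>j<J. 1 / (8 * pmf p (b j)) * c j)"
    by (rule tendsto_add)
  then show ?thesis by simp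
qed

end

section \<open>Exact risks on a single region\<close>

text \<open>
  A cyclic permutation of \<open>{a..a + m}\<close>. Inside a region it preserves \<open>p\<close>, which is the exchangeability
  of the counts that the Spitzer identity requires.
\<close>

definition rotate_labels :: "nat \<Rightarrow> nat \<Rightarrow> nat \<Rightarrow> nat" where
  "rotate_labels a m i = (if i = a then a + m else if a < i \<and> i \<le> a + m then i - 1 else i)"

lemma bij_rotate_labels: "bij (rotate_labels a m)"
proof (rule bijI')
  show "rotate_labels a m x = rotate_labels a m y \<longleftrightarrow> x = y" for x y
    by (auto simp: rotate_labels_def split: if_splits)
  show "\<exists>x. y = rotate_labels a m x" for y
  proof -
    consider "y = a + m" | "a \<le> y" "y < a + m" | "y < a \<or> a + m < y" by linarith
    then show ?thesis
    proof cases
      case 1 then show ?thesis by (intro exI[of _ a]) (simp add: rotate_labels_def)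
    next
      case 2 then show ?thesis by (intro exI[of _ "Suc y"]) (simp add: rotate_labels_def)
    next
      case 3 then show ?thesis by (intro exI[of _ y]) (auto simp: rotate_labels_def)
    qed
  qed
qed

lemma emp_map_rotate:
  assumes "i \<le> m"
  shows "emp (map (rotate_labels a m) xs) (a + i) = emp xs (a + (if i = m then 0 else Suc i))"
proof -
  have "a + i = rotate_labels a m (a + (if i = m then 0 else Suc i))"
    using assms by (auto simp: rotate_labels_def)
  then have "count_list (map (rotate_labels a m) xs) (a + i) = count_list xs (a + (if i = m then 0 else Suc i))"
    using count_list_map_conv[OF bij_is_inj[OF bij_rotate_labels[of a m]]] by metis
  then show ?thesis by (simp add: emp_def)
qed

context flat_blocks
begin

definition isoreg_block_risk :: "nat \<Rightarrow> real" where
  "isoreg_block_risk j = pmf p (b j) * harm (b (Suc j) - b j) - real (b (Suc j) - b j) * (pmf p (b j))\<^sup>2"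

text \<open>
  For a nonempty region of length \<open>w\<close> and common probability \<open>q\<close>: the variance \<open>w * q * (1 - w * q)\<close>
  contributed by one observation to the count of the region, divided by \<open>w\<close>. The indicator makes the
  value 0 for an empty region.
\<close>

definition average_block_risk :: "nat \<Rightarrow> real" where
  "average_block_risk j = pmf p (b j) * of_bool (b j < b (Suc j)) - real (b (Suc j) - b j) * (pmf p (b j))\<^sup>2"

lemma map_pmf_rotate_labels:
  assumes "a = b j" "m < b (Suc j) - b j"
  shows "map_pmf (rotate_labels a m) p = p"
proof (rule pmf_eqI)
  fix y
  obtain x where y: "y = rotate_labels a m x"
    using bij_rotate_labels[of a m] by (metis bij_pointE)
  have "pmf (map_pmf (rotate_labels a m) p) y = pmf p x"
    unfolding y by (rule pmf_map_inj') (rule bij_is_inj[OF bij_rotate_labels])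
  also have "\<dots> = pmf p y"
  proof (cases "a \<le> x \<and> x \<le> a + m")
    case True
    then have "x \<in> {b j..<b (Suc j)}" "y \<in> {b j..<b (Suc j)}"
      using assms by (auto simp: y rotate_labels_def)
    then show ?thesis using flat[of x j] flat[of y j] by simp
  qed (auto simp: y rotate_labels_def)
  finally show "pmf (map_pmf (rotate_labels a m) p) y = pmf p y" .
qed

lemma measure_initial_block:
  assumes "r \<le> b (Suc j) - b j"
  shows "measure p {b j..<b j + r} = real r * pmf p (b j)"
proof -
  have "measure p {b j..<b j + r} = (\<Sum>i\<in>{b j..<b j + r}. pmf p (b j))"
  proof -
    have "{b j..<b j + r} \<subseteq> {b j..<b (Suc j)}" using assms by auto
    then have "(\<Sum>i\<in>{b j..<b j + r}. pmf p i) = (\<Sum>i\<in>{b j..<b j + r}. pmf p (b j))"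
      by (intro sum.cong refl flat[of _ j]) blast
    then show ?thesis by (subst measure_measure_pmf_finite) (simp_all only: finite_atLeastLessThan)
  qed
  then show ?thesis by simp
qed

text \<open>
  Let the region have length \<open>w\<close> and common probability \<open>q\<close>. The regression preserves the total of the
  frequencies, so the risk reduces to the expected sum of
  squares. By the Spitzer identity that is the sum over \<open>r \<le> w\<close> of the second moments of averages of
  \<open>r\<close> frequencies, \<open>q\<^sup>2 + (q / r - q\<^sup>2) / n\<close> each; summation over \<open>r\<close> produces the harmonic
  number. The value is exact for every sample size, which makes a central limit theorem superfluous.
\<close>

lemma expectation_isoreg_block:
  assumes n: "0 < n"
  shows "measure_pmf.expectation (replicate_pmf n p)
    (\<lambda>xs. real n * (\<Sum>i=b j..<b (Suc j). (isoreg (b j) (b (Suc j)) (emp xs) i - pmf p i)\<^sup>2)) = isoreg_block_risk j"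
proof -
  let ?E = "measure_pmf.expectation (replicate_pmf n p)"
  define w where "w = b (Suc j) - b j"
  define q where "q = pmf p (b j)"
  let ?f = "\<lambda>xs. isoreg (b j) (b (Suc j)) (emp xs)"
  let ?N = "\<lambda>xs. \<Sum>i=b j..<b (Suc j). emp xs i"
  let ?I = "\<lambda>xs. integral {0..1} (\<lambda>t. run_max w (\<lambda>i. emp xs (b j + i) - t))"
  have bb: "b j \<le> b (Suc j)" by (simp add: b_le)
  have emp01: "0 \<le> emp xs i \<and> emp xs i \<le> 1" for xs i using emp_nonneg emp_le_1 by blast
  have S: "(\<Sum>i=b j..<b (Suc j). (?f xs i - pmf p i)\<^sup>2) = 2 * ?I xs - 2 * q * ?N xs + real w * q\<^sup>2" for xs
  proof -
    have "(\<Sum>i=b j..<b (Suc j). (?f xs i - pmf p i)\<^sup>2) = (\<Sum>i=b j..<b (Suc j). (?f xs i)\<^sup>2 - 2 * q * ?f xs i + q\<^sup>2)"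
    proof (rule sum.cong)
      fix i assume "i \<in> {b j..<b (Suc j)}"
      from flat[OF this] show "(?f xs i - pmf p i)\<^sup>2 = (?f xs i)\<^sup>2 - 2 * q * ?f xs i + q\<^sup>2"
        by (simp add: q_def power2_diff)
    qed simp
    also have "\<dots> = (\<Sum>i=b j..<b (Suc j). (?f xs i)\<^sup>2) - 2 * q * (\<Sum>i=b j..<b (Suc j). ?f xs i) + real w * q\<^sup>2"
      by (simp add: sum.distrib sum_subtractf sum_distrib_left w_def)
    also have "(\<Sum>i=b j..<b (Suc j). ?f xs i) = ?N xs"
      using is_isoreg_isoreg[of "b j" "b (Suc j)" "emp xs"] unfolding is_isoreg_def by blast
    also have "(\<Sum>i=b j..<b (Suc j). (?f xs i)\<^sup>2) = 2 * ?I xs"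
      unfolding w_def by (rule is_isoreg_sum_squares[OF is_isoreg_isoreg bb emp01])
    finally show ?thesis .
  qed
  have EI: "?E ?I = (\<Sum>r<w. ?E (\<lambda>xs. ((\<Sum>i<Suc r. emp xs (b j + i)) / real (Suc r))\<^sup>2)) / 2"
  proof (rule expectation_integral_run_max[where rot = "\<lambda>m. map (rotate_labels (b j) m)"])
    show "map_pmf (map (rotate_labels (b j) m)) (replicate_pmf n p) = replicate_pmf n p" if "m < w" for m
      unfolding map_replicate_pmf using map_pmf_rotate_labels[of "b j" j m] that by (simp add: w_def)
  qed (auto simp: emp01 emp_map_rotate)
  have pointwise: "?E (\<lambda>xs. ((\<Sum>i<Suc r. emp xs (b j + i)) / real (Suc r))\<^sup>2) =
      q\<^sup>2 + (q * inverse (real (Suc r)) - q\<^sup>2) / real n" if "r < w" for r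
  proof -
    have m: "measure p {b j..<b j + Suc r} = real (Suc r) * q"
      using measure_initial_block[of "Suc r" j] that unfolding w_def q_def by simp
    have sh: "(\<Sum>i<Suc r. emp xs (b j + i)) = (\<Sum>i\<in>{b j..<b j + Suc r}. emp xs i)" for xs
      using sum.shift_bounds_nat_ivl[of "emp xs" 0 "b j" "Suc r"] by (simp add: atLeast0LessThan add.commute)
    have "?E (\<lambda>xs. ((\<Sum>i<Suc r. emp xs (b j + i)) / real (Suc r))\<^sup>2) =
        ?E (\<lambda>xs. (\<Sum>i\<in>{b j..<b j + Suc r}. emp xs i)\<^sup>2) / (real (Suc r))\<^sup>2"
      unfolding sh power_divide by simp
    also have "\<dots> = ((real (Suc r) * q)\<^sup>2 + (real (Suc r) * q) * (1 - real (Suc r) * q) / real n) / (real (Suc r))\<^sup>2"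
      by (subst expectation_sum_emp(2)[OF _ n]) (simp_all only: m finite_atLeastLessThan)
    also have "\<dots> = q\<^sup>2 + (q * inverse (real (Suc r)) - q\<^sup>2) / real n"
      using n by (simp add: field_simps power2_eq_square del: of_nat_Suc)
    finally show ?thesis .
  qed
  have "(\<Sum>r<w. ?E (\<lambda>xs. ((\<Sum>i<Suc r. emp xs (b j + i)) / real (Suc r))\<^sup>2)) =
      (\<Sum>r<w. q\<^sup>2 + (q * inverse (real (Suc r)) - q\<^sup>2) / real n)"
    using pointwise by (intro sum.cong) auto
  also have "\<dots> = real w * q\<^sup>2 + (q * (\<Sum>r<w. inverse (real (Suc r))) - real w * q\<^sup>2) / real n"
    unfolding sum.distrib sum_divide_distrib[symmetric] sum_subtractf sum_distrib_left by simp
  also have "(\<Sum>r<w. inverse (real (Suc r))) = harm w"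
    unfolding harm_def by (rule sum.reindex_bij_witness[of _ "\<lambda>k. k - 1" Suc]) auto
  finally have EI2: "?E ?I = (real w * q\<^sup>2 + (q * harm w - real w * q\<^sup>2) / real n) / 2" using EI by simp
  have EN: "?E ?N = real w * q"
    using expectation_sum_emp(1)[OF _ n, of "{b j..<b (Suc j)}" p] measure_block[of j] by (simp add: w_def q_def)
  have intI: "integrable (replicate_pmf n p) ?I"
  proof (rule integrable_pmf_bounded[where B = "real w"])
    fix xs show "\<bar>?I xs\<bar> \<le> real w"
      using integral_run_max_bounds[of w "\<lambda>i. emp xs (b j + i)" 0 1] emp01 by (simp add: abs_le_iff)
  qed
  have intN: "integrable (replicate_pmf n p) ?N"
    by (rule integrable_pmf_bounded[where B = 1]) (auto simp: sum_nonneg emp_nonneg sum_emp_le_1)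
  have "?E (\<lambda>xs. real n * (\<Sum>i=b j..<b (Suc j). (?f xs i - pmf p i)\<^sup>2)) =
     real n * (2 * ?E ?I - 2 * q * ?E ?N + real w * q\<^sup>2)"
    unfolding S using intI intN by simp
  also have "\<dots> = q * harm w - real w * q\<^sup>2"
    unfolding EI2 EN using n by (simp add: field_simps power2_eq_square)
  finally show ?thesis by (simp add: isoreg_block_risk_def w_def q_def)
qed

text \<open>
  Outside all regions, where \<open>p\<close> vanishes, the value is left unchanged.
\<close>

definition block_average :: "(nat \<Rightarrow> real) \<Rightarrow> nat \<Rightarrow> real" where
  "block_average y i =
     (if \<exists>j. i \<in> {b j..<b (Suc j)}
      then let j = THE j. i \<in> {b j..<b (Suc j)} in sum y {b j..<b (Suc j)} / real (b (Suc j) - b j)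
      else y i)"

lemma block_average_eq:
  assumes "i \<in> {b j..<b (Suc j)}"
  shows "block_average y i = sum y {b j..<b (Suc j)} / real (b (Suc j) - b j)"
proof -
  have "(THE j. i \<in> {b j..<b (Suc j)}) = j"
  proof (rule the_equality[where P = "\<lambda>j. i \<in> {b j..<b (Suc j)}", OF assms])
    fix j' assume j': "i \<in> {b j'..<b (Suc j')}"
    show "j' = j"
      using assms j' b_le[of "Suc j" j'] b_le[of "Suc j'" j] by (cases j j' rule: linorder_cases) auto
  qed
  then show ?thesis using assms unfolding block_average_def by (auto simp: Let_def)
qed

lemma sum_block_average:
  "(\<Sum>i=b j..<b (Suc j). block_average y i) = sum y {b j..<b (Suc j)}"
proof -
  have "(\<Sum>i=b j..<b (Suc j). block_average y i) =
     (\<Sum>i=b j..<b (Suc j). sum y {b j..<b (Suc j)} / real (b (Suc j) - b j))"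
    by (intro sum.cong refl block_average_eq)
  also have "\<dots> = sum y {b j..<b (Suc j)}"
    by (cases "b j < b (Suc j)") (simp_all add: sum_constant del: of_nat_diff)
  finally show ?thesis .
qed

lemma block_average_nonneg: "(\<And>i. 0 \<le> y i) \<Longrightarrow> 0 \<le> block_average y i"
  by (auto simp: block_average_def Let_def sum_nonneg)

lemma block_average_deviation:
  assumes "b j < b (Suc j)" and q: "\<And>i. i \<in> {b j..<b (Suc j)} \<Longrightarrow> r i = q"
  shows "(\<Sum>i=b j..<b (Suc j). (block_average y i - r i)\<^sup>2) =
     (sum y {b j..<b (Suc j)} - real (b (Suc j) - b j) * q)\<^sup>2 / real (b (Suc j) - b j)"
proof -
  define w where "w = real (b (Suc j) - b j)"
  have w: "w > 0" using assms by (simp add: w_def)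
  have "(\<Sum>i=b j..<b (Suc j). (block_average y i - r i)\<^sup>2) =
     (\<Sum>i=b j..<b (Suc j). (sum y {b j..<b (Suc j)} / w - q)\<^sup>2)"
    unfolding w_def by (intro sum.cong refl) (simp only: block_average_eq q)
  also have "\<dots> = w * (sum y {b j..<b (Suc j)} / w - q)\<^sup>2"
    unfolding sum_constant card_atLeastLessThan w_def ..
  also have "\<dots> = (sum y {b j..<b (Suc j)} - w * q)\<^sup>2 / w"
    using w by (simp add: field_simps power2_eq_square)
  finally show ?thesis unfolding w_def .
qed

lemma expectation_average_block:
  assumes n: "0 < n"
  shows "measure_pmf.expectation (replicate_pmf n p)
    (\<lambda>xs. real n * (\<Sum>i=b j..<b (Suc j). (isoreg (b j) (b (Suc j)) (block_average (emp xs)) i - pmf p i)\<^sup>2))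
    = average_block_risk j"
proof (cases "b j < b (Suc j)")
  case True
  define w where "w = real (b (Suc j) - b j)"
  define q where "q = pmf p (b j)"
  have w: "w > 0" using True by (simp add: w_def)
  have iso: "isoreg (b j) (b (Suc j)) (block_average y) i = block_average y i" if "i \<in> {b j..<b (Suc j)}" for y i
    by (rule isoreg_antimono_id[OF _ that]) (rule monotone_onI, simp only: block_average_eq order_refl)
  have "(\<Sum>i=b j..<b (Suc j). (isoreg (b j) (b (Suc j)) (block_average (emp xs)) i - pmf p i)\<^sup>2)
      = ((\<Sum>i=b j..<b (Suc j). emp xs i) - w * q)\<^sup>2 / w" for xs
    
  proof -
    have "(\<Sum>i=b j..<b (Suc j). (isoreg (b j) (b (Suc j)) (block_average (emp xs)) i - pmf p i)\<^sup>2) =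
        (\<Sum>i=b j..<b (Suc j). (block_average (emp xs) i - pmf p i)\<^sup>2)"
      by (intro sum.cong refl) (simp only: iso)
    also have "\<dots> = ((\<Sum>i=b j..<b (Suc j). emp xs i) - w * q)\<^sup>2 / w"
      unfolding w_def q_def by (rule block_average_deviation[OF True flat])
    finally show ?thesis .
  qed
  then have "measure_pmf.expectation (replicate_pmf n p)
    (\<lambda>xs. real n * (\<Sum>i=b j..<b (Suc j). (isoreg (b j) (b (Suc j)) (block_average (emp xs)) i - pmf p i)\<^sup>2))
    = measure_pmf.expectation (replicate_pmf n p) (\<lambda>xs. real n * ((\<Sum>i=b j..<b (Suc j). emp xs i) - w * q)\<^sup>2) / w"
    by simp
  also have "\<dots> = w * q * (1 - w * q) / w"
    using expectation_emp_deviation[OF _ n, of "{b j..<b (Suc j)}" p] measure_block[of j]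
    by (simp add: w_def q_def)
  also have "\<dots> = average_block_risk j"
    using w True by (simp add: average_block_risk_def w_def[symmetric] q_def[symmetric] field_simps power2_eq_square)
  finally show ?thesis .
qed (simp add: average_block_risk_def)

text \<open>
  Averaging is the orthogonal projection onto the vectors that are constant on each region.
\<close>

lemma block_average_contraction:
  "(\<Sum>i=b j..<b (Suc j). (block_average y i - pmf p i)\<^sup>2) \<le> (\<Sum>i=b j..<b (Suc j). (y i - pmf p i)\<^sup>2)"
proof -
  have dec: "(y i - pmf p i)\<^sup>2 = (y i - block_average y i)\<^sup>2 + (block_average y i - pmf p i)\<^sup>2
      + 2 * (block_average y (b j) - pmf p (b j)) * (y i - block_average y i)"
    if "i \<in> {b j..<b (Suc j)}" for i
  proof -
    have "b j \<in> {b j..<b (Suc j)}" using that by auto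
    then have "block_average y (b j) = block_average y i" "pmf p (b j) = pmf p i"
      using that flat[OF that] block_average_eq by auto
    then show ?thesis by (simp add: power2_eq_square algebra_simps)
  qed
  have "(\<Sum>i=b j..<b (Suc j). (y i - pmf p i)\<^sup>2) =
     (\<Sum>i=b j..<b (Suc j). (y i - block_average y i)\<^sup>2) + (\<Sum>i=b j..<b (Suc j). (block_average y i - pmf p i)\<^sup>2)
      + 2 * (block_average y (b j) - pmf p (b j)) * (\<Sum>i=b j..<b (Suc j). y i - block_average y i)"
    by (simp add: dec sum.distrib sum_distrib_left)
  also have "(\<Sum>i=b j..<b (Suc j). y i - block_average y i) = 0"
    unfolding sum_subtractf sum_block_average by simp
  finally show ?thesis by (simp add: sum_nonneg)
qed

lemma block_average_close:
  assumes "\<And>i. \<bar>y i - pmf p i\<bar> < d"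
  shows "\<bar>block_average y i - pmf p i\<bar> < d"
proof (cases "\<exists>j. i \<in> {b j..<b (Suc j)}")
  case True
  then obtain j where j: "i \<in> {b j..<b (Suc j)}" by blast
  define w where "w = real (b (Suc j) - b j)"
  have w: "w > 0" using j by (simp add: w_def)
  have "\<bar>sum y {b j..<b (Suc j)} - w * pmf p i\<bar> = \<bar>\<Sum>i'=b j..<b (Suc j). y i' - pmf p i'\<bar>"
  proof -
    have "(\<Sum>i'=b j..<b (Suc j). pmf p i') = (\<Sum>i'=b j..<b (Suc j). pmf p i)"
      by (intro sum.cong refl) (simp only: flat flat[OF j])
    then show ?thesis by (simp add: sum_subtractf w_def)
  qed
  also have "\<dots> \<le> (\<Sum>i'=b j..<b (Suc j). \<bar>y i' - pmf p i'\<bar>)" by (rule sum_abs)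
  also have "\<dots> < (\<Sum>i'=b j..<b (Suc j). d)" using j assms by (intro sum_strict_mono) auto
  also have "\<dots> = w * d" by (simp add: w_def)
  finally have "\<bar>w * (block_average y i - pmf p i)\<bar> < w * d"
    using w by (simp add: block_average_eq[OF j] w_def[symmetric] right_diff_distrib)
  then show ?thesis using w by (simp add: abs_mult)
next
  case False
  then have "block_average y i = y i" unfolding block_average_def by (rule if_not_P)
  then show ?thesis using assms[of i] by simp
qed

end

section \<open>Both estimators are isotonic regressions\<close>

text \<open>
  A jump of \<open>f\<close> at \<open>Suc i\<close> is a point of contact between the partial sums and their majorant; the
  inequalities at its two neighbours then force \<open>y (Suc i) < y i\<close>.
\<close>

lemma is_isoreg_eq_adjacent:
  assumes f: "is_isoreg a c y f" and i: "a \<le> i" "Suc i < c" and y: "y i \<le> y (Suc i)"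
  shows "f (Suc i) = f i"
proof (rule ccontr)
  assume "f (Suc i) \<noteq> f i"
  moreover have "f (Suc i) \<le> f i"
    using f i unfolding is_isoreg_def by (auto simp: monotone_on_def)
  ultimately have less: "f (Suc i) < f i" by simp
  have jump: "sum f {a..<Suc i} = sum y {a..<Suc i}"
  proof -
    have "Suc i \<in> {a<..<c}" "f (Suc i) < f (Suc i - 1)" using i less by auto
    then show ?thesis using f unfolding is_isoreg_def by blast
  qed
  have le: "sum y {a..<j} \<le> sum f {a..<j}" if "j \<in> {a..c}" for j
    using f that unfolding is_isoreg_def by blast
  have "sum y {a..<i} \<le> sum f {a..<i}" "sum y {a..<Suc (Suc i)} \<le> sum f {a..<Suc (Suc i)}"
    by (rule le, use i in simp)+
  then have "f i \<le> y i" "y (Suc i) \<le> f (Suc i)" using jump i by auto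
  then show False using less y by simp
qed

lemma arg_min_on_eqI:
  fixes f :: "'b \<Rightarrow> real"
  assumes "x \<in> S" and less: "\<And>y. y \<in> S \<Longrightarrow> y \<noteq> x \<Longrightarrow> f x < f y"
  shows "arg_min_on f S = x"
  unfolding arg_min_on_def arg_min_def
proof (rule some_equality)
  have "\<not> f y < f x" if "y \<in> S" for y using less[OF that] by (cases "y = x") auto
  then show "is_arg_min f (\<lambda>x. x \<in> S) x" using assms(1) unfolding is_arg_min_def by blast
  show "y = x" if "is_arg_min f (\<lambda>x. x \<in> S) y" for y
    using that less[of y] assms(1) unfolding is_arg_min_def by blast
qed

lemma arg_max_on_eqI:
  fixes f :: "'b \<Rightarrow> real"
  assumes "x \<in> S" and less: "\<And>y. y \<in> S \<Longrightarrow> y \<noteq> x \<Longrightarrow> f y < f x"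
  shows "arg_max_on f S = x"
  unfolding arg_max_on_def arg_max_def
proof (rule some_equality)
  have "\<not> f x < f y" if "y \<in> S" for y using less[OF that] by (cases "y = x") auto
  then show "is_arg_max f (\<lambda>x. x \<in> S) x" using assms(1) unfolding is_arg_max_def by blast
  show "y = x" if "is_arg_max f (\<lambda>x. x \<in> S) y" for y
    using that less[of y] assms(1) unfolding is_arg_max_def by blast
qed

lemma count_obs_nth: "count_obs (length xs) (\<lambda>l. xs ! (l - 1)) i = count_list xs i"
proof -
  have "{l \<in> {1..length xs}. xs ! (l - 1) = i} = Suc ` {j. j < length xs \<and> i = xs ! j}"
  proof (intro equalityI subsetI)
    fix l assume "l \<in> {l \<in> {1..length xs}. xs ! (l - 1) = i}"
    then show "l \<in> Suc ` {j. j < length xs \<and> i = xs ! j}"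
      by (intro image_eqI[of _ _ "l - 1"]) auto
  qed auto
  then show ?thesis
    unfolding count_obs_def count_list_eq_length_filter length_filter_conv_card
    by (simp add: card_image)
qed

lemma empirical_nth: "empirical (length xs) (\<lambda>l. xs ! (l - 1)) i = emp xs i"
  unfolding empirical_def emp_def count_obs_nth ..

lemma count_obs_sample: "count_obs n x i = count_list (map x [1..<Suc n]) i"
proof -
  have "count_obs n x i = count_obs n (\<lambda>l. map x [1..<Suc n] ! (l - 1)) i"
    unfolding count_obs_def by (intro arg_cong[where f = card] Collect_cong) (auto simp: nth_append simp del: upt_Suc)
  then show "count_obs n x i = count_list (map x [1..<Suc n]) i"
    using count_obs_nth[of "map x [1..<Suc n]" i] by (simp del: upt_Suc)
qed

lemma isoreg_decreasing_pmf:
  assumes W: "{1..<c} \<subseteq> idx k" and y: "\<And>i. 0 \<le> y i" "sum y {1..<c} = 1"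
  shows "isoreg 1 c y \<in> decreasing_pmfs k"
proof -
  let ?f = "isoreg 1 c y"
  have iso: "is_isoreg 1 c y ?f" by (rule is_isoreg_isoreg)
  have nn: "0 \<le> ?f i" for i
    using is_isoreg_ge[OF iso, of 0 i] y(1) by (cases "i \<in> {1..<c}") (auto simp: isoreg_outside)
  have out: "?f i = 0" if "i \<notin> {1..<c}" for i using that by (rule isoreg_outside)
  have "sum ?f {1..<c} = 1" using iso y(2) unfolding is_isoreg_def by simp
  then have "(?f has_sum 1) (idx k)"
    using W out by (intro has_sum_finite_neutralI[of "{1..<c}"]) auto
  moreover have "antimono_on (idx k) ?f"
  proof (rule monotone_onI)
    fix u v assume uv: "u \<in> idx k" "v \<in> idx k" "u \<le> v"
    show "?f v \<le> ?f u"
    proof (cases "v < c")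
      case True
      then show ?thesis using iso uv unfolding is_isoreg_def monotone_on_def by (auto simp: idx_def)
    next
      case False
      then show ?thesis using out[of v] nn[of u] by simp
    qed
  qed
  moreover have "?f i = 0" if "i \<notin> idx k" for i using that W by (intro out) blast
  ultimately show ?thesis using nn unfolding decreasing_pmfs_def by blast
qed

lemma decreasing_pmfs_finite_sum_le_1:
  assumes g: "g \<in> decreasing_pmfs k" and "finite S" "S \<subseteq> idx k"
  shows "sum g S \<le> 1"
proof (rule finite_sum_le_has_sum[where A = "idx k"])
  show "(g has_sum 1) (idx k)" using g by (simp add: decreasing_pmfs_def)
qed (use assms in \<open>auto simp: decreasing_pmfs_def\<close>)

text \<open>
  With \<open>\<Phi>\<close> the squared distance to the frequencies and \<open>f\<close> the regression, the variational
  inequality yields \<open>\<Phi> g \<ge> \<Phi> f + (f i - g i)\<^sup>2\<close> for every competitor \<open>g\<close> and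
  every index \<open>i\<close>, hence a strict minimum. The index \<open>i0\<close> at which \<open>g\<close> and the regression differ is
  added to the window so that only finite sums have to be compared.
\<close>

lemma grenander_eq_isoreg:
  assumes W: "{1..<c} \<subseteq> idx k" and xs: "xs \<noteq> []" "set xs \<subseteq> {1..<c}"
  shows "grenander k (length xs) (\<lambda>l. xs ! (l - 1)) = isoreg 1 c (emp xs)"
proof -
  let ?y = "emp xs"
  let ?f = "isoreg 1 c ?y"
  let ?\<Phi> = "\<lambda>f. \<Sum>\<^sub>\<infinity>i\<in>idx k. (?y i - f i)\<^sup>2"
  let ?D = "decreasing_pmfs k"
  have iso: "is_isoreg 1 c ?y ?f" by (rule is_isoreg_isoreg)
  have y0: "?y i = 0" if "i \<notin> {1..<c}" for i using xs(2) that by (intro emp_eq_0) auto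
  have f0: "?f i = 0" if "i \<notin> {1..<c}" for i using that by (rule isoreg_outside)
  have fD: "?f \<in> ?D"
    using isoreg_decreasing_pmf[OF W emp_nonneg sum_emp_eq_1[OF _ xs(2,1)]] by simp
  have \<Phi>f: "?\<Phi> ?f = (\<Sum>i\<in>{1..<c}. (?y i - ?f i)\<^sup>2)"
    by (subst infsum_cong_neutral[of "{1..<c}" "idx k" "\<lambda>i. (?y i - ?f i)\<^sup>2"])
      (use W y0 f0 in auto)
  have less: "?\<Phi> ?f < ?\<Phi> g" if g: "g \<in> ?D" "g \<noteq> ?f" for g
  proof -
    have g_nn: "0 \<le> g i" for i using g(1) unfolding decreasing_pmfs_def by (cases "i \<in> idx k") auto
    have g_le: "g i \<le> 1" for i
      using decreasing_pmfs_finite_sum_le_1[OF g(1), of "{i}"] g(1)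
      unfolding decreasing_pmfs_def by (cases "i \<in> idx k") auto
    obtain i0 where i0: "g i0 \<noteq> ?f i0" using g(2) by blast
    have i0k: "i0 \<in> idx k"
      using i0 g(1) fD unfolding decreasing_pmfs_def by force
    have "antimono_on {1..<c} g"
      using g(1) W unfolding decreasing_pmfs_def by (auto intro: monotone_on_subset)
    then have "(\<Sum>i=1..<c. (?y i - ?f i) * g i) \<le> 0" "(\<Sum>i=1..<c. (?y i - ?f i) * ?f i) = 0"
      using is_isoreg_inner_antimono[OF iso] is_isoreg_inner_self[OF iso, of "\<lambda>x. x"] by blast+
    then have cross: "0 \<le> (\<Sum>i=1..<c. (?y i - ?f i) * (?f i - g i))"
      by (simp add: right_diff_distrib sum_subtractf)
    let ?W = "insert i0 {1..<c}"
    have crossW: "0 \<le> (\<Sum>i\<in>?W. (?y i - ?f i) * (?f i - g i))"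
      using cross y0[of i0] f0[of i0] by (cases "i0 \<in> {1..<c}") (auto simp: insert_absorb simp del: atLeastLessThan_iff)
    have \<Phi>f': "?\<Phi> ?f = (\<Sum>i\<in>?W. (?y i - ?f i)\<^sup>2)"
      unfolding \<Phi>f using y0 f0 by (intro sum.mono_neutral_left) auto
    have summ: "(\<lambda>i. (?y i - g i)\<^sup>2) summable_on idx k"
    proof (rule summable_on_comparison_test)
      have "?y summable_on idx k"
        using y0 has_sum_finite_neutralI[of "{1..<c}" "idx k" ?y] W by (auto simp: summable_on_def)
      moreover have "g summable_on idx k" using g(1) by (auto simp: decreasing_pmfs_def summable_on_def)
      ultimately show "(\<lambda>i. ?y i + g i) summable_on idx k" by (rule summable_on_add)
      show "(?y i - g i)\<^sup>2 \<le> ?y i + g i" for i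
        using emp_nonneg emp_le_1 g_nn g_le by (intro square_diff_le) auto
    qed auto
    have "?\<Phi> ?f < (\<Sum>i\<in>?W. (?y i - ?f i)\<^sup>2) + (\<Sum>i\<in>?W. (?f i - g i)\<^sup>2)"
    proof -
      have "0 < (?f i0 - g i0)\<^sup>2" using i0 by simp
      also have "\<dots> \<le> (\<Sum>i\<in>?W. (?f i - g i)\<^sup>2)" by (rule member_le_sum) auto
      finally show ?thesis using \<Phi>f' by simp
    qed
    also have "\<dots> \<le> (\<Sum>i\<in>?W. (?y i - ?f i)\<^sup>2) + (\<Sum>i\<in>?W. (?f i - g i)\<^sup>2)
        + 2 * (\<Sum>i\<in>?W. (?y i - ?f i) * (?f i - g i))" using crossW by simp
    also have "\<dots> = (\<Sum>i\<in>?W. (?y i - g i)\<^sup>2)"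
      unfolding sum_distrib_left sum.distrib[symmetric]
      by (intro sum.cong) (auto simp: power2_eq_square algebra_simps)
    also have "\<dots> \<le> ?\<Phi> g"
      using W i0k by (intro finite_sum_le_infsum summ) auto
    finally show ?thesis .
  qed
  show ?thesis
    unfolding grenander_def empirical_nth by (rule arg_min_on_eqI, rule fD, rule less)
qed

context flat_blocks
begin

definition blockwise_constant :: "(nat \<Rightarrow> real) \<Rightarrow> bool" where
  "blockwise_constant f \<longleftrightarrow> (\<forall>j. \<forall>i\<in>{b j..<b (Suc j)}. f i = f (b j))"

lemma blockwise_constant_isoreg:
  assumes y: "blockwise_constant y"
  shows "blockwise_constant (isoreg 1 (b J) y)"
  unfolding blockwise_constant_def
proof (intro allI ballI)
  fix j i assume i: "i \<in> {b j..<b (Suc j)}"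
  let ?f = "isoreg 1 (b J) y"
  show "?f i = ?f (b j)"
  proof (cases "j < J")
    case False
    then have "b J \<le> b j" by (simp add: b_le)
    then show ?thesis using i by (simp add: isoreg_outside)
  next
    case True
    then have J: "b (Suc j) \<le> b J" by (simp add: b_le)
    have "b j + l < b (Suc j) \<Longrightarrow> ?f (b j + l) = ?f (b j)" for l
    proof (induction l)
      case (Suc l)
      have "y (b j + l) = y (Suc (b j + l))"
        using y Suc.prems unfolding blockwise_constant_def
        by (metis add_Suc_right atLeastLessThan_iff le_add1 less_Suc_eq less_SucI order.strict_trans lessI)
      then have "?f (Suc (b j + l)) = ?f (b j + l)"
        using Suc.prems J b_pos[of j]
        by (intro is_isoreg_eq_adjacent[OF is_isoreg_isoreg]) auto
      then show ?case using Suc by simp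
    qed simp
    from this[of "i - b j"] show ?thesis using i by simp
  qed
qed

lemma sum_blockwise_constant_average:
  assumes h: "blockwise_constant h"
  shows "(\<Sum>i=1..<b J. block_average y i * h i) = (\<Sum>i=1..<b J. y i * h i)"
proof -
  have "(\<Sum>i=b j..<b (Suc j). u i * h i) = sum u {b j..<b (Suc j)} * h (b j)" for u j
    using h unfolding blockwise_constant_def sum_distrib_right by (intro sum.cong) auto
  then show ?thesis unfolding sum_blocks by (simp add: sum_block_average)
qed

lemma blockwise_constant_block_average: "blockwise_constant (block_average y)"
  unfolding blockwise_constant_def
proof (intro allI ballI)
  fix j i assume i: "i \<in> {b j..<b (Suc j)}"
  then have "b j \<in> {b j..<b (Suc j)}" by auto
  then show "block_average y i = block_average y (b j)" using i by (simp only: block_average_eq)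
qed

text \<open>
  Let \<open>f\<close> be the regression of the averaged frequencies \<open>y\<close>. For a competitor \<open>g\<close> the logarithm of \<open>g\<close>
  is decreasing (where \<open>g\<close> vanishes, it is cut off), so \<open>\<Sum> y ln g \<le> \<Sum> f ln g\<close>; Gibbs' inequality gives \<open>\<Sum> f ln g < \<Sum> f ln f\<close>; and
  the latter sum equals \<open>\<Sum> y ln f\<close>, since \<open>y - f\<close> is orthogonal to functions of \<open>f\<close>. Averaging the
  frequencies does not affect the likelihood of vectors that are constant on the regions.
\<close>

lemma flat_mle_eq_isoreg:
  assumes K: "idx k = set_pmf p"
    and F: "flat_decreasing_pmfs k m w = {f \<in> decreasing_pmfs k. blockwise_constant f}"
    and xs: "xs \<noteq> []" "set xs \<subseteq> {1..<b J}"
  shows "flat_mle k m w (length xs) (\<lambda>l. xs ! (l - 1)) = isoreg 1 (b J) (block_average (emp xs))"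
proof -
  let ?W = "{1..<b J}"
  let ?y = "block_average (emp xs)"
  let ?f = "isoreg 1 (b J) ?y"
  let ?F = "flat_decreasing_pmfs k m w"
  define L where "L f = (\<Prod>i\<in>?W. f i ^ count_list xs i)" for f :: "nat \<Rightarrow> real"
  have W: "?W \<subseteq> idx k" unfolding K support by blast
  have lik: "likelihood k (length xs) (\<lambda>l. xs ! (l - 1)) = L"
  proof
    fix f
    have "likelihood k (length xs) (\<lambda>l. xs ! (l - 1)) f =
        (\<Prod>i\<in>?W. if i \<in> idx k then f i ^ count_list xs i else 1)"
      unfolding likelihood_def count_obs_nth
    proof (rule prodinf_finite)
      fix i assume "i \<notin> ?W"
      then have "i \<notin> set xs" using xs(2) by auto
      then show "(if i \<in> idx k then f i ^ count_list xs i else 1) = 1" by simp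
    qed simp
    also have "\<dots> = L f" unfolding L_def using W by (intro prod.cong) auto
    finally show "likelihood k (length xs) (\<lambda>l. xs ! (l - 1)) f = L f" .
  qed
  have iso: "is_isoreg 1 (b J) ?y ?f" by (rule is_isoreg_isoreg)
  have y_nn: "0 \<le> ?y i" for i by (intro block_average_nonneg emp_nonneg)
  have y_sum: "sum ?y ?W = 1"
    using sum_emp_eq_1[OF _ xs(2,1)] by (simp only: sum_blocks sum_block_average finite_atLeastLessThan)
  have fD: "?f \<in> decreasing_pmfs k" by (rule isoreg_decreasing_pmf[OF W y_nn y_sum])
  have f_flat: "blockwise_constant ?f" by (intro blockwise_constant_isoreg blockwise_constant_block_average)
  have fF: "?f \<in> ?F" unfolding F using fD f_flat by simp
  have f_nn: "0 \<le> ?f i" for i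
    using fD unfolding decreasing_pmfs_def by (cases "i \<in> idx k") auto
  have f_am: "?f i' \<le> ?f i" if "1 \<le> i" "i \<le> i'" "i' < b J" for i i'
    using iso that unfolding is_isoreg_def monotone_on_def by auto
  have f_sum: "sum ?f ?W = 1" using iso y_sum unfolding is_isoreg_def by simp
  define P where "P = {i \<in> ?W. 0 < ?f i}"
  \<comment> \<open>test the regression against the indicator of its zero set\<close>
  have y0: "?y i = 0" if i: "i \<in> ?W - P" for i
  proof -
    have "(\<Sum>i=1..<b J. (?y i - ?f i) * of_bool (?f i = 0)) = 0" by (rule is_isoreg_inner_self[OF iso])
    moreover have "0 \<le> (?y i - ?f i) * of_bool (?f i = 0)" for i using y_nn by auto
    ultimately have "(?y i - ?f i) * of_bool (?f i = 0) = 0"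
      using i by (subst (asm) sum_nonneg_eq_0_iff) auto
    moreover have "?f i = 0" using i f_nn[of i] unfolding P_def by auto
    ultimately show ?thesis by simp
  qed
  have count_y: "0 < ?y i'" if i: "i \<in> ?W" "0 < count_list xs i" "i' \<in> {b j..<b (Suc j)}" "i \<in> {b j..<b (Suc j)}" for i i' j
  proof -
    have "0 < emp xs i" using i(2) xs(1) by (simp add: emp_def)
    also have "\<dots> \<le> sum (emp xs) {b j..<b (Suc j)}" using i by (intro member_le_sum) (auto simp: emp_nonneg)
    finally show ?thesis using i(3) by (simp add: block_average_eq)
  qed
  have count_P: "i \<in> P" if "i \<in> ?W" "0 < count_list xs i" for i
  proof -
    obtain j where "i \<in> {b j..<b (Suc j)}" using block_exists[of i J] \<open>i \<in> ?W\<close> by auto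
    then have "0 < ?y i" using count_y[OF that] by blast
    then show ?thesis using y0[of i] that(1) by auto
  qed
  have L_exp: "L g = exp (\<Sum>i\<in>?W. real (count_list xs i) * ln (g i))"
    if "\<And>i. i \<in> ?W \<Longrightarrow> 0 < count_list xs i \<Longrightarrow> 0 < g i" for g
    unfolding L_def exp_sum[OF finite_atLeastLessThan]
  proof (rule prod.cong)
    fix i assume "i \<in> ?W"
    then show "g i ^ count_list xs i = exp (real (count_list xs i) * ln (g i))"
      using that[of i] by (cases "count_list xs i = 0") (auto simp: exp_of_nat_mult)
  qed simp
  have L_f: "L ?f = exp (\<Sum>i\<in>?W. real (count_list xs i) * ln (?f i))"
    by (rule L_exp) (use count_P in \<open>auto simp: P_def\<close>)
  have sum_count: "(\<Sum>i\<in>?W. real (count_list xs i) * ln (g i)) = real (length xs) * (\<Sum>i\<in>?W. ?y i * ln (g i))"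
    if "blockwise_constant g" for g
  proof -
    have "blockwise_constant (\<lambda>i. ln (g i))" using that unfolding blockwise_constant_def by auto
    from sum_blockwise_constant_average[OF this, of "emp xs" J]
    show ?thesis using xs(1) by (simp add: emp_def sum_distrib_left)
  qed
  have less: "L g < L ?f" if g: "g \<in> ?F" "g \<noteq> ?f" for g
  proof (cases "\<forall>i\<in>?W. 0 < count_list xs i \<longrightarrow> 0 < g i")
    case False
    then obtain i where i: "i \<in> ?W" "0 < count_list xs i" "\<not> 0 < g i" by auto
    have "0 \<le> g i" using g(1) i(1) W unfolding F decreasing_pmfs_def by auto
    then have "g i ^ count_list xs i = 0" using i by simp
    then have "L g = 0" unfolding L_def using i(1) by (intro prod_zero) auto
    then show ?thesis unfolding L_f by simp
  next
    case True
    have gD: "g \<in> decreasing_pmfs k" and g_flat: "blockwise_constant g" using g(1) unfolding F by auto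
    have g_nn: "0 \<le> g i" for i using gD unfolding decreasing_pmfs_def by (cases "i \<in> idx k") auto
    have g_am: "g i' \<le> g i" if "i \<in> ?W" "i' \<in> ?W" "i \<le> i'" for i i'
      using gD W that unfolding decreasing_pmfs_def monotone_on_def by blast
    have g_pos: "0 < g i" if i: "i \<in> P" for i
    proof -
      have "\<exists>i'\<in>?W. i \<le> i' \<and> 0 < ?y i'"
      proof (rule ccontr)
        assume "\<not> ?thesis"
        then have z: "?y i' = 0" if "i' \<in> {i..<b J}" for i'
          using y_nn[of i'] that i unfolding P_def by force
        have i1: "1 \<le> i" "i < b J" using i unfolding P_def by auto
        have split: "sum u {1..<i} + sum u {i..<b J} = sum u ?W" for u :: "nat \<Rightarrow> real"
          using i1 by (simp add: sum.atLeastLessThan_concat)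
        have "sum ?y {1..<i} \<le> sum ?f {1..<i}"
          using iso i1 unfolding is_isoreg_def by auto
        moreover have "sum ?y {i..<b J} = 0" using z by (intro sum.neutral) auto
        moreover have "0 < sum ?f {i..<b J}"
          using i i1 f_nn by (intro sum_pos2[of _ i]) (auto simp: P_def)
        ultimately show False using split[of ?y] split[of ?f] y_sum f_sum by linarith
      qed
      then obtain i' where i': "i' \<in> ?W" "i \<le> i'" "0 < ?y i'" by blast
      obtain j where j: "i' \<in> {b j..<b (Suc j)}" "j < J" using block_exists[of i' J] i' by auto
      have "\<exists>i''\<in>{b j..<b (Suc j)}. 0 < count_list xs i''"
      proof (rule ccontr)
        assume "\<not> ?thesis"
        then have "sum (emp xs) {b j..<b (Suc j)} = 0" by (intro sum.neutral) (auto simp: emp_def)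
        then show False using i'(3) block_average_eq[OF j(1), of "emp xs"] by simp
      qed
      then obtain i'' where i'': "i'' \<in> {b j..<b (Suc j)}" "0 < count_list xs i''" by blast
      have "i'' \<in> ?W" using i''(1) b_pos[of j] b_le[of "Suc j" J] j(2) by auto
      then have "0 < g i''" using True i'' by blast
      also have "g i'' = g i'" using g_flat i'' j unfolding blockwise_constant_def by metis
      also have "g i' \<le> g i" using i i' unfolding P_def by (intro g_am) auto
      finally show ?thesis .
    qed
    have P_fin: "finite P" "P \<subseteq> ?W" unfolding P_def by auto
    have P_ne: "P \<noteq> {}"
    proof
      assume "P = {}"
      then have "sum ?f ?W = 0" using f_nn unfolding P_def
        by (intro sum.neutral) (metis (mono_tags, lifting) empty_iff mem_Collect_eq order_le_less)
      then show False using f_sum by simp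
    qed
    \<comment> \<open>the logarithm of \<open>g\<close>, cut off below its minimum on the support of the regression\<close>
    define \<epsilon> where "\<epsilon> = Min (g ` P)"
    have \<epsilon>: "0 < \<epsilon>" "\<And>i. i \<in> P \<Longrightarrow> \<epsilon> \<le> g i"
      using P_fin P_ne g_pos unfolding \<epsilon>_def by auto
    define h where "h i = ln (max (g i) \<epsilon>)" for i
    have hP: "h i = ln (g i)" if "i \<in> P" for i using \<epsilon>(2)[OF that] by (simp add: h_def max_def)
    have "antimono_on ?W h"
    proof (rule monotone_onI)
      fix u v assume uv: "u \<in> ?W" "v \<in> ?W" "u \<le> v"
      have "max (g v) \<epsilon> \<le> max (g u) \<epsilon>" using g_am[OF uv] by auto
      then show "h v \<le> h u" unfolding h_def using \<epsilon>(1) by (intro ln_mono) (auto simp: less_max_iff_disj)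
    qed
    then have "(\<Sum>i\<in>?W. (?y i - ?f i) * h i) \<le> 0" by (rule is_isoreg_inner_antimono[OF iso])
    then have 1: "(\<Sum>i\<in>?W. ?y i * h i) \<le> (\<Sum>i\<in>?W. ?f i * h i)"
      by (simp add: left_diff_distrib sum_subtractf)
    have 2: "(\<Sum>i\<in>?W. ?y i * ln (?f i)) = (\<Sum>i\<in>?W. ?f i * ln (?f i))"
      using is_isoreg_inner_self[OF iso, of ln] by (simp add: left_diff_distrib sum_subtractf)
    have restrict_y: "(\<Sum>i\<in>?W. ?y i * u i) = (\<Sum>i\<in>P. ?y i * u i)" for u
      using P_fin y0 by (intro sum.mono_neutral_right) auto
    have restrict_f: "(\<Sum>i\<in>?W. ?f i * u i) = (\<Sum>i\<in>P. ?f i * u i)" for u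
    proof (intro sum.mono_neutral_right ballI)
      fix i assume "i \<in> ?W - P"
      then have "?f i = 0" using f_nn[of i] unfolding P_def by auto
      then show "?f i * u i = 0" by simp
    qed (use P_fin in auto)
    have P1: "sum ?f P = 1" using restrict_f[of "\<lambda>_. 1"] f_sum by simp
    have gP: "sum g P \<le> 1"
      using P_fin W by (intro decreasing_pmfs_finite_sum_le_1[OF gD]) auto
    have ex: "\<exists>i\<in>P. g i \<noteq> ?f i"
    proof (rule ccontr)
      assume "\<not> ?thesis"
      then have eq: "\<And>i. i \<in> P \<Longrightarrow> g i = ?f i" by auto
      then have gP1: "sum g P = 1" using P1 by (simp cong: sum.cong)
      have "g i = ?f i" if "i \<notin> P" for i
      proof -
        have "g i = 0"
        proof (cases "i \<in> idx k")
          case True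
          have "sum g (insert i P) \<le> 1"
            using P_fin W True by (intro decreasing_pmfs_finite_sum_le_1[OF gD]) auto
          then show ?thesis using that P_fin gP1 g_nn[of i] by simp
        qed (use gD in \<open>auto simp: decreasing_pmfs_def\<close>)
        moreover have "?f i = 0"
          using that f_nn[of i] unfolding P_def by (cases "i \<in> ?W") (auto simp: isoreg_outside)
        ultimately show ?thesis by simp
      qed
      then have "g = ?f" using eq by (metis ext)
      then show False using g(2) by simp
    qed
    have "(\<Sum>i\<in>P. ?f i * (ln (g i) - ln (?f i))) < (\<Sum>i\<in>P. g i - ?f i)"
    proof (rule sum_strict_mono_ex1)
      show "\<forall>i\<in>P. ?f i * (ln (g i) - ln (?f i)) \<le> g i - ?f i"
      proof
        fix i assume i: "i \<in> P"
        then have "0 < ?f i" by (simp add: P_def)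
        moreover from this have "ln (g i) - ln (?f i) \<le> (g i - ?f i) / ?f i"
          using g_pos[OF i] by (intro ln_diff_le)
        ultimately show "?f i * (ln (g i) - ln (?f i)) \<le> g i - ?f i"
          by (simp add: pos_le_divide_eq mult.commute)
      qed
      from ex obtain i where i: "i \<in> P" "g i \<noteq> ?f i" by blast
      then have "0 < ?f i" by (simp add: P_def)
      moreover from this have "ln (g i) - ln (?f i) < (g i - ?f i) / ?f i"
        using g_pos[OF i(1)] i(2) by (intro ln_diff_less)
      ultimately show "\<exists>i\<in>P. ?f i * (ln (g i) - ln (?f i)) < g i - ?f i"
        using i(1) by (intro bexI[of _ i]) (simp_all add: pos_less_divide_eq mult.commute)
    qed fact
    also have "\<dots> \<le> 0" using gP P1 by (simp add: sum_subtractf)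
    finally have 3: "(\<Sum>i\<in>P. ?f i * ln (g i)) < (\<Sum>i\<in>P. ?f i * ln (?f i))"
      by (simp add: right_diff_distrib sum_subtractf)
    have hh: "(\<Sum>i\<in>P. u i * h i) = (\<Sum>i\<in>P. u i * ln (g i))" for u
      by (intro sum.cong) (auto simp: hP)
    have "(\<Sum>i\<in>?W. ?y i * ln (g i)) < (\<Sum>i\<in>?W. ?y i * ln (?f i))"
      using 1 2 3 unfolding restrict_y restrict_f hh by linarith
    then have "(\<Sum>i\<in>?W. real (count_list xs i) * ln (g i)) < (\<Sum>i\<in>?W. real (count_list xs i) * ln (?f i))"
      unfolding sum_count[OF g_flat] sum_count[OF f_flat] using xs(1) by simp
    moreover have "L g = exp (\<Sum>i\<in>?W. real (count_list xs i) * ln (g i))"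
      by (rule L_exp) (use True in auto)
    ultimately show ?thesis unfolding L_f by simp
  qed
  show ?thesis
    unfolding flat_mle_def lik by (rule arg_max_on_eqI, rule fF, rule less)
qed

end

section \<open>Comparison of the limits\<close>

text \<open>
  Setting the lengths beyond \<open>m\<close> to 0 makes the sequence total and eventually constant if \<open>m\<close> is finite.
\<close>

definition block_end :: "enat \<Rightarrow> (nat \<Rightarrow> nat) \<Rightarrow> nat \<Rightarrow> nat" where
  "block_end m w J = 1 + (\<Sum>l=1..J. if l \<in> idx m then w l else 0)"

lemma block_end_first_index:
  assumes "Suc j \<in> idx m"
  shows "block_end m w j = first_index w (Suc j)"
    and "block_end m w (Suc j) = first_index w (Suc j) + w (Suc j)"
proof -
  have "l \<in> idx m" if "l \<in> {1..j}" for l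
    using assms that by (auto simp: idx_def intro: order_trans[of "enat l" "enat (Suc j)"])
  then have *: "(\<Sum>l=1..j. if l \<in> idx m then w l else 0) = (\<Sum>l=1..j. w l)" by (intro sum.cong) auto
  then show "block_end m w j = first_index w (Suc j)"
    unfolding block_end_def first_index_def by (simp add: atLeastLessThanSuc_atLeastAtMost)
  then show "block_end m w (Suc j) = first_index w (Suc j) + w (Suc j)"
    using assms unfolding block_end_def by simp
qed

lemma block_end_outside: "Suc j \<notin> idx m \<Longrightarrow> block_end m w (Suc j) = block_end m w j"
  by (simp add: block_end_def)

text \<open>
  If \<open>m = \<infinity>\<close>, all lengths are at least 1, so the sum of the lengths exceeds every natural number. The
  assumption \<open>k \<noteq> 0\<close> excludes that \<open>k\<close> is the default value 0 of a sum that does not converge.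
\<close>

lemma idx_eq_Union_blocks:
  assumes fr: "flat_regions k m w f" and k: "k \<noteq> 0"
  shows "idx k = (\<Union>J. {1..<block_end m w J})"
proof -
  have w: "\<And>j. j \<in> idx m \<Longrightarrow> 1 \<le> w j" and ksum: "k = (\<Sum>\<^sub>\<infinity>j\<in>idx m. enat (w j))"
    using fr unfolding flat_regions_def by auto
  have "enat i \<le> k \<longleftrightarrow> (\<exists>J. i < block_end m w J)" if "1 \<le> i" for i
  proof (cases m)
    case (enat M)
    have idx: "idx m = {1..M}" unfolding idx_def enat by auto
    have "k = (\<Sum>j\<in>{1..M}. enat (w j))" unfolding ksum idx by simp
    also have "\<dots> = enat (\<Sum>j=1..M. w j)"
      by (induction M) (auto simp: zero_enat_def)
    finally have k_eq: "k = enat (\<Sum>j=1..M. w j)" .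
    have le: "(\<Sum>l=1..J. if l \<in> idx m then w l else 0) \<le> (\<Sum>j=1..M. w j)" for J
    proof -
      have "(\<Sum>l=1..J. if l \<in> idx m then w l else 0) = (\<Sum>l\<in>{1..J} \<inter> {1..M}. w l)"
        unfolding idx by (rule sum.inter_restrict[symmetric]) simp
      also have "\<dots> \<le> (\<Sum>j=1..M. w j)" by (intro sum_mono2) auto
      finally show ?thesis .
    qed
    have "(\<Sum>l=1..M. if l \<in> idx m then w l else 0) = (\<Sum>j=1..M. w j)"
      unfolding idx by (intro sum.cong) auto
    then show ?thesis using le k_eq unfolding block_end_def
      by (metis (no_types, lifting) enat_ord_simps(1) less_Suc_eq_le order_trans plus_1_eq_Suc)
  next
    case infinity
    have idx: "idx m = {1..}" unfolding idx_def infinity by auto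
    have part: "enat n \<le> k" for n
    proof (cases "(\<lambda>j. enat (w j)) summable_on idx m")
      case False
      then show ?thesis using k infsum_not_exists[OF False] ksum by simp
    next
      case True
      have "enat n = (\<Sum>j\<in>{1..n}. enat 1)"
        by (simp add: of_nat_eq_enat[symmetric] one_enat_def[symmetric])
      also have "\<dots> \<le> (\<Sum>j\<in>{1..n}. enat (w j))"
        using w idx by (intro sum_mono) auto
      also have "\<dots> = infsum (\<lambda>j. enat (w j)) {1..n}" by simp
      also have "\<dots> \<le> infsum (\<lambda>j. enat (w j)) (idx m)"
        using True by (intro infsum_mono_neutral) (auto simp: idx)
      finally show ?thesis using ksum by simp
    qed
    have "(\<Sum>l=1..i. 1) \<le> (\<Sum>l=1..i. if l \<in> idx m then w l else 0)"
      using w idx by (intro sum_mono) auto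
    then have "i < block_end m w i" by (simp add: block_end_def)
    then show ?thesis using part by auto
  qed
  then show ?thesis by (auto simp: idx_def)
qed

lemma flat_blocks_block_end:
  assumes supp: "set_pmf p = idx k" and fr: "flat_regions k m w (pmf p)"
  shows "flat_blocks p (block_end m w)"
proof -
  let ?b = "block_end m w"
  have k0: "k \<noteq> 0"
  proof
    assume "k = 0"
    then have "set_pmf p = {}" unfolding supp idx_def by (auto simp: zero_enat_def)
    then show False using set_pmf_not_empty by blast
  qed
  have b0: "?b 0 = 1" by (simp add: block_end_def)
  have bm: "mono ?b" by (intro incseq_SucI) (simp add: block_end_def)
  have sup: "set_pmf p = (\<Union>J. {1..<?b J})"
    unfolding supp by (rule idx_eq_Union_blocks[OF fr k0])
  have in_idx: "Suc j \<in> idx m" if "i \<in> {?b j..<?b (Suc j)}" for i j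
    using that block_end_outside[of j m w] by (cases "Suc j \<in> idx m") auto
  have flat: "pmf p i = pmf p (?b j)" if i: "i \<in> {?b j..<?b (Suc j)}" for i j
  proof -
    note j = in_idx[OF i]
    have "i \<in> block w (Suc j)" using i unfolding block_def block_end_first_index[OF j] .
    then show ?thesis using fr j unfolding flat_regions_def block_end_first_index(1)[OF j] by blast
  qed
  have step: "pmf p (?b (Suc j)) < pmf p (?b j)" if "Suc (Suc j) \<in> idx m" for j
  proof -
    have j: "Suc j \<in> idx m" using that by (auto simp: idx_def intro: order_trans[of _ "enat (Suc (Suc j))"])
    show ?thesis using fr j that
      unfolding flat_regions_def block_end_first_index(1)[OF j] block_end_first_index(1)[OF that] by blast
  qed
  have desc: "pmf p (?b (Suc j + l)) < pmf p (?b j)" if "Suc (Suc j + l) \<in> idx m" for j l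
    using that
  proof (induction l)
    case 0
    then show ?case using step by simp
  next
    case (Suc l)
    have "Suc (Suc j + l) \<in> idx m" using Suc.prems by (auto simp: idx_def intro: order_trans[of _ "enat (Suc (Suc j + Suc l))"])
    then show ?case using Suc.IH step[of "Suc j + l"] Suc.prems by simp
  qed
  have drop: "pmf p i' < pmf p i" if i: "1 \<le> i" "i < ?b j" "?b j \<le> i'" for i i' j
  proof (cases "i' \<in> set_pmf p")
    case False
    have "i \<in> set_pmf p" unfolding sup using i by auto
    then show ?thesis using False by (simp add: set_pmf_iff pmf_positive_iff)
  next
    case True
    then obtain J where "i' < ?b J" unfolding sup by auto
    then obtain l' where l': "i' \<in> {?b l'..<?b (Suc l')}"
      using ex_consecutive_endpoints[of ?b i' J] b0 i by (metis dual_order.trans less_imp_le)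
    obtain l where l: "l < j" "i \<in> {?b l..<?b (Suc l)}"
      using ex_consecutive_endpoints[of ?b i j] b0 i by metis
    have "\<not> Suc l' \<le> j"
    proof
      assume "Suc l' \<le> j"
      then have "?b (Suc l') \<le> ?b j" using bm by (simp add: mono_def)
      then show False using l' i by simp
    qed
    then have "l < l'" using l by simp
    then obtain d where d: "l' = Suc l + d" using less_imp_Suc_add by auto
    have "pmf p (?b l') < pmf p (?b l)" unfolding d by (rule desc) (use in_idx[OF l'] d in simp)
    then show ?thesis using flat[OF l'] flat[OF l(2)] by simp
  qed
  show ?thesis by unfold_locales (fact b0 bm sup flat drop)+
qed

lemma flat_decreasing_pmfs_eq:
  assumes "flat_blocks p (block_end m w)"
  shows "flat_decreasing_pmfs k m w = {f \<in> decreasing_pmfs k. flat_blocks.blockwise_constant (block_end m w) f}"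
proof -
  interpret flat_blocks p "block_end m w" by fact
  have "(\<forall>j\<in>idx m. \<forall>i\<in>block w j. f i = f (first_index w j)) \<longleftrightarrow> blockwise_constant f" for f :: "nat \<Rightarrow> real"
  proof
    assume *: "\<forall>j\<in>idx m. \<forall>i\<in>block w j. f i = f (first_index w j)"
    show "blockwise_constant f" unfolding blockwise_constant_def
    proof (intro allI ballI)
      fix j i assume i: "i \<in> {block_end m w j..<block_end m w (Suc j)}"
      then have j: "Suc j \<in> idx m" using block_end_outside[of j m w] by (cases "Suc j \<in> idx m") auto
      then show "f i = f (block_end m w j)"
        using * i unfolding block_def block_end_first_index[OF j] by blast
    qed
  next
    assume *: "blockwise_constant f"
    show "\<forall>j\<in>idx m. \<forall>i\<in>block w j. f i = f (first_index w j)"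
    proof (intro ballI)
      fix j i assume j: "j \<in> idx m" and i: "i \<in> block w j"
      then obtain j' where j': "j = Suc j'" by (cases j) (auto simp: idx_def)
      show "f i = f (first_index w j)"
        using * i j unfolding blockwise_constant_def block_def j' block_end_first_index[of j' m w, symmetric]
        by (metis block_end_first_index)
    qed
  qed
  then show ?thesis unfolding flat_decreasing_pmfs_def by simp
qed

lemma harm_ge_of_bool: "of_bool (0 < n) \<le> (harm n :: real)"
  using harm_mono[of 1 n, where 'a = real] by (cases n) (auto simp: harm_expand)

lemma harm_eq_of_bool_iff: "(harm n :: real) = of_bool (0 < n) \<longleftrightarrow> n \<le> 1"
proof (cases "n \<le> 1")
  case True
  then have "n = 0 \<or> n = Suc 0" by auto
  then show ?thesis using True by (auto simp: harm_expand)
next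
  case False
  then have "harm 2 \<le> (harm n :: real)" by (intro harm_mono) auto
  moreover have "harm 2 = (3 / 2 :: real)" by (simp add: harm_expand)
  ultimately show ?thesis using False by auto
qed

context flat_blocks
begin

lemma block_risk_diff:
  "isoreg_block_risk j - average_block_risk j =
    pmf p (b j) * (harm (b (Suc j) - b j) - of_bool (b j < b (Suc j)))"
  by (simp add: isoreg_block_risk_def average_block_risk_def algebra_simps)

lemma average_block_risk_le: "average_block_risk j \<le> isoreg_block_risk j"
proof -
  have "0 \<le> pmf p (b j) * (harm (b (Suc j) - b j) - of_bool (0 < b (Suc j) - b j))"
    by (intro mult_nonneg_nonneg) (simp_all only: pmf_nonneg diff_ge_0_iff_ge harm_ge_of_bool)
  then show ?thesis using block_risk_diff[of j] by (simp only: zero_less_diff)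
qed

text \<open>
  On a nonempty region with common probability \<open>q\<close> the two risks differ by \<open>q * (H - 1)\<close>, where the
  harmonic number \<open>H\<close> of the length is 1 only for length 1.
\<close>

lemma average_block_risk_eq_iff:
  "average_block_risk j = isoreg_block_risk j \<longleftrightarrow> b (Suc j) - b j \<le> 1"
proof (cases "b j < b (Suc j)")
  case True
  then have "0 < pmf p (b j)" by (intro pmf_pos b_pos)
  then have "average_block_risk j = isoreg_block_risk j \<longleftrightarrow>
      harm (b (Suc j) - b j) = (of_bool (0 < b (Suc j) - b j) :: real)"
    using block_risk_diff[of j] by auto
  then show ?thesis by (simp only: harm_eq_of_bool_iff)
next
  case False
  then have "b (Suc j) - b j = 0" by simp
  then show ?thesis by (simp add: isoreg_block_risk_def average_block_risk_def harm_expand)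
qed

lemma strict_antimono_iff_small_blocks:
  "strict_antimono_on (set_pmf p) (pmf p) \<longleftrightarrow> (\<forall>j. b (Suc j) - b j \<le> 1)"
proof
  assume *: "strict_antimono_on (set_pmf p) (pmf p)"
  show "\<forall>j. b (Suc j) - b j \<le> 1"
  proof (rule allI, rule ccontr)
    fix j assume "\<not> b (Suc j) - b j \<le> 1"
    then have j: "b j \<in> {b j..<b (Suc j)}" "Suc (b j) \<in> {b j..<b (Suc j)}" by auto
    then have "b j \<in> set_pmf p" "Suc (b j) \<in> set_pmf p"
      using pmf_pos[of "b j" "Suc j"] pmf_pos[of "Suc (b j)" "Suc j"] b_pos[of j]
      by (auto simp: pmf_positive_iff)
    then have "pmf p (Suc (b j)) < pmf p (b j)" using * by (auto simp: monotone_on_def)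
    then show False using flat[OF j(2)] by simp
  qed
next
  assume *: "\<forall>j. b (Suc j) - b j \<le> 1"
  show "strict_antimono_on (set_pmf p) (pmf p)"
  proof (rule monotone_onI)
    fix i i' assume i: "i \<in> set_pmf p" "i < i'"
    then obtain J where "1 \<le> i" "i < b J" unfolding support by auto
    then obtain j where j: "i \<in> {b j..<b (Suc j)}" using block_exists by metis
    have "b (Suc j) \<le> i'" using *[rule_format, of j] j i(2) by auto
    then show "pmf p i' < pmf p i" using j \<open>1 \<le> i\<close> by (intro drop[of i "Suc j"]) auto
  qed
qed

end

lemma l2_sq_eq_suminf:
  assumes f: "\<And>i. i \<notin> idx k \<Longrightarrow> f i = 0" "\<And>i. i \<notin> idx k \<Longrightarrow> q i = 0"
    and summ: "summable (\<lambda>i. (f i - q i)\<^sup>2)"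
  shows "l2_sq k f q = (\<Sum>i. (f i - q i)\<^sup>2)"
proof -
  have "((\<lambda>i. (f i - q i)\<^sup>2) has_sum (\<Sum>i. (f i - q i)\<^sup>2)) UNIV"
    using summ by (intro norm_summable_imp_has_sum) (auto intro: summable_sums)
  then have "(\<Sum>\<^sub>\<infinity>i\<in>UNIV. (f i - q i)\<^sup>2) = (\<Sum>i. (f i - q i)\<^sup>2)" by (rule infsumI)
  moreover have "l2_sq k f q = (\<Sum>\<^sub>\<infinity>i\<in>UNIV. (f i - q i)\<^sup>2)"
    unfolding l2_sq_def using f by (intro infsum_cong_neutral) auto
  ultimately show ?thesis by simp
qed

text \<open>
  An estimator that depends on the first \<open>n\<close> observations only may be evaluated on a random list.
\<close>

lemma scaled_risk_eq_expectation:
  assumes "prob_space M" and "prob_space.indep_vars M (\<lambda>_. count_space UNIV) X {1..}"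
    and "\<forall>l\<ge>1. distr M (count_space UNIV) (X l) = measure_pmf p"
    and sample: "\<And>n x. estim n x = estim n (\<lambda>l. map x [1..<Suc n] ! (l - 1))"
  shows "scaled_risk M X loss estim q n = measure_pmf.expectation (replicate_pmf n p)
     (\<lambda>xs. real n * loss (estim (length xs) (\<lambda>l. xs ! (l - 1))) q)"
proof -
  interpret prob_space M by fact
  let ?Y = "\<lambda>\<omega>. map (\<lambda>l. X l \<omega>) [1..<Suc n]"
  let ?g = "\<lambda>xs. real n * loss (estim n (\<lambda>l. xs ! (l - 1))) q"
  have distr: "distr M (count_space UNIV) (X l) = measure_pmf p" if "l \<ge> 1" for l
    using assms(3) that by blast
  have Y: "?Y \<in> measurable M (count_space UNIV)"
    "distr M (count_space UNIV) ?Y = measure_pmf (replicate_pmf n p)"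
    by (rule distr_sample_eq_replicate_pmf[OF assms(2)], erule distr)+
  have "scaled_risk M X loss estim q n = (\<integral>\<omega>. ?g (?Y \<omega>) \<partial>M)"
    unfolding scaled_risk_def by (subst sample) (rule refl)
  also have "\<dots> = (\<integral>xs. ?g xs \<partial>distr M (count_space UNIV) ?Y)"
    by (rule integral_distr[symmetric, OF Y(1)]) simp_all
  also have "\<dots> = measure_pmf.expectation (replicate_pmf n p) ?g" unfolding Y(2) ..
  also have "\<dots> = measure_pmf.expectation (replicate_pmf n p)
     (\<lambda>xs. real n * loss (estim (length xs) (\<lambda>l. xs ! (l - 1))) q)"
    by (intro integral_cong_AE) (auto simp: AE_measure_pmf_iff set_replicate_pmf)
  finally show ?thesis .
qed

lemma estimators_depend_on_sample:
  "grenander k n x = grenander k n (\<lambda>l. map x [1..<Suc n] ! (l - 1))"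
  "flat_mle k m w n x = flat_mle k m w n (\<lambda>l. map x [1..<Suc n] ! (l - 1))"
proof -
  have c: "count_obs n (\<lambda>l. map x [1..<Suc n] ! (l - 1)) = count_obs n x"
    using count_obs_nth[of "map x [1..<Suc n]"] count_obs_sample[of n x]
    by (auto simp: fun_eq_iff simp del: upt_Suc)
  show "grenander k n x = grenander k n (\<lambda>l. map x [1..<Suc n] ! (l - 1))"
    unfolding grenander_def empirical_def c ..
  show "flat_mle k m w n x = flat_mle k m w n (\<lambda>l. map x [1..<Suc n] ! (l - 1))"
    unfolding flat_mle_def likelihood_def c ..
qed

lemma (in blockwise_estimator) scaled_risk_l2_tendsto:
  assumes k: "idx k = set_pmf p"
    and M: "prob_space M" "prob_space.indep_vars M (\<lambda>_. count_space UNIV) X {1..}"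
      "\<forall>l\<ge>1. distr M (count_space UNIV) (X l) = measure_pmf p"
    and sample: "\<And>n x. estim n x = estim n (\<lambda>l. map x [1..<Suc n] ! (l - 1))"
    and est_def: "est = (\<lambda>xs. estim (length xs) (\<lambda>l. xs ! (l - 1)))"
  shows "scaled_risk M X (l2_sq k) estim (pmf p) \<longlonglongrightarrow> suminf c"
proof -
  have "scaled_risk M X (l2_sq k) estim (pmf p) n = l2_risk n" if n: "0 < n" for n
    unfolding scaled_risk_eq_expectation[where estim = estim, OF M sample] l2_risk_def
  proof (intro integral_cong_AE)
    have "l2_sq k (est xs) (pmf p) = (\<Sum>i. err xs i)" if xs: "xs \<in> set_pmf (Q n)" for xs
      unfolding err_def
    proof (rule l2_sq_eq_suminf)
      show "summable (\<lambda>i. (est xs i - pmf p i)\<^sup>2)"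
        using err_bounds(3)[OF xs n, of "\<lambda>_. True"] by (simp add: err_def)
      fix i assume i: "i \<notin> idx k"
      then show "pmf p i = 0" by (simp add: k set_pmf_iff)
      obtain J' where J': "set xs \<subseteq> {1..<b J'}" using window[OF xs] by blast
      have "i \<notin> {1..<b J'}" using i unfolding k support by blast
      then show "est xs i = 0" unfolding est[OF sample_nonempty[OF xs n] J'] by (rule isoreg_outside)
    qed
    then show "AE xs in Q n. real n * l2_sq k (estim (length xs) (\<lambda>l. xs ! (l - 1))) (pmf p) = real n * (\<Sum>i. err xs i)"
      by (simp add: AE_measure_pmf_iff est_def)
  qed auto
  then have "\<forall>\<^sub>F n in sequentially. l2_risk n = scaled_risk M X (l2_sq k) estim (pmf p) n"
    by (intro eventually_mono[OF eventually_gt_at_top[of 0]]) simp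
  then show ?thesis by (rule Lim_transform_eventually[OF l2_risk_tendsto])
qed

lemma (in blockwise_estimator) scaled_risk_hellinger_tendsto:
  assumes k: "idx k = {1..<b J}"
    and M: "prob_space M" "prob_space.indep_vars M (\<lambda>_. count_space UNIV) X {1..}"
      "\<forall>l\<ge>1. distr M (count_space UNIV) (X l) = measure_pmf p"
    and sample: "\<And>n x. estim n x = estim n (\<lambda>l. map x [1..<Suc n] ! (l - 1))"
    and est_def: "est = (\<lambda>xs. estim (length xs) (\<lambda>l. xs ! (l - 1)))"
  shows "scaled_risk M X (hellinger_sq k) estim (pmf p) \<longlonglongrightarrow> (\<Sum>j<J. c j / (8 * pmf p (b j)))"
proof -
  have "estim (length xs) (\<lambda>l. xs ! (l - 1)) = est xs" for xs
    unfolding est_def ..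
  note * = scaled_risk_eq_expectation[where estim = estim, OF M sample, unfolded this]
  have "scaled_risk M X (hellinger_sq k) estim (pmf p) = hellinger_risk (b J)"
    unfolding fun_eq_iff * hellinger_risk_def hellinger_sq_def k by simp
  then show ?thesis using hellinger_risk_tendsto by simp
qed

theorem lemma5:
  fixes p :: "nat pmf" and k m :: enat and w :: "nat \<Rightarrow> nat"
    and M :: "'a measure" and X :: "nat \<Rightarrow> 'a \<Rightarrow> nat"
  assumes "0 \<notin> set_pmf p"
    and "k = (SUP i\<in>{i. 0 < pmf p i}. enat i)"
    and "\<forall>i\<in>idx k. 0 < pmf p i"
    and "flat_regions k m w (pmf p)"
    and "prob_space M"
    and "prob_space.indep_vars M (\<lambda>_. count_space UNIV) X {1..}"
    and "\<forall>l\<ge>1. distr M (count_space UNIV) (X l) = measure_pmf p"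
  shows
    "(let R_star = scaled_risk M X (l2_sq k) (flat_mle k m w) (pmf p);
          R_G = scaled_risk M X (l2_sq k) (grenander k) (pmf p)
      in convergent R_star \<and> convergent R_G \<and> lim R_star \<le> lim R_G \<and>
         (lim R_star = lim R_G \<longleftrightarrow> strict_antimono_on (idx k) (pmf p))) \<and>
     (k < \<infinity> \<longrightarrow>
      (let R_star = scaled_risk M X (hellinger_sq k) (flat_mle k m w) (pmf p);
           R_G = scaled_risk M X (hellinger_sq k) (grenander k) (pmf p)
       in convergent R_star \<and> convergent R_G \<and> lim R_star \<le> lim R_G \<and>
          (lim R_star = lim R_G \<longleftrightarrow> strict_antimono_on (idx k) (pmf p))))"
proof -
  let ?b = "block_end m w"
  have supp: "set_pmf p = idx k"
  proof (intro equalityI subsetI)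
    fix i assume i: "i \<in> set_pmf p"
    then have "enat i \<le> k" unfolding assms(2) by (intro SUP_upper) (simp add: pmf_positive_iff)
    moreover have "i \<noteq> 0" using i assms(1) by metis
    ultimately show "i \<in> idx k" by (simp add: idx_def)
  qed (use assms(3) in \<open>auto simp: pmf_positive_iff\<close>)
  have fb: "flat_blocks p ?b" by (rule flat_blocks_block_end[OF supp assms(4)])
  interpret flat_blocks p ?b by (rule fb)
  have W: "{1..<?b J} \<subseteq> idx k" for J using supp support by blast
  have avg_sum: "sum (block_average y) {1..<?b J} = sum y {1..<?b J}" for y J
    by (simp only: sum_blocks sum_block_average)
  let ?gest = "\<lambda>xs. grenander k (length xs) (\<lambda>l. xs ! (l - 1))"
  let ?fest = "\<lambda>xs. flat_mle k m w (length xs) (\<lambda>l. xs ! (l - 1))"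
  interpret G: blockwise_estimator p ?b emp ?gest isoreg_block_risk
  proof (unfold_locales, goal_cases)
    case (1 xs J) then show ?case by (intro grenander_eq_isoreg W)
  next
    case (3 xs J) then show ?case by (intro sum_emp_eq_1) auto
  next
    case (6 n j) then show ?case by (rule expectation_isoreg_block)
  qed (auto simp: emp_nonneg)
  interpret F: blockwise_estimator p ?b "\<lambda>xs. block_average (emp xs)" ?fest average_block_risk
  proof (unfold_locales, goal_cases)
    case (1 xs J)
    then show ?case by (intro flat_mle_eq_isoreg[OF supp[symmetric] flat_decreasing_pmfs_eq[OF fb]])
  next
    case (2 xs i) show ?case by (intro block_average_nonneg emp_nonneg)
  next
    case (3 xs J) then show ?case unfolding avg_sum by (intro sum_emp_eq_1) auto
  next
    case (4 xs d i) then show ?case by (intro block_average_close)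
  next
    case (5 xs j) show ?case by (rule block_average_contraction)
  next
    case (6 n j) then show ?case by (rule expectation_average_block)
  qed
  note sampling = assms(5-7)
  have l2: "scaled_risk M X (l2_sq k) (flat_mle k m w) (pmf p) \<longlonglongrightarrow> suminf average_block_risk"
    "scaled_risk M X (l2_sq k) (grenander k) (pmf p) \<longlonglongrightarrow> suminf isoreg_block_risk"
    using F.scaled_risk_l2_tendsto[OF supp[symmetric] sampling estimators_depend_on_sample(2) refl]
      G.scaled_risk_l2_tendsto[OF supp[symmetric] sampling estimators_depend_on_sample(1) refl] .
  have le: "suminf average_block_risk \<le> suminf isoreg_block_risk"
    by (intro suminf_le average_block_risk_le F.summable_c G.summable_c)
  have "suminf average_block_risk = suminf isoreg_block_risk \<longleftrightarrow>
      (\<Sum>j. isoreg_block_risk j - average_block_risk j) = 0"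
    using suminf_diff[OF G.summable_c F.summable_c] by auto
  also have "\<dots> \<longleftrightarrow> (\<forall>j. isoreg_block_risk j - average_block_risk j = 0)"
    by (intro suminf_eq_zero_iff summable_diff F.summable_c G.summable_c)
      (simp add: average_block_risk_le)
  also have "\<dots> \<longleftrightarrow> (\<forall>j. average_block_risk j = isoreg_block_risk j)" by auto
  also have "\<dots> \<longleftrightarrow> strict_antimono_on (idx k) (pmf p)"
    unfolding average_block_risk_eq_iff strict_antimono_iff_small_blocks[symmetric] supp ..
  finally have eq: "suminf average_block_risk = suminf isoreg_block_risk \<longleftrightarrow> strict_antimono_on (idx k) (pmf p)" .
  have hell: "let R_star = scaled_risk M X (hellinger_sq k) (flat_mle k m w) (pmf p);
           R_G = scaled_risk M X (hellinger_sq k) (grenander k) (pmf p)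
       in convergent R_star \<and> convergent R_G \<and> lim R_star \<le> lim R_G \<and>
          (lim R_star = lim R_G \<longleftrightarrow> strict_antimono_on (idx k) (pmf p))" if fin: "k < \<infinity>"
  proof -
    obtain N where N: "k = enat N" using fin by auto
    have idxN: "idx k = {1..N}" by (auto simp: idx_def N)
    then have "1 \<le> N" using set_pmf_not_empty[of p] supp by auto
    then have "N \<in> (\<Union>J. {1..<?b J})" using idxN supp support by auto
    then obtain J where J: "N < ?b J" by auto
    have idxJ: "idx k = {1..<?b J}" using W[of J] J idxN by auto
    define h where "h c = (\<Sum>j<J. c j / (8 * pmf p (?b j)))" for c :: "nat \<Rightarrow> real"
    have lims: "scaled_risk M X (hellinger_sq k) (flat_mle k m w) (pmf p) \<longlonglongrightarrow> h average_block_risk"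
      "scaled_risk M X (hellinger_sq k) (grenander k) (pmf p) \<longlonglongrightarrow> h isoreg_block_risk"
      unfolding h_def
      using F.scaled_risk_hellinger_tendsto[OF idxJ sampling estimators_depend_on_sample(2) refl]
        G.scaled_risk_hellinger_tendsto[OF idxJ sampling estimators_depend_on_sample(1) refl] .
    have diff: "h isoreg_block_risk - h average_block_risk =
        (\<Sum>j<J. (isoreg_block_risk j - average_block_risk j) / (8 * pmf p (?b j)))"
      unfolding h_def sum_subtractf[symmetric] diff_divide_distrib ..
    have nn: "0 \<le> (isoreg_block_risk j - average_block_risk j) / (8 * pmf p (?b j))" for j
      by (simp add: average_block_risk_le)
    have hle: "h average_block_risk \<le> h isoreg_block_risk"
      using diff sum_nonneg[of "{..<J}" "\<lambda>j. (isoreg_block_risk j - average_block_risk j) / (8 * pmf p (?b j))"] nn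
      by simp
    have "h average_block_risk = h isoreg_block_risk \<longleftrightarrow>
        (\<forall>j<J. (isoreg_block_risk j - average_block_risk j) / (8 * pmf p (?b j)) = 0)"
      using diff sum_nonneg_eq_0_iff[of "{..<J}" "\<lambda>j. (isoreg_block_risk j - average_block_risk j) / (8 * pmf p (?b j))"] nn
      by auto
    also have "\<dots> \<longleftrightarrow> (\<forall>j. average_block_risk j = isoreg_block_risk j)"
    proof
      assume *: "\<forall>j<J. (isoreg_block_risk j - average_block_risk j) / (8 * pmf p (?b j)) = 0"
      show "\<forall>j. average_block_risk j = isoreg_block_risk j"
      proof
        fix j
        show "average_block_risk j = isoreg_block_risk j"
        proof (cases "?b j < ?b (Suc j)")
          case False
          then show ?thesis unfolding average_block_risk_eq_iff by simp
        next
          case True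
          then have "?b j \<in> {1..<?b (Suc j)}" using b_pos by simp
          then have "?b j \<in> {1..<?b J}" using W[of "Suc j"] idxJ by blast
          then have "j < J" using b_le[of J j] by (intro ccontr[of "j < J"]) auto
          moreover have "0 < pmf p (?b j)" using True by (intro pmf_pos b_pos)
          ultimately show ?thesis using * by auto
        qed
      qed
    qed auto
    also have "\<dots> \<longleftrightarrow> strict_antimono_on (idx k) (pmf p)"
      unfolding average_block_risk_eq_iff strict_antimono_iff_small_blocks[symmetric] supp ..
    finally show ?thesis
      using hle lims by (simp add: Let_def convergentI limI)
  qed
  show ?thesis
    using l2 le eq hell by (simp add: Let_def convergentI limI)
qed

end
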